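(* Let $u$ be the function defined in the context. Then for every $\mathcal{L}$-process $X=((\mathsf{t}_s,x_s),P_{t,x})$ the representation $$u(t,x)=E_{t,x}\,g(x_{1-t})$$ holds at all points $(t,x)\in(-\infty,1)\times\mathbb{R}$ apart from the origin $(0,0)$ (at which point $u$ is discontinuous, i.e. $u(t,x)$ has no limit as $(t,x)\to(0,0)$).
   Context: Fix $\nu\in(1/2,1)$. Let $\partial_t=\partial/\partial t$, $D=\partial/\partial x$, $b(t,x)=I_{t>0}\,t^{-\nu}\operatorname{sign}x$ for $(t,x)\in\mathbb{R}^2$, and $\mathcal{L}u=\partial_tu+\tfrac12D^2u+b\,Du$. Let $g(x)=\zeta(|x|)\operatorname{sign}x$, where $\zeta\ge0$ is infinitely differentiable, nondecreasing, $\zeta(r)=0$ for $r\le1/2$, $\zeta(r)=1$ for $r\ge1$. Let $G=\big((-\infty,1]\times\mathbb{R}\big)\setminus\{(0,0)\}$ and $B(t)=\int_{-\infty}^tI_{s>0}s^{-\nu}ds$. The function $u$ is the unique bounded continuous function on $G$, odd in $x$, having Sobolev derivatives $\partial_tu,Du,D^2u$ there, satisfying $\mathcal{L}u=0$ a.e. in $(-\infty,1)\times\mathbb{R}$ and $u(1,x)=g(x)$ on $\mathbb{R}$, and such that: (a) $Du$ is continuous in $G$ and all other derivatives of $u$ with respect to $x$ are continuous in $\big((-\infty,1)\times\mathbb{R}\big)\setminus\big([0,1]\times\{0\}\big)$; (b) $u-g\in W^{1,2}_p((\delta,1)\times\mathbb{R})$ for any $p>1$, $\delta\in(0,1)$ (i.e.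 $u-g$ and its Sobolev derivatives $\partial_t,D,D^2$ are in $L_p$), and in $(-\infty,-\delta]\times\mathbb{R}$ $u$ is infinitely differentiable with each derivative bounded, for any $\delta>0$; (c) $u(t,x)$ is nondecreasing in $x$ for any $t\le1$; (d) $v(t,x):=u(t,x+B(t))$ is bounded and continuous in $G$, infinitely differentiable in $\Gamma=\big((-\infty,1)\times\mathbb{R}\big)\cap\{x+B(t)>0\}$ and satisfies $\partial_tv+\tfrac12D^2v=0$ there. (Existence and uniqueness of such $u$ is known.) An $\mathcal{L}$-process is a strong Markov $\mathbb{R}^2$-valued diffusion process $X=((\mathsf{t}_s,x_s),P_{t,x})$, $s\ge0$, $(t,x)\in\mathbb{R}^2$, such that for every $(t,x)\in\mathbb{R}^2$ the distribution of its trajectories under $P_{t,x}$ is the distribution of a solution, for some one-dimensional Wiener process $w$ on some probability space, of the system $$\mathsf{t}_s=t+s,\qquad x_s=x+w_s+\int_0^s I_{\mathsf{t}_r>0}\,\mathsf{t}_r^{-\nu}\operatorname{sign}x_r\,dr,\qquad s\ge0.$$ $E_{t,x}$ is the expectation with respect to $P_{t,x}$. *)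

theory Defs
  imports "HOL-Probability.Probability"
begin

section \<open>Calculus in the plane\<close>

text \<open>Points of the plane are pairs \<open>(t, x)\<close>; functions are total, and their values outside the
  set where they are meant to be defined are never used.\<close>

definition Dt :: "(real \<times> real \<Rightarrow> real) \<Rightarrow> real \<times> real \<Rightarrow> real" where
  "Dt f = (\<lambda>(t, x). deriv (\<lambda>s. f (s, x)) t)"

definition Dx :: "(real \<times> real \<Rightarrow> real) \<Rightarrow> real \<times> real \<Rightarrow> real" where
  "Dx f = (\<lambda>(t, x). deriv (\<lambda>y. f (t, y)) x)"

definition has_Dx_on :: "(real \<times> real) set \<Rightarrow> (real \<times> real \<Rightarrow> real) \<Rightarrow> bool" where
  "has_Dx_on S f \<longleftrightarrow> (\<forall>(t, x)\<in>S. (\<lambda>y. f (t, y)) differentiable at x)"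

text \<open>A finite word \<open>ds\<close> over \<open>Dt\<close>, \<open>Dx\<close> encodes a mixed partial derivative of arbitrary order.\<close>

definition iter_D ::
  "((real \<times> real \<Rightarrow> real) \<Rightarrow> real \<times> real \<Rightarrow> real) list
    \<Rightarrow> (real \<times> real \<Rightarrow> real) \<Rightarrow> real \<times> real \<Rightarrow> real" where
  "iter_D ds f = foldr (\<lambda>D h. D h) ds f"

definition smooth_on :: "(real \<times> real) set \<Rightarrow> (real \<times> real \<Rightarrow> real) \<Rightarrow> bool" where
  "smooth_on S f \<longleftrightarrow> (\<forall>ds\<in>lists {Dt, Dx}. \<forall>z\<in>S. iter_D ds f differentiable at z)"

definition smooth_real :: "(real \<Rightarrow> real) \<Rightarrow> bool" where
  "smooth_real f \<longleftrightarrow> (\<forall>n r. (deriv ^^ n) f differentiable at r)"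

definition test_function :: "(real \<times> real) set \<Rightarrow> (real \<times> real \<Rightarrow> real) \<Rightarrow> bool" where
  "test_function \<Omega> \<phi> \<longleftrightarrow>
     smooth_on UNIV \<phi> \<and> (\<exists>K. compact K \<and> K \<subseteq> \<Omega> \<and> (\<forall>z. z \<notin> K \<longrightarrow> \<phi> z = 0))"

definition locally_integrable :: "(real \<times> real) set \<Rightarrow> (real \<times> real \<Rightarrow> real) \<Rightarrow> bool" where
  "locally_integrable \<Omega> f \<longleftrightarrow> (\<forall>K. compact K \<and> K \<subseteq> \<Omega> \<longrightarrow> set_integrable lborel K f)"

text \<open>\<open>h\<close> is the Sobolev derivative \<open>\<partial>\<^sub>t\<^sup>i D\<^sup>j f\<close> in the open set \<open>\<Omega>\<close>.\<close>

definition sobolev_deriv ::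
  "nat \<Rightarrow> nat \<Rightarrow> (real \<times> real) set \<Rightarrow> (real \<times> real \<Rightarrow> real) \<Rightarrow> (real \<times> real \<Rightarrow> real) \<Rightarrow> bool" where
  "sobolev_deriv i j \<Omega> f h \<longleftrightarrow>
     locally_integrable \<Omega> f \<and> locally_integrable \<Omega> h \<and>
     (\<forall>\<phi>. test_function \<Omega> \<phi> \<longrightarrow>
        (LINT z:\<Omega>|lborel. f z * (Dt ^^ i) ((Dx ^^ j) \<phi>) z)
          = (-1) ^ (i + j) * (LINT z:\<Omega>|lborel. h z * \<phi> z))"

definition in_Lp :: "real \<Rightarrow> (real \<times> real) set \<Rightarrow> (real \<times> real \<Rightarrow> real) \<Rightarrow> bool" where
  "in_Lp p \<Omega> f \<longleftrightarrow> set_borel_measurable lborel \<Omega> f \<and>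
     set_integrable lborel \<Omega> (\<lambda>z. \<bar>f z\<bar> powr p)"

definition in_W12 :: "real \<Rightarrow> (real \<times> real) set \<Rightarrow> (real \<times> real \<Rightarrow> real) \<Rightarrow> bool" where
  "in_W12 p \<Omega> f \<longleftrightarrow> in_Lp p \<Omega> f \<and>
     (\<exists>ft fx fxx. sobolev_deriv 1 0 \<Omega> f ft \<and> sobolev_deriv 0 1 \<Omega> f fx \<and>
        sobolev_deriv 0 2 \<Omega> f fxx \<and> in_Lp p \<Omega> ft \<and> in_Lp p \<Omega> fx \<and> in_Lp p \<Omega> fxx)"


section \<open>The equation\<close>

definition drift :: "real \<Rightarrow> real \<times> real \<Rightarrow> real" where
  "drift \<nu> = (\<lambda>(t, x). if t > 0 then t powr (-\<nu>) * sgn x else 0)"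

definition cum_drift :: "real \<Rightarrow> real \<Rightarrow> real" where
  "cum_drift \<nu> t = (LINT s:{..t}|lborel. if s > 0 then s powr (-\<nu>) else 0)"

definition cutoff :: "(real \<Rightarrow> real) \<Rightarrow> bool" where
  "cutoff \<zeta> \<longleftrightarrow> smooth_real \<zeta> \<and> mono \<zeta> \<and> (\<forall>r. \<zeta> r \<ge> 0) \<and>
     (\<forall>r\<le>1/2. \<zeta> r = 0) \<and> (\<forall>r\<ge>1. \<zeta> r = 1)"

definition terminal :: "(real \<Rightarrow> real) \<Rightarrow> real \<Rightarrow> real" where
  "terminal \<zeta> x = \<zeta> \<bar>x\<bar> * sgn x"

definition dom_G :: "(real \<times> real) set" where
  "dom_G = ({..1} \<times> UNIV) - {(0, 0)}"

definition dom_Gamma :: "real \<Rightarrow> (real \<times> real) set" where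
  "dom_Gamma \<nu> = {(t, x). t < 1 \<and> x + cum_drift \<nu> t > 0}"

definition dom_xsmooth :: "(real \<times> real) set" where
  "dom_xsmooth = ({..<1} \<times> UNIV) - ({0..1} \<times> {0})"

definition shifted :: "real \<Rightarrow> (real \<times> real \<Rightarrow> real) \<Rightarrow> real \<times> real \<Rightarrow> real" where
  "shifted \<nu> u = (\<lambda>(t, x). u (t, x + cum_drift \<nu> t))"

text \<open>Sobolev derivatives are functions on open sets, hence \<open>interior dom_G\<close>, which differs from
  \<open>{..<1} \<times> UNIV\<close> by the origin only.\<close>

definition sobolev_solution :: "real \<Rightarrow> (real \<times> real \<Rightarrow> real) \<Rightarrow> bool" where
  "sobolev_solution \<nu> u \<longleftrightarrow>
     (\<exists>ut ux uxx. sobolev_deriv 1 0 (interior dom_G) u ut \<and>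
        sobolev_deriv 0 1 (interior dom_G) u ux \<and>
        sobolev_deriv 0 2 (interior dom_G) u uxx \<and>
        (AE z in lborel. z \<in> {..<1} \<times> UNIV \<longrightarrow> ut z + 1/2 * uxx z + drift \<nu> z * ux z = 0))"

definition is_solution_u :: "real \<Rightarrow> (real \<Rightarrow> real) \<Rightarrow> (real \<times> real \<Rightarrow> real) \<Rightarrow> bool" where
  "is_solution_u \<nu> g u \<longleftrightarrow>
     bounded (u ` dom_G) \<and> continuous_on dom_G u \<and>
     (\<forall>(t, x)\<in>dom_G. u (t, -x) = - u (t, x)) \<and>
     sobolev_solution \<nu> u \<and>
     (\<forall>x. u (1, x) = g x) \<and>
     has_Dx_on dom_G u \<and> continuous_on dom_G (Dx u) \<and>
     (\<forall>n. has_Dx_on dom_xsmooth ((Dx ^^ n) u) \<and> continuous_on dom_xsmooth ((Dx ^^ n) u)) \<and>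
     (\<forall>p>1. \<forall>\<delta>\<in>{0<..<1}. in_W12 p ({\<delta><..<1} \<times> UNIV) (\<lambda>(t, x). u (t, x) - g x)) \<and>
     (\<forall>\<delta>>0. smooth_on ({..-\<delta>} \<times> UNIV) u \<and>
        (\<forall>ds\<in>lists {Dt, Dx}. bounded (iter_D ds u ` ({..-\<delta>} \<times> UNIV)))) \<and>
     (\<forall>t x y. (t, x) \<in> dom_G \<and> (t, y) \<in> dom_G \<and> x \<le> y \<longrightarrow> u (t, x) \<le> u (t, y)) \<and>
     bounded (shifted \<nu> u ` dom_G) \<and> continuous_on dom_G (shifted \<nu> u) \<and>
     smooth_on (dom_Gamma \<nu>) (shifted \<nu> u) \<and>
     (\<forall>z\<in>dom_Gamma \<nu>. Dt (shifted \<nu> u) z + 1/2 * Dx (Dx (shifted \<nu> u)) z = 0)"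


section \<open>Diffusion processes\<close>

text \<open>Time is \<open>[0, \<infinity>]\<close> for filtrations and stopping times (so that a stopping time may be infinite)
  and \<open>[0, \<infinity>)\<close>, a subset of the reals, for trajectories.\<close>

definition filtration_on :: "'w measure \<Rightarrow> (ennreal \<Rightarrow> 'w measure) \<Rightarrow> bool" where
  "filtration_on M F \<longleftrightarrow> filtration (space M) F \<and> (\<forall>s. sets (F s) \<subseteq> sets M)"

definition adapted :: "(ennreal \<Rightarrow> 'w measure) \<Rightarrow> (real \<Rightarrow> 'w \<Rightarrow> 'a::topological_space) \<Rightarrow> bool" where
  "adapted F X \<longleftrightarrow> (\<forall>s\<ge>0. X s \<in> borel_measurable (F (ennreal s)))"

text \<open>\<open>M\<close> serves only as the measurable space of elementary events; \<open>P z\<close> is the law for the initial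
  point \<open>z\<close>.\<close>

definition strong_Markov_diffusion ::
  "'w measure \<Rightarrow> (ennreal \<Rightarrow> 'w measure) \<Rightarrow> (real \<Rightarrow> 'w \<Rightarrow> 'a::topological_space)
    \<Rightarrow> ('a \<Rightarrow> 'w measure) \<Rightarrow> bool" where
  "strong_Markov_diffusion M F X P \<longleftrightarrow>
     filtration_on M F \<and> adapted F X \<and>
     (\<forall>\<omega>\<in>space M. continuous_on {0..} (\<lambda>s. X s \<omega>)) \<and>
     (\<forall>z. prob_space (P z) \<and> sets (P z) = sets M \<and> (AE \<omega> in P z. X 0 \<omega> = z)) \<and>
     (\<forall>s\<ge>0. \<forall>C\<in>sets borel.
        (\<lambda>z. measure (P z) {\<omega>\<in>space M. X s \<omega> \<in> C}) \<in> borel_measurable borel) \<and>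
     (\<forall>\<tau> A s C z.
        stopping_time F \<tau> \<and> A \<in> sets (filtration.pre_sigma (space M) F \<tau>) \<and>
        s \<ge> 0 \<and> C \<in> sets borel \<longrightarrow>
        measure (P z) {\<omega>\<in>A. \<tau> \<omega> < \<infinity> \<and> X (enn2real (\<tau> \<omega>) + s) \<omega> \<in> C}
          = (LINT \<omega>:{\<omega>\<in>A. \<tau> \<omega> < \<infinity>}|P z.
               measure (P (X (enn2real (\<tau> \<omega>)) \<omega>)) {\<omega>'\<in>space M. X s \<omega>' \<in> C}))"

definition wiener_process ::
  "'v measure \<Rightarrow> (ennreal \<Rightarrow> 'v measure) \<Rightarrow> (real \<Rightarrow> 'v \<Rightarrow> real) \<Rightarrow> bool" where
  "wiener_process N F w \<longleftrightarrow>
     prob_space N \<and> filtration_on N F \<and> adapted F w \<and>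
     (AE \<omega> in N. w 0 \<omega> = 0 \<and> continuous_on {0..} (\<lambda>s. w s \<omega>)) \<and>
     (\<forall>r s. 0 \<le> r \<and> r < s \<longrightarrow>
        distributed N lborel (\<lambda>\<omega>. w s \<omega> - w r \<omega>) (\<lambda>y. ennreal (normal_density 0 (sqrt (s - r)) y)) \<and>
        prob_space.indep_set N (sets (F (ennreal r)))
          (sets (vimage_algebra (space N) (\<lambda>\<omega>. w s \<omega> - w r \<omega>) borel)))"

definition weak_solution ::
  "real \<Rightarrow> real \<times> real \<Rightarrow> 'v measure \<Rightarrow> (ennreal \<Rightarrow> 'v measure) \<Rightarrow> (real \<Rightarrow> 'v \<Rightarrow> real)
    \<Rightarrow> (real \<Rightarrow> 'v \<Rightarrow> real \<times> real) \<Rightarrow> bool" where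
  "weak_solution \<nu> z N F w Y \<longleftrightarrow>
     wiener_process N F w \<and> adapted F Y \<and>
     (AE \<omega> in N. \<forall>s\<ge>0.
        fst (Y s \<omega>) = fst z + s \<and>
        set_integrable lborel {0..s} (\<lambda>r. drift \<nu> (Y r \<omega>)) \<and>
        snd (Y s \<omega>) = snd z + w s \<omega> + (LINT r:{0..s}|lborel. drift \<nu> (Y r \<omega>)))"

text \<open>The law of the trajectories, on the cylinder \<open>\<sigma>\<close>-algebra; on continuous trajectories its trace is
  the Borel \<open>\<sigma>\<close>-algebra of \<open>C([0, \<infinity>))\<close>.\<close>

definition path_law :: "'w measure \<Rightarrow> (real \<Rightarrow> 'w \<Rightarrow> 'a::topological_space) \<Rightarrow> (real \<Rightarrow> 'a) measure" where
  "path_law N Y = distr N (\<Pi>\<^sub>M s\<in>{0..}. borel) (\<lambda>\<omega>. \<lambda>s\<in>{0..}. Y s \<omega>)"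

text \<open>HOL cannot quantify existentially over types, so the type \<open>'v\<close> of the elementary events of the
  spaces carrying the Wiener processes is a parameter.\<close>

definition L_process ::
  "'v itself \<Rightarrow> real \<Rightarrow> 'w measure \<Rightarrow> (ennreal \<Rightarrow> 'w measure) \<Rightarrow> (real \<Rightarrow> 'w \<Rightarrow> real \<times> real)
    \<Rightarrow> (real \<times> real \<Rightarrow> 'w measure) \<Rightarrow> bool" where
  "L_process _ \<nu> M F X P \<longleftrightarrow>
     strong_Markov_diffusion M F X P \<and>
     (\<forall>z. \<exists>(N :: 'v measure) F' w Y. weak_solution \<nu> z N F' w Y \<and> path_law (P z) X = path_law N Y)"

end

theory Submission
  imports Defs
begin

text \<open>Only a few classical properties of the solution carry the proof. It is bounded, odd and nondecreasing
in \<open>x\<close>, continuous together with its \<open>x\<close>-derivative away from the origin, and on each of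
the half-planes \<open>x > 0\<close> and \<open>x < 0\<close>, for \<open>t \<noteq> 0\<close>, it is a classical solution of
\<open>u\<^sub>t + u\<^sub>x\<^sub>x / 2 + c(t) sgn(x) u\<^sub>x = 0\<close> with \<open>c(t) = t powr (-\<nu>)\<close> for \<open>t > 0\<close> and \<open>c(t) = 0\<close>
otherwise; the equation is the heat equation for the shifted function, read along the curves on which
\<open>x - B(t)\<close> is constant. The locale \<open>odd_solution\<close> collects these properties.

The representation says that \<open>s \<mapsto> E u(s, x\<^sub>s)\<close> is constant on \<open>[t, 1]\<close>, where \<open>x\<^sub>s\<close> is the
solution of the stochastic equation, indexed by absolute time. On time intervals at a positive distance from \<open>0\<close> the drift is bounded, and the only obstacle to Ito's formula is the line \<open>x = 0\<close>, where the drift jumps and the second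
derivative of \<open>u\<close> is not under control. It is removed by replacing \<open>u\<close> by its fourfold average \<open>U\<close>
over intervals of length \<open>2 e\<close> in \<open>x\<close>. Integrating the equation over both half-planes
produces boundary terms with \<open>u\<^sub>x(t, 0)\<close>, and these cancel because \<open>u\<close> is odd
(\<open>box_mean_time_increment\<close>). Hence \<open>U\<close> has bounded Lipschitz derivatives, and the generator applied
to \<open>U\<close> is \<open>c(t)\<close> times a defect which comes only from the noncommutation of \<open>sgn\<close> with averaging.
The defect vanishes for \<open>\<bar>x\<bar> > 4 e\<close> and, by symmetry, for \<open>x = 0\<close>; it is bounded uniformly in \<open>e\<close>
because \<open>u\<^sub>x\<close> is locally bounded (\<open>defect_away\<close>, \<open>defect_at_zero\<close>, \<open>defect_bounded\<close>). It therefore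
tends to \<open>0\<close> boundedly and at \<^emph>\<open>every\<close> point, and dominated convergence applies without any information on the
time which the process spends near \<open>0\<close> (\<open>expectation_constant\<close>).

For \<open>U\<close> the formula of Dynkin is derived from Taylor's formula (\<open>dynkin_formula\<close>): over a time step of
length \<open>h\<close> the error is of the order \<open>h powr (3/2)\<close>, and a function of time whose increments are that
small is constant. Across time \<open>0\<close>, where the drift is unbounded, it is enough that \<open>s \<mapsto> E u(s, x\<^sub>s)\<close>
is continuous. This holds since \<open>u\<close> is continuous outside the origin and the process avoids the
origin almost surely: before time \<open>0\<close> it is a Brownian motion (\<open>path_avoids_origin\<close>, \<open>representation\<close>).

Since \<open>u(t, 0) = 0\<close> for \<open>t \<noteq> 0\<close>, a limit at the origin could only be \<open>0\<close>. But the drift wins against the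
Brownian fluctuations near time \<open>0\<close>, so that a process started at \<open>(t, 2 t powr \<nu>)\<close> escapes with a probability
bounded away from \<open>0\<close>. The analytic form of this is a comparison with two explicit barriers
(\<open>u_lower_bound\<close>, \<open>u_lower_bound_near_origin\<close>), and it gives \<open>u(t, 2 t powr \<nu>) \<ge> a > 0\<close> as \<open>t \<rightarrow> 0\<close>.\<close>

section \<open>The drift coefficient and its primitive\<close>

definition drift_coeff :: "real \<Rightarrow> real \<Rightarrow> real" where
  "drift_coeff \<nu> t = (if t > 0 then t powr (-\<nu>) else 0)"

lemma drift_eq: "drift \<nu> z = drift_coeff \<nu> (fst z) * sgn (snd z)"
  by (cases z) (auto simp: drift_def drift_coeff_def)

lemma drift_coeff_nonneg: "0 \<le> drift_coeff \<nu> t"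
  by (simp add: drift_coeff_def)

lemma drift_coeff_measurable [measurable]: "drift_coeff \<nu> \<in> borel_measurable borel"
  unfolding drift_coeff_def by measurable

lemma continuous_on_drift_coeff:
  assumes "0 \<notin> S"
  shows "continuous_on S (drift_coeff \<nu>)"
proof -
  have "continuous_on ({0<..} \<union> {..<0}) (drift_coeff \<nu>)"
  proof (rule continuous_on_open_Un)
    have "continuous_on {0<..} (\<lambda>t. t powr (-\<nu>))"
      by (intro continuous_intros) auto
    then show "continuous_on {0<..} (drift_coeff \<nu>)"
      by (rule continuous_on_eq) (auto simp: drift_coeff_def)
    have "continuous_on {..<0} (\<lambda>t::real. 0::real)"
      by simp
    then show "continuous_on {..<0} (drift_coeff \<nu>)"
      by (rule continuous_on_eq) (auto simp: drift_coeff_def)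
  qed auto
  moreover have "S \<subseteq> {0<..} \<union> {..<0}"
  proof
    fix x assume "x \<in> S"
    with assms have "x \<noteq> 0" by metis
    then show "x \<in> {0<..} \<union> {..<0}" by auto
  qed
  ultimately show ?thesis
    by (rule continuous_on_subset)
qed

text \<open>The closed form of \<open>cum_drift\<close>. It is continuous, and a primitive of \<open>drift_coeff\<close> off \<open>0\<close>; together this
makes the fundamental theorem of calculus available across the singularity at \<open>0\<close>.\<close>

definition drift_prim :: "real \<Rightarrow> real \<Rightarrow> real" where
  "drift_prim \<nu> t = (if t > 0 then t powr (1 - \<nu>) / (1 - \<nu>) else 0)"

lemma drift_prim_eq_max:
  assumes "\<nu> < 1"
  shows "drift_prim \<nu> t = max 0 t powr (1 - \<nu>) / (1 - \<nu>)"
  using assms by (auto simp: drift_prim_def max_def)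

lemma continuous_on_drift_prim: "\<nu> < 1 \<Longrightarrow> continuous_on S (drift_prim \<nu>)"
proof -
  assume nu: "\<nu> < 1"
  have "continuous_on S (\<lambda>t. max 0 t powr (1 - \<nu>) / (1 - \<nu>))"
    by (intro continuous_on_divide continuous_on_powr' continuous_on_max continuous_on_const continuous_on_id)
       (use nu in auto)
  then show ?thesis
    by (simp add: drift_prim_eq_max[OF nu])
qed

lemma DERIV_drift_prim:
  assumes "\<nu> < 1" "t \<noteq> 0"
  shows "(drift_prim \<nu> has_real_derivative drift_coeff \<nu> t) (at t)"
proof (cases "t > 0")
  case True
  have "((\<lambda>t. t powr (1 - \<nu>) / (1 - \<nu>)) has_real_derivative t powr (-\<nu>)) (at t)"
    using True assms by (auto intro!: derivative_eq_intros)
  then have "(drift_prim \<nu> has_real_derivative t powr (-\<nu>)) (at t)"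
    by (rule DERIV_cong_ev[THEN iffD1, rotated -1])
       (use True eventually_nhds_in_open[of "{0<..}" t] in
         \<open>auto elim!: eventually_mono simp: drift_prim_def\<close>)
  then show ?thesis
    using True by (simp add: drift_coeff_def)
next
  case False
  have "((\<lambda>t. 0) has_real_derivative 0) (at t)"
    by simp
  then have "(drift_prim \<nu> has_real_derivative 0) (at t)"
    by (rule DERIV_cong_ev[THEN iffD1, rotated -1])
       (use False assms eventually_nhds_in_open[of "{..<0}" t] in
         \<open>auto elim!: eventually_mono simp: drift_prim_def\<close>)
  then show ?thesis
    using False by (simp add: drift_coeff_def)
qed

lemma drift_coeff_integral:
  assumes "\<nu> < 1" "a \<le> b"
  shows "set_integrable lborel {a..b} (drift_coeff \<nu>)"
    and "(LINT s:{a..b}|lborel. drift_coeff \<nu> s) = drift_prim \<nu> b - drift_prim \<nu> a"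
proof -
  have I: "(drift_coeff \<nu> has_integral (drift_prim \<nu> b - drift_prim \<nu> a)) {a..b}"
    by (rule fundamental_theorem_of_calculus_strong[where S="{0}"])
       (use assms DERIV_drift_prim in
         \<open>auto intro: continuous_on_drift_prim simp: has_real_derivative_iff_has_vector_derivative[symmetric]\<close>)
  have "integral\<^sup>N lborel (\<lambda>x. indicator {a..b} x * drift_coeff \<nu> x) = drift_prim \<nu> b - drift_prim \<nu> a"
    by (rule nn_integral_has_integral_lebesgue[OF _ I]) (simp add: drift_coeff_nonneg)
  then show int: "set_integrable lborel {a..b} (drift_coeff \<nu>)"
    unfolding set_integrable_def
    by (intro integrableI_nonneg) (auto simp: drift_coeff_nonneg)
  show "(LINT s:{a..b}|lborel. drift_coeff \<nu> s) = drift_prim \<nu> b - drift_prim \<nu> a"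
    using set_borel_integral_eq_integral(2)[OF int] I by (simp add: integral_unique)
qed

lemma cum_drift_eq_prim:
  assumes "\<nu> < 1"
  shows "cum_drift \<nu> = drift_prim \<nu>"
proof
  fix t
  have "cum_drift \<nu> t = (LINT s:{min 0 t..t}|lborel. drift_coeff \<nu> s)"
    unfolding cum_drift_def set_lebesgue_integral_def
    by (rule Bochner_Integration.integral_cong) (auto simp: drift_coeff_def indicator_def)
  also have "\<dots> = drift_prim \<nu> t"
    using assms by (subst drift_coeff_integral(2)) (auto simp: drift_prim_def)
  finally show "cum_drift \<nu> t = drift_prim \<nu> t" .
qed

section \<open>The classical content of the solution\<close>

lemma has_derivative_partials:
  fixes f :: "real \<times> real \<Rightarrow> real"
  assumes "f differentiable at (t, x)"
  shows "(f has_derivative (\<lambda>(h, k). h * Dt f (t, x) + k * Dx f (t, x))) (at (t, x))"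
proof -
  obtain D where D: "(f has_derivative D) (at (t, x))"
    using assms by (auto simp: differentiable_def)
  then interpret D: bounded_linear D
    by (rule has_derivative_bounded_linear)
  have "((\<lambda>s. f (s, x)) has_derivative (\<lambda>h. D (h, 0))) (at t)"
    by (rule has_derivative_compose[where g=f and f="\<lambda>s. (s, x)"])
       (auto intro!: derivative_eq_intros D)
  moreover have "(\<lambda>h. D (h, 0)) = (*) (D (1, 0))"
  proof
    show "D (h, 0) = D (1, 0) * h" for h
      using D.scaleR[of h "(1, 0)"] by (simp add: mult.commute)
  qed
  ultimately have "((\<lambda>s. f (s, x)) has_real_derivative D (1, 0)) (at t)"
    by (simp only: has_field_derivative_def)
  then have t: "Dt f (t, x) = D (1, 0)"
    by (simp add: Dt_def DERIV_imp_deriv)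
  have "((\<lambda>y. f (t, y)) has_derivative (\<lambda>k. D (0, k))) (at x)"
    by (rule has_derivative_compose[where g=f and f="\<lambda>y. (t, y)"])
       (auto intro!: derivative_eq_intros D)
  moreover have "(\<lambda>k. D (0, k)) = (*) (D (0, 1))"
  proof
    show "D (0, k) = D (0, 1) * k" for k
      using D.scaleR[of k "(0, 1)"] by (simp add: mult.commute)
  qed
  ultimately have "((\<lambda>y. f (t, y)) has_real_derivative D (0, 1)) (at x)"
    by (simp only: has_field_derivative_def)
  then have x: "Dx f (t, x) = D (0, 1)"
    by (simp add: Dx_def DERIV_imp_deriv)
  have D_eq: "D (h, k) = h * D (1, 0) + k * D (0, 1)" for h k
  proof -
    have "D (h, k) = D (h *\<^sub>R (1, 0)) + D (k *\<^sub>R (0, 1))"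
      by (subst D.add[symmetric]) simp
    then show ?thesis
      by (simp only: D.scaleR real_scaleR_def)
  qed
  have "D = (\<lambda>(h, k). h * Dt f (t, x) + k * Dx f (t, x))"
  proof
    show "D z = (case z of (h, k) \<Rightarrow> h * Dt f (t, x) + k * Dx f (t, x))" for z
      using D_eq[of "fst z" "snd z"] by (simp add: t x split_def)
  qed
  with D show ?thesis by (simp only:)
qed

text \<open>The chain rule along a curve in the plane; it turns the heat equation for the shifted function into the
equation with drift.\<close>

lemma DERIV_along_path:
  fixes f :: "real \<times> real \<Rightarrow> real"
  assumes "f differentiable at (\<alpha> s, \<beta> s)"
    and "(\<alpha> has_real_derivative a) (at s)" "(\<beta> has_real_derivative b) (at s)"
  shows "((\<lambda>s. f (\<alpha> s, \<beta> s)) has_real_derivative a * Dt f (\<alpha> s, \<beta> s) + b * Dx f (\<alpha> s, \<beta> s)) (at s)"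
proof -
  have "((\<lambda>s. (\<alpha> s, \<beta> s)) has_derivative (\<lambda>h. (a * h, b * h))) (at s)"
    using assms(2,3) by (auto simp: has_field_derivative_def intro!: has_derivative_Pair)
  from has_derivative_compose[OF this has_derivative_partials[OF assms(1)]]
  have "((\<lambda>s. f (\<alpha> s, \<beta> s)) has_derivative
      (\<lambda>h. a * h * Dt f (\<alpha> s, \<beta> s) + b * h * Dx f (\<alpha> s, \<beta> s))) (at s)"
    by simp
  moreover have "(\<lambda>h. a * h * Dt f (\<alpha> s, \<beta> s) + b * h * Dx f (\<alpha> s, \<beta> s)) =
      (*) (a * Dt f (\<alpha> s, \<beta> s) + b * Dx f (\<alpha> s, \<beta> s))"
    by (auto simp: algebra_simps)
  ultimately show ?thesis
    by (simp only: has_field_derivative_def)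
qed

text \<open>The classical properties of the solution from which everything else is derived; \<open>p\<close> and \<open>q\<close> stand for
the first and second derivative in \<open>x\<close>. The equation is required only for \<open>x > 0\<close>: oddness carries it over to
\<open>x < 0\<close>, and nothing is known about \<open>q\<close> up to \<open>x = 0\<close>.\<close>

locale odd_solution =
  fixes \<nu> :: real and \<zeta> :: "real \<Rightarrow> real" and u p q :: "real \<times> real \<Rightarrow> real" and M :: real
  assumes nu: "1/2 < \<nu>" "\<nu> < 1"
    and cutoff: "cutoff \<zeta>"
    and bdd: "z \<in> dom_G \<Longrightarrow> \<bar>u z\<bar> \<le> M"
    and cont: "continuous_on dom_G u"
    and odd: "(t, x) \<in> dom_G \<Longrightarrow> u (t, -x) = - u (t, x)"
    and terminal: "u (1, x) = terminal \<zeta> x"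
    and mono: "(t, x) \<in> dom_G \<Longrightarrow> (t, y) \<in> dom_G \<Longrightarrow> x \<le> y \<Longrightarrow> u (t, x) \<le> u (t, y)"
    and dx: "(t, x) \<in> dom_G \<Longrightarrow> ((\<lambda>y. u (t, y)) has_real_derivative p (t, x)) (at x)"
    and p_cont: "continuous_on dom_G p"
    and dxx: "t < 1 \<Longrightarrow> t \<noteq> 0 \<Longrightarrow> 0 < x \<Longrightarrow> ((\<lambda>y. p (t, y)) has_real_derivative q (t, x)) (at x)"
    and q_cont: "continuous_on {(t, x). t < 1 \<and> t \<noteq> 0 \<and> 0 < x} q"
    and dt: "t < 1 \<Longrightarrow> t \<noteq> 0 \<Longrightarrow> 0 < x \<Longrightarrow>
      ((\<lambda>s. u (s, x)) has_real_derivative - (1/2) * q (t, x) - drift_coeff \<nu> t * p (t, x)) (at t)"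

text \<open>On \<open>x > 0\<close> the solution is \<open>v(t, x - B(t))\<close> with \<open>v\<close> smooth and caloric. Differentiating along
\<open>t \<mapsto> (t, x - B(t))\<close> adds the term \<open>- B'(t) v\<^sub>x\<close>, which is the drift term since \<open>B'\<close> is \<open>drift_coeff\<close>.\<close>

lemma is_solution_u_imp_odd_solution:
  assumes nu: "1/2 < \<nu>" "\<nu> < 1" and "cutoff \<zeta>" and sol: "is_solution_u \<nu> (terminal \<zeta>) u"
  obtains q M where "odd_solution \<nu> \<zeta> u (Dx u) q M"
proof -
  have u_bdd: "bounded (u ` dom_G)" and u_cont: "continuous_on dom_G u"
    and u_odd: "\<forall>(t, x)\<in>dom_G. u (t, -x) = - u (t, x)"
    and u_terminal: "\<forall>x. u (1, x) = terminal \<zeta> x"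
    and u_Dx: "has_Dx_on dom_G u" and Dx_cont: "continuous_on dom_G (Dx u)"
    and u_mono: "\<forall>t x y. (t, x) \<in> dom_G \<and> (t, y) \<in> dom_G \<and> x \<le> y \<longrightarrow> u (t, x) \<le> u (t, y)"
    and v_smooth: "smooth_on (dom_Gamma \<nu>) (shifted \<nu> u)"
    and v_heat: "\<forall>z\<in>dom_Gamma \<nu>. Dt (shifted \<nu> u) z + 1/2 * Dx (Dx (shifted \<nu> u)) z = 0"
    using sol unfolding is_solution_u_def by - (elim conjE, assumption)+
  define B where "B = drift_prim \<nu>"
  define v where "v = shifted \<nu> u"
  have B: "cum_drift \<nu> = B" using nu by (simp add: B_def cum_drift_eq_prim)
  have dB: "(B has_real_derivative drift_coeff \<nu> t) (at t)" if "t \<noteq> 0" for t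
    unfolding B_def by (rule DERIV_drift_prim[OF nu(2) that])
  have v: "v (t, x) = u (t, x + B t)" for t x by (simp add: v_def shifted_def B)
  have dx: "((\<lambda>y. u (t, y)) has_real_derivative Dx u (t, x)) (at x)" if "(t, x) \<in> dom_G" for t x
  proof -
    have "(\<lambda>y. u (t, y)) differentiable at x"
      using u_Dx that by (auto simp: has_Dx_on_def)
    then show ?thesis
      by (simp add: Dx_def DERIV_deriv_iff_real_differentiable)
  qed
  have dxv: "Dx v (t, y) = Dx u (t, y + B t)" if "(t, y + B t) \<in> dom_G" for t y
  proof -
    have "((\<lambda>y. v (t, y)) has_real_derivative Dx u (t, y + B t)) (at y)"
      unfolding v using dx[OF that] by (simp add: DERIV_shift)
    then show ?thesis by (simp add: Dx_def DERIV_imp_deriv)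
  qed
  define q where "q = (\<lambda>(t, x). Dx (Dx v) (t, x - B t))"
  have G: "(t, x) \<in> dom_G" if "t < 1" "t \<noteq> 0" for t x using that by (auto simp: dom_G_def)
  have smooth: "iter_D ds v differentiable at (t, x - B t)" if "t < 1" "0 < x" "ds \<in> lists {Dt, Dx}" for t x ds
    using v_smooth that by (auto simp: smooth_on_def dom_Gamma_def B v_def)
  have sm0: "v differentiable at (t, x - B t)" if "t < 1" "0 < x" for t x
    using smooth[OF that, of "[]"] by (simp add: iter_D_def)
  have sm1: "Dx v differentiable at (t, x - B t)" if "t < 1" "0 < x" for t x
    using smooth[OF that, of "[Dx]"] by (simp add: iter_D_def)
  have sm2: "Dx (Dx v) differentiable at (t, x - B t)" if "t < 1" "0 < x" for t x
    using smooth[OF that, of "[Dx, Dx]"] by (simp add: iter_D_def)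
  obtain M where M: "\<And>z. z \<in> dom_G \<Longrightarrow> \<bar>u z\<bar> \<le> M"
    using u_bdd by (auto simp: bounded_iff)
  have "odd_solution \<nu> \<zeta> u (Dx u) q M"
  proof
    show "1/2 < \<nu>" "\<nu> < 1" "cutoff \<zeta>" by fact+
    show "\<bar>u z\<bar> \<le> M" if "z \<in> dom_G" for z using M that .
    show "continuous_on dom_G u" "continuous_on dom_G (Dx u)" by fact+
    show "u (t, - x) = - u (t, x)" if "(t, x) \<in> dom_G" for t x using u_odd that by auto
    show "u (1, x) = terminal \<zeta> x" for x using u_terminal by auto
    show "u (t, x) \<le> u (t, y)" if "(t, x) \<in> dom_G" "(t, y) \<in> dom_G" "x \<le> y" for t x y
      using u_mono that by blast
    show "((\<lambda>y. u (t, y)) has_real_derivative Dx u (t, x)) (at x)" if "(t, x) \<in> dom_G" for t x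
      using dx[OF that] .
    show "((\<lambda>y. Dx u (t, y)) has_real_derivative q (t, x)) (at x)" if "t < 1" "t \<noteq> 0" "0 < x" for t x
    proof -
      have "((\<lambda>y. Dx v (t, y - B t)) has_real_derivative
          0 * Dt (Dx v) (t, x - B t) + 1 * Dx (Dx v) (t, x - B t)) (at x)"
        by (rule DERIV_along_path[where \<alpha>="\<lambda>_. t" and \<beta>="\<lambda>y. y - B t"])
           (use that in \<open>auto intro!: sm1 derivative_eq_intros\<close>)
      then show ?thesis
        using that by (simp add: q_def dxv G)
    qed
    show "continuous_on {(t, x). t < 1 \<and> t \<noteq> 0 \<and> 0 < x} q"
    proof -
      have "continuous_on {(t, x). t < 1 \<and> t \<noteq> 0 \<and> 0 < x} (\<lambda>z. Dx (Dx v) (fst z, snd z - B (fst z)))"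
      proof (rule continuous_on_compose2[where g="Dx (Dx v)"])
        show "continuous_on {(t, x). t < 1 \<and> 0 < x + B t} (Dx (Dx v))"
        proof (rule continuous_at_imp_continuous_on, clarify)
          fix t x assume "t < 1" "0 < x + B t"
          then show "isCont (Dx (Dx v)) (t, x)"
            using sm2[of t "x + B t"] by (intro differentiable_imp_continuous_within) simp
        qed
        show "continuous_on {(t, x). t < 1 \<and> t \<noteq> 0 \<and> 0 < x} (\<lambda>z. (fst z, snd z - B (fst z)))"
          unfolding B_def using nu
          by (auto intro!: continuous_intros continuous_on_compose2[OF continuous_on_drift_prim[of \<nu> UNIV]])
      qed auto
      then show ?thesis by (simp add: q_def case_prod_unfold)
    qed
    show "((\<lambda>s. u (s, x)) has_real_derivative - (1/2) * q (t, x) - drift_coeff \<nu> t * Dx u (t, x)) (at t)"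
      if "t < 1" "t \<noteq> 0" "0 < x" for t x
    proof -
      have "((\<lambda>s. v (s, x - B s)) has_real_derivative
          1 * Dt v (t, x - B t) + (- drift_coeff \<nu> t) * Dx v (t, x - B t)) (at t)"
        by (rule DERIV_along_path[where \<alpha>="\<lambda>s. s" and \<beta>="\<lambda>s. x - B s"])
           (use that nu in \<open>auto intro!: sm0 derivative_eq_intros dB\<close>)
      moreover have "Dt v (t, x - B t) + 1/2 * Dx (Dx v) (t, x - B t) = 0"
        using bspec[OF v_heat, of "(t, x - B t)"] that by (simp add: dom_Gamma_def B v_def)
      then have "Dt v (t, x - B t) = - (1/2) * q (t, x)"
        by (simp add: q_def)
      ultimately show ?thesis
        using that by (simp add: v dxv G)
    qed
  qed
  then show ?thesis by (rule that)
qed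

section \<open>Comparison and the discontinuity at the origin\<close>

text \<open>Time runs backwards here, so the boundary values are prescribed at the final time \<open>hi\<close> and on the two
sides. Adding \<open>d * (hi - t)\<close> makes the differential inequality strict. A negative minimum of the perturbed
function would lie off the boundary; there the time derivative is nonnegative, the first space
derivative vanishes and the second is nonnegative, which contradicts the strict inequality.\<close>

lemma parabolic_minimum_principle:
  fixes f ft fx fxx k :: "real \<Rightarrow> real \<Rightarrow> real"
  assumes cont: "continuous_on ({lo..hi} \<times> {0..R}) (\<lambda>(t, y). f t y)"
    and dt: "\<And>t y. t \<in> {lo..<hi} \<Longrightarrow> y \<in> {0<..<R} \<Longrightarrow> ((\<lambda>s. f s y) has_real_derivative ft t y) (at t)"
    and dx: "\<And>t y. t \<in> {lo..<hi} \<Longrightarrow> y \<in> {0<..<R} \<Longrightarrow> (f t has_real_derivative fx t y) (at y)"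
    and dxx: "\<And>t y. t \<in> {lo..<hi} \<Longrightarrow> y \<in> {0<..<R} \<Longrightarrow> (fx t has_real_derivative fxx t y) (at y)"
    and super: "\<And>t y. t \<in> {lo..<hi} \<Longrightarrow> y \<in> {0<..<R} \<Longrightarrow> ft t y + 1/2 * fxx t y + k t y * fx t y \<le> 0"
    and terminal: "\<And>y. y \<in> {0..R} \<Longrightarrow> 0 \<le> f hi y"
    and left: "\<And>t. t \<in> {lo..hi} \<Longrightarrow> 0 \<le> f t 0"
    and right: "\<And>t. t \<in> {lo..hi} \<Longrightarrow> 0 \<le> f t R"
    and ty: "t \<in> {lo..hi}" "y \<in> {0..R}"
  shows "0 \<le> f t y"
proof (rule ccontr)
  assume "\<not> 0 \<le> f t y"
  then have neg: "f t y < 0" by simp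
  define d where "d = - f t y / (2 * (hi - lo + 1))"
  have tt: "lo \<le> hi" using ty by auto
  have d: "d > 0" using neg tt by (auto simp: d_def intro!: divide_neg_pos)
  define g where "g = (\<lambda>(s, z). f s z + d * (hi - s))"
  have "d * (hi - t) \<le> d * (hi - lo + 1)"
    using d ty by (intro mult_left_mono) auto
  also have "\<dots> = - f t y / 2"
    using tt by (simp add: d_def field_simps)
  finally have gneg: "g (t, y) < 0"
    using neg by (simp add: g_def)
  have "continuous_on ({lo..hi} \<times> {0..R}) (\<lambda>z. (\<lambda>(t, y). f t y) z + d * (hi - fst z))"
    by (intro continuous_intros cont)
  then have "continuous_on ({lo..hi} \<times> {0..R}) g"
    by (simp add: g_def case_prod_unfold)
  then obtain m where m: "m \<in> {lo..hi} \<times> {0..R}" "\<And>z. z \<in> {lo..hi} \<times> {0..R} \<Longrightarrow> g m \<le> g z"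
    using continuous_attains_inf[of "{lo..hi} \<times> {0..R}" g] ty
    by (metis SigmaI compact_Icc compact_Times empty_iff)
  obtain s z where sz: "m = (s, z)" by (cases m)
  have neg': "g (s, z) < 0"
    using m(2)[of "(t, y)"] gneg ty sz by auto
  have s: "s \<in> {lo..hi}" and z: "z \<in> {0..R}" using m sz by auto
  have ge: "g (s', z') \<ge> f s' z'" if "s' \<in> {lo..hi}" for s' z'
    using d that by (simp add: g_def)
  have s': "s \<in> {lo..<hi}"
    using s neg' terminal[OF z] ge[OF s, of z] by (cases "s = hi") auto
  have z': "z \<in> {0<..<R}"
    using z neg' left[OF s] right[OF s] ge[OF s, of z] by (cases "z = 0"; cases "z = R") auto
  have fx0: "fx s z = 0"
  proof (rule DERIV_local_min[OF dx[OF s' z'], of "min z (R - z)"])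
    show "0 < min z (R - z)" using z' by auto
    show "\<forall>y. \<bar>z - y\<bar> < min z (R - z) \<longrightarrow> f s z \<le> f s y"
    proof (intro allI impI)
      fix y' assume "\<bar>z - y'\<bar> < min z (R - z)"
      then have "y' \<in> {0..R}" by auto
      then show "f s z \<le> f s y'" using m(2)[of "(s, y')"] s sz by (auto simp: g_def)
    qed
  qed
  have "fxx s z \<ge> 0"
  proof (rule ccontr)
    assume "\<not> 0 \<le> fxx s z"
    then obtain e where e: "e > 0" "\<And>h. h > 0 \<Longrightarrow> h < e \<Longrightarrow> fx s (z + h) < fx s z"
      using DERIV_neg_dec_right[OF dxx[OF s' z']] by auto
    define h where "h = min (e / 2) ((R - z) / 2)"
    have h: "h > 0" "h < e" "z + h < R"
      using e z' by (auto simp: h_def min_def field_simps)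
    have "\<exists>x>z. x < z + h \<and> f s (z + h) - f s z = (z + h - z) * fx s x"
      by (rule MVT2) (use h z' s' in \<open>auto intro!: dx\<close>)
    then obtain x where x: "z < x" "x < z + h" "f s (z + h) - f s z = h * fx s x"
      by auto
    have "fx s (z + (x - z)) < 0"
      using e(2)[of "x - z"] x h fx0 by auto
    then have "f s (z + h) < f s z"
      using x(3) mult_pos_neg[OF h(1), of "fx s x"] by simp
    moreover have "g (s, z) \<le> g (s, z + h)"
      using m(2)[of "(s, z + h)"] sz s z' h by auto
    ultimately show False by (simp add: g_def)
  qed
  have "((\<lambda>s. g (s, z)) has_real_derivative ft s z + d * (0 - 1)) (at s)"
    unfolding g_def split
    by (rule DERIV_add[OF dt[OF s' z']]) (auto intro!: derivative_eq_intros)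
  moreover have "\<not> (\<exists>e>0. \<forall>h>0. h < e \<longrightarrow> g (s + h, z) < g (s, z))"
  proof
    assume "\<exists>e>0. \<forall>h>0. h < e \<longrightarrow> g (s + h, z) < g (s, z)"
    then obtain e where e: "e > 0" "\<And>h. h > 0 \<Longrightarrow> h < e \<Longrightarrow> g (s + h, z) < g (s, z)" by auto
    define h where "h = min (e / 2) (hi - s)"
    have "h > 0" "h < e" "s + h \<in> {lo..hi}"
      using e s' by (auto simp: h_def min_def field_simps)
    with e(2)[of h] m(2)[of "(s + h, z)"] sz z show False by auto
  qed
  ultimately have "ft s z - d \<ge> 0"
    using DERIV_neg_dec_right[of "\<lambda>s. g (s, z)" "ft s z - d" s] by force
  with super[OF s' z'] fx0 \<open>fxx s z \<ge> 0\<close> d show False by simp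
qed

lemma half_le_one_minus_exp:
  fixes y :: real
  assumes "0 \<le> y" "y \<le> 1"
  shows "y / 2 \<le> 1 - exp (-y)"
proof -
  have "exp (-y) \<le> 1 / (1 + y)"
    using exp_ge_add_one_self[of y] assms by (simp add: exp_minus field_simps)
  also have "\<dots> \<le> 1 - y / 2"
  proof -
    have "y * y \<le> y" using assms by (simp add: mult_left_le)
    then show ?thesis using assms by (simp add: field_simps)
  qed
  finally show ?thesis by simp
qed

text \<open>The size of the error that the barrier \<open>exp (- z)\<close> makes in the equation; the bound is the inequality between
arithmetic and geometric mean for \<open>2 / Q\<close> and \<open>(Q / 2) exp (- z)\<close>.\<close>

lemma boundary_layer_inequality:
  fixes z Q n :: real
  assumes "0 \<le> z" "0 < Q" "0 \<le> n" "n \<le> 1"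
  shows "exp (-z) * (n * z - Q / 2) \<le> 2 / Q"
proof -
  have z: "z \<le> 2 * exp (z / 2)"
    using exp_ge_add_one_self[of "z / 2"] by linarith
  have "n * z * exp (-z) \<le> z * exp (-z)"
    using assms by (intro mult_right_mono) (auto intro: mult_left_le_one_le)
  also have "\<dots> \<le> 2 * exp (z / 2) * exp (-z)"
    using z by (intro mult_right_mono) auto
  also have "\<dots> = 2 * exp (-z / 2)"
    by (simp add: mult_exp_exp)
  also have "\<dots> \<le> 2 / Q + Q / 2 * exp (-z)"
  proof -
    have "0 \<le> (sqrt (2 / Q) - sqrt (Q / 2) * exp (-z/2))\<^sup>2" by simp
    also have "\<dots> = 2 / Q + Q / 2 * (exp (-z/2))\<^sup>2 - 2 * (sqrt (2 / Q) * sqrt (Q / 2)) * exp (-z / 2)"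
      using assms by (simp add: power2_diff power_mult_distrib)
    also have "sqrt (2 / Q) * sqrt (Q / 2) = 1"
      using assms by (simp add: real_sqrt_mult[symmetric])
    also have "(exp (-z/2))\<^sup>2 = exp (-z)"
      by (simp add: power2_eq_square mult_exp_exp)
    finally show ?thesis by simp
  qed
  finally show ?thesis by (simp add: algebra_simps)
qed

lemma powr_tendsto_zero_at_right:
  fixes a :: real
  assumes "0 < a"
  shows "((\<lambda>t. t powr a) \<longlongrightarrow> 0) (at_right 0)"
proof -
  have "((\<lambda>t. t powr a) \<longlongrightarrow> 0 powr a) (at_right (0::real))"
    by (rule tendsto_powr'[OF tendsto_ident_at tendsto_const])
       (use assms eventually_at_right_less[of "0::real"] in \<open>auto elim!: eventually_mono\<close>)
  with assms show ?thesis by simp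
qed

context odd_solution
begin

lemma strip_in_dom_G: "t \<le> 1 \<Longrightarrow> t \<noteq> 0 \<Longrightarrow> (t, x) \<in> dom_G"
  by (auto simp: dom_G_def)

lemma u_zero: "t \<le> 1 \<Longrightarrow> t \<noteq> 0 \<Longrightarrow> u (t, 0) = 0"
  using odd[of t 0] strip_in_dom_G[of t 0] by simp

lemma u_nonneg: "t \<le> 1 \<Longrightarrow> t \<noteq> 0 \<Longrightarrow> 0 \<le> x \<Longrightarrow> 0 \<le> u (t, x)"
  using mono[of t 0 x] u_zero[of t] strip_in_dom_G[of t] by simp

lemma u_terminal_one: "1 \<le> x \<Longrightarrow> u (1, x) = 1"
  using cutoff terminal[of x] by (auto simp: cutoff_def terminal_def)

lemma drift_prim_increment:
  assumes "0 < T" "T \<le> t" "t \<le> 1"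
  shows "t - T \<le> drift_prim \<nu> t - drift_prim \<nu> T"
proof -
  have "(\<lambda>s. drift_prim \<nu> s - s) T \<le> (\<lambda>s. drift_prim \<nu> s - s) t"
  proof (rule DERIV_nonneg_imp_nondecreasing[OF assms(2)], intro exI conjI)
    fix s assume s: "T \<le> s" "s \<le> t"
    show "((\<lambda>s. drift_prim \<nu> s - s) has_real_derivative drift_coeff \<nu> s - 1) (at s)"
      by (intro DERIV_diff DERIV_drift_prim nu DERIV_ident) (use s assms in auto)
    have "1 powr (-\<nu>) \<le> s powr (-\<nu>)"
      using s assms nu by (intro powr_mono2') auto
    then show "0 \<le> drift_coeff \<nu> s - 1"
      using s assms by (simp add: drift_coeff_def)
  qed
  then show ?thesis by simp
qed

text \<open>The function \<open>exp (- y + (B(t) - B(T)) - (t - T) / 2)\<close> solves the equation. At \<open>t = T\<close> it is \<open>exp (- y)\<close>, on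
\<open>y = 0\<close> it is at least \<open>1\<close> because \<open>B(t) - B(T) \<ge> t - T\<close>, and at \<open>t = 1\<close> it is at least \<open>1\<close> for \<open>y \<le> 1\<close>, where the
terminal value may be smaller than \<open>1\<close>; this last point is what \<open>B(1) - B(T) \<ge> 3/2\<close> is for. The second
solution \<open>exp (y - B(t) - t / 2)\<close>, with a small factor \<open>d\<close>, makes up for the side \<open>y = R\<close> of
the bounded rectangle to which the minimum principle is applied.\<close>

lemma u_lower_bound_perturbed:
  assumes T: "0 < T" "T < 1" and B: "drift_prim \<nu> 1 - drift_prim \<nu> T \<ge> 3/2"
    and d: "0 < d" "d < exp (-1)" and y: "0 \<le> y" "y \<le> 1"
  shows "1 - exp (-y) - d * exp y \<le> u (T, y)"
proof -
  define b where "b = drift_prim \<nu>"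
  define R where "R = - ln d + b 1 + 1/2"
  \<comment> \<open>both \<open>E1\<close> and \<open>E2\<close> solve the equation exactly; \<open>R\<close> is chosen so that \<open>d * E2 t R \<ge> 1\<close>\<close>
  define E1 where "E1 = (\<lambda>t y. exp (- y + b t - b T - (t - T) / 2))"
  define E2 where "E2 = (\<lambda>t y. exp (y - b t - t / 2))"
  define f where "f = (\<lambda>t y. u (t, y) - 1 + E1 t y + d * E2 t y)"
  have db: "t \<noteq> 0 \<Longrightarrow> (b has_real_derivative drift_coeff \<nu> t) (at t)" for t
    unfolding b_def by (rule DERIV_drift_prim[OF nu(2)])
  have b_mono: "t - s \<le> b t - b s" if "0 < s" "s \<le> t" "t \<le> 1" for s t
    using drift_prim_increment[OF that] by (simp add: b_def)
  have b0: "0 \<le> b 1" using nu by (simp add: b_def drift_prim_def)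
  have ln: "1 < - ln d"
  proof -
    have "ln d < ln (exp (-1))" using d by (subst ln_less_cancel_iff) auto
    then show ?thesis by simp
  qed
  have "0 \<le> f T y"
  proof (rule parabolic_minimum_principle[where f=f and R=R and lo=T and hi=1 and t=T and k="\<lambda>t y. drift_coeff \<nu> t"
       and ft="\<lambda>t y. - (1/2) * q (t, y) - drift_coeff \<nu> t * p (t, y) + E1 t y * (drift_coeff \<nu> t - 1/2) + d * (E2 t y * (- drift_coeff \<nu> t - 1/2))"
       and fx="\<lambda>t y. p (t, y) - E1 t y + d * E2 t y"
       and fxx="\<lambda>t y. q (t, y) + E1 t y + d * E2 t y"])
    have cb: "continuous_on S b" for S
      unfolding b_def by (rule continuous_on_drift_prim[OF nu(2)])
    have "continuous_on ({T..1} \<times> {0..R}) (\<lambda>z. u z - 1 + exp (- snd z + b (fst z) - b T - (fst z - T) / 2)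
        + d * exp (snd z - b (fst z) - fst z / 2))"
      by (intro continuous_intros continuous_on_subset[OF cont] continuous_on_compose2[OF cb[of UNIV]])
         (use T in \<open>auto simp: dom_G_def\<close>)
    then show "continuous_on ({T..1} \<times> {0..R}) (\<lambda>(t, y). f t y)"
      by (simp add: f_def E1_def E2_def case_prod_unfold)
  next
    fix t y assume ty: "t \<in> {T..<1}" "y \<in> {0<..<R}"
    have t0: "t \<noteq> 0" "t < 1" "0 < y" using ty T by auto
    show "((\<lambda>s. f s y) has_real_derivative - (1/2) * q (t, y) - drift_coeff \<nu> t * p (t, y) + E1 t y * (drift_coeff \<nu> t - 1/2) + d * (E2 t y * (- drift_coeff \<nu> t - 1/2))) (at t)"
      unfolding f_def E1_def E2_def
      by (rule derivative_eq_intros dt db t0 refl | simp)+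
    show "(f t has_real_derivative p (t, y) - E1 t y + d * E2 t y) (at y)"
      unfolding f_def E1_def E2_def using t0
      by (auto intro!: derivative_eq_intros dx strip_in_dom_G)
    show "((\<lambda>y. p (t, y) - E1 t y + d * E2 t y) has_real_derivative q (t, y) + E1 t y + d * E2 t y) (at y)"
      unfolding f_def E1_def E2_def using t0
      by (auto intro!: derivative_eq_intros dxx)
    show "- (1/2) * q (t, y) - drift_coeff \<nu> t * p (t, y) + E1 t y * (drift_coeff \<nu> t - 1/2) + d * (E2 t y * (- drift_coeff \<nu> t - 1/2))
        + 1 / 2 * (q (t, y) + E1 t y + d * E2 t y) + drift_coeff \<nu> t * (p (t, y) - E1 t y + d * E2 t y) \<le> 0"
      by (simp add: algebra_simps)
  next
    fix y assume y: "y \<in> {0..R}"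
    have E2: "0 \<le> d * E2 1 y" using d by (simp add: E2_def)
    show "0 \<le> f 1 y"
    proof (cases "1 \<le> y")
      case True
      then show ?thesis
        using E2 by (simp add: f_def E1_def u_terminal_one)
    next
      case False
      have "E1 1 y \<ge> exp 0"
        unfolding E1_def using B False T by (subst exp_le_cancel_iff) (simp add: b_def)
      then show ?thesis
        using E2 u_nonneg[of 1 y] y by (simp add: f_def)
    qed
  next
    fix t assume t: "t \<in> {T..1}"
    have "E1 t 0 \<ge> exp 0"
      unfolding E1_def using b_mono[of T t] t T by (subst exp_le_cancel_iff) simp
    then show "0 \<le> f t 0"
      using u_zero[of t] t T d by (simp add: f_def E2_def)
    have "b t \<le> b 1" using b_mono[of t 1] t T by simp
    then have "exp (- ln d) \<le> E2 t R"
      unfolding E2_def R_def using t by (subst exp_le_cancel_iff) simp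
    then have "1 \<le> d * E2 t R"
      using d by (simp add: exp_minus field_simps)
    moreover have "0 \<le> u (t, R)"
      using t T ln b0 by (intro u_nonneg) (auto simp: R_def)
    moreover have "0 \<le> E1 t R" by (simp add: E1_def)
    ultimately show "0 \<le> f t R"
      unfolding f_def by linarith
  qed (use T y ln b0 in \<open>auto simp: R_def\<close>)
  moreover have "E1 T y = exp (-y)" by (simp add: E1_def)
  moreover have "d * E2 T y \<le> d * exp y"
  proof -
    have "0 \<le> b T" using nu T by (simp add: b_def drift_prim_def)
    then show ?thesis
      using d T unfolding E2_def by (intro mult_left_mono) auto
  qed
  ultimately show ?thesis by (simp add: f_def)
qed

lemma u_lower_bound:
  assumes T: "0 < T" "T < 1" and B: "drift_prim \<nu> 1 - drift_prim \<nu> T \<ge> 3/2"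
    and y: "0 \<le> y" "y \<le> 1"
  shows "1 - exp (-y) \<le> u (T, y)"
proof (rule tendsto_upperbound)
  show "((\<lambda>d. 1 - exp (-y) - d * exp y) \<longlongrightarrow> 1 - exp (-y)) (at_right 0)"
    by (rule tendsto_eq_intros refl | simp)+
  show "\<forall>\<^sub>F d in at_right 0. 1 - exp (-y) - d * exp y \<le> u (T, y)"
  proof -
    have "\<forall>\<^sub>F d in at_right 0. d \<in> {0<..<exp (-1::real)}"
      by (rule eventually_at_right_real) simp
    then show ?thesis
      by eventually_elim (rule u_lower_bound_perturbed[OF T B _ _ y], auto)
  qed
qed simp

text \<open>With the drift frozen at time \<open>t\<close>, \<open>exp (- 2 c y)\<close> is the probability of ever
reaching \<open>0\<close> from \<open>y\<close>. Half of that exponent, \<open>\<lambda> = t powr (-\<nu>)\<close>, leaves a margin \<open>- \<lambda>\<^sup>2 / 2\<close> in the equation,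
and the margin absorbs the derivative of \<open>\<lambda>\<close> up to an error of at most \<open>2 t powr (2 \<nu> - 2)\<close>. For \<open>\<nu> > 1/2\<close>
this error is integrable at \<open>0\<close>, and subtracting its integral makes the barrier a
subsolution. The assumption on \<open>T\<close> keeps that integral below \<open>1/2\<close>.\<close>

lemma u_lower_bound_near_origin:
  assumes T: "0 < T" "T < 1" and B: "drift_prim \<nu> 1 - drift_prim \<nu> T \<ge> 3/2"
    and \<eta>: "2 * T powr (2 * \<nu> - 1) / (2 * \<nu> - 1) \<le> 1 / 2"
    and t: "0 < t" "t \<le> T" and y: "0 \<le> y" "y \<le> 1"
  shows "T powr \<nu> / 2 * (1 / 2 - exp (- (t powr (-\<nu>) * y))) \<le> u (t, y)"
proof -
  define \<alpha> where "\<alpha> = 2 * \<nu> - 1"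
  have \<alpha>: "0 < \<alpha>" using nu by (simp add: \<alpha>_def)
  define a where "a = T powr \<nu> / 2"
  have a: "0 < a" "a \<le> 1 / 2"
    using T nu powr_le_one_le[of T] powr_mono2[of \<nu> T 1] by (auto simp: a_def)
  \<comment> \<open>the integral from \<open>s\<close> to \<open>T\<close> of the error \<open>2 r powr (2 \<nu> - 2)\<close>\<close>
  define h where "h = (\<lambda>s. 2 * (T powr \<alpha> - s powr \<alpha>) / \<alpha>)"
  have h_nonneg: "0 \<le> h s" if "0 < s" "s \<le> T" for s
    using that \<alpha> by (auto simp: h_def intro!: divide_nonneg_pos powr_mono2)
  have h_le: "h s \<le> 1 / 2" if "0 < s" "s \<le> T" for s
  proof -
    have "h s \<le> 2 * T powr \<alpha> / \<alpha>"
      using \<alpha> by (auto simp: h_def intro!: divide_right_mono)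
    with \<eta> show ?thesis by (simp add: \<alpha>_def)
  qed
  define E where "E = (\<lambda>s y. exp (- (s powr (-\<nu>) * y)))"
  define f where "f = (\<lambda>s y. u (s, y) - a * (1 - E s y - h s))"
  have T1: "1 \<le> s powr (-\<nu>)" if "0 < s" "s \<le> 1" for s
    using powr_mono2'[of "-\<nu>" s 1] that nu by simp
  \<comment> \<open>the hypotheses on \<open>T\<close> are inherited by all earlier times, so the side \<open>y = 1\<close> is covered as well\<close>
  have low: "y / 2 \<le> u (s, y)" if "0 < s" "s \<le> T" "0 \<le> y" "y \<le> 1" for s y
  proof -
    have "drift_prim \<nu> s \<le> drift_prim \<nu> T"
      using drift_prim_increment[of s T] that T by simp
    then have "1 - exp (-y) \<le> u (s, y)"
      using that T B by (intro u_lower_bound) auto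
    with half_le_one_minus_exp[OF that(3,4)] show ?thesis by simp
  qed
  have "0 \<le> f t y"
  proof (rule parabolic_minimum_principle[where f=f and R=1 and lo=t and hi=T and t=t and k="\<lambda>t y. drift_coeff \<nu> t"
       and ft="\<lambda>t y. - (1/2) * q (t, y) - drift_coeff \<nu> t * p (t, y) - a * (- (E t y * (\<nu> * t powr (-\<nu> - 1) * y)) + 2 * t powr (\<alpha> - 1))"
       and fx="\<lambda>t y. p (t, y) - a * (E t y * t powr (-\<nu>))"
       and fxx="\<lambda>t y. q (t, y) + a * (E t y * (t powr (-\<nu>))\<^sup>2)"])
    have "continuous_on ({t..T} \<times> {0..1}) (\<lambda>z. u z - a * (1 - exp (- (fst z powr (-\<nu>) * snd z)) - 2 * (T powr \<alpha> - fst z powr \<alpha>) / \<alpha>))"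
      by (intro continuous_intros continuous_on_subset[OF cont])
         (use T t \<alpha> in \<open>auto simp: dom_G_def\<close>)
    then show "continuous_on ({t..T} \<times> {0..1}) (\<lambda>(t, y). f t y)"
      by (simp add: f_def E_def h_def case_prod_unfold)
  next
    fix s y assume sy: "s \<in> {t..<T}" "y \<in> {0<..<1::real}"
    have s0: "s \<noteq> 0" "s < 1" "0 < y" "0 < s" using sy t T by auto
    have dE: "((\<lambda>s. E s y) has_real_derivative E s y * (\<nu> * s powr (-\<nu> - 1) * y)) (at s)"
      unfolding E_def using s0 by (auto intro!: derivative_eq_intros)
    have dh: "(h has_real_derivative - (2 * s powr (\<alpha> - 1))) (at s)"
      unfolding h_def using s0 \<alpha> by (auto intro!: derivative_eq_intros)
    have "((\<lambda>s. f s y) has_real_derivative - (1/2) * q (s, y) - drift_coeff \<nu> s * p (s, y) - a * (0 - E s y * (\<nu> * s powr (-\<nu> - 1) * y) - - (2 * s powr (\<alpha> - 1)))) (at s)"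
      unfolding f_def by (intro DERIV_diff DERIV_cmult DERIV_const dt dE dh s0)
    then show "((\<lambda>s. f s y) has_real_derivative - (1/2) * q (s, y) - drift_coeff \<nu> s * p (s, y) - a * (- (E s y * (\<nu> * s powr (-\<nu> - 1) * y)) + 2 * s powr (\<alpha> - 1))) (at s)"
      by simp
    show "(f s has_real_derivative p (s, y) - a * (E s y * s powr (-\<nu>))) (at y)"
      unfolding f_def E_def using s0
      by (auto intro!: derivative_eq_intros dx strip_in_dom_G)
    show "((\<lambda>y. p (s, y) - a * (E s y * s powr (-\<nu>))) has_real_derivative q (s, y) + a * (E s y * (s powr (-\<nu>))\<^sup>2)) (at y)"
      unfolding E_def using s0
      by (auto intro!: derivative_eq_intros dxx simp: power2_eq_square)
    define P where "P = s powr (-\<nu>)"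
    have P: "0 < P" using s0 by (simp add: P_def)
    have p1: "s powr (-\<nu> - 1) = P / s"
      using s0 by (simp add: P_def powr_diff)
    have p2: "s powr (\<alpha> - 1) = 1 / (P\<^sup>2 * s\<^sup>2)"
    proof -
      have "P\<^sup>2 * s\<^sup>2 = s powr (2 - 2 * \<nu>)"
      proof -
        have "P\<^sup>2 = s powr (-\<nu> + -\<nu>)"
          by (simp only: P_def power2_eq_square powr_add)
        moreover have "s\<^sup>2 = s powr 2"
          using s0 by simp
        ultimately show ?thesis
          by (simp only: powr_add[symmetric]) (simp add: algebra_simps)
      qed
      then show ?thesis
        using powr_minus_divide[of s "2 - 2 * \<nu>"] by (simp add: \<alpha>_def)
    qed
    have "E s y * (\<nu> * (P * y) - P\<^sup>2 * s / 2) \<le> 2 / (P\<^sup>2 * s)"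
      unfolding E_def P_def[symmetric]
      by (rule boundary_layer_inequality) (use P s0 nu in auto)
    then have "(E s y * (\<nu> * (P * y) - P\<^sup>2 * s / 2)) / s \<le> (2 / (P\<^sup>2 * s)) / s"
      using s0 by (intro divide_right_mono) auto
    then have key: "E s y * (\<nu> * (P / s) * y) - E s y * P\<^sup>2 / 2 - 2 * (1 / (P\<^sup>2 * s\<^sup>2)) \<le> 0"
      using s0 by (simp add: field_simps power2_eq_square)
    have "- (1/2) * q (s, y) - drift_coeff \<nu> s * p (s, y) - a * (- (E s y * (\<nu> * s powr (-\<nu> - 1) * y)) + 2 * s powr (\<alpha> - 1))
        + 1 / 2 * (q (s, y) + a * (E s y * (s powr (-\<nu>))\<^sup>2)) + drift_coeff \<nu> s * (p (s, y) - a * (E s y * s powr (-\<nu>)))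
       = a * (E s y * (\<nu> * (P / s) * y) - E s y * P\<^sup>2 / 2 - 2 * (1 / (P\<^sup>2 * s\<^sup>2)))"
      unfolding p1 p2 P_def[symmetric] using s0
      by (simp add: drift_coeff_def P_def[symmetric] algebra_simps power2_eq_square)
    also have "\<dots> \<le> 0"
      using key a by (intro mult_nonneg_nonpos) auto
    finally show "- (1/2) * q (s, y) - drift_coeff \<nu> s * p (s, y) - a * (- (E s y * (\<nu> * s powr (-\<nu> - 1) * y)) + 2 * s powr (\<alpha> - 1))
        + 1 / 2 * (q (s, y) + a * (E s y * (s powr (-\<nu>))\<^sup>2)) + drift_coeff \<nu> s * (p (s, y) - a * (E s y * s powr (-\<nu>))) \<le> 0" .
  next
    fix y :: real assume y: "y \<in> {0..1}"
    have "1 - E T y \<le> T powr (-\<nu>) * y"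
      using exp_ge_add_one_self[of "- (T powr (-\<nu>) * y)"] by (simp add: E_def)
    then have "a * (1 - E T y) \<le> a * (T powr (-\<nu>) * y)"
      using a by (intro mult_left_mono) auto
    also have "\<dots> = y / 2"
      using T by (simp add: a_def powr_minus field_simps)
    also have "\<dots> \<le> u (T, y)"
      using low[of T y] y T by simp
    finally show "0 \<le> f T y"
      by (simp add: f_def h_def)
  next
    fix s assume s: "s \<in> {t..T}"
    show "0 \<le> f s 0"
      using u_zero[of s] s t T a h_nonneg[of s] by (simp add: f_def E_def)
    have "0 \<le> E s 1" by (simp add: E_def)
    then have "1 - E s 1 - h s \<le> 1"
      using h_nonneg[of s] s t by auto
    then have "a * (1 - E s 1 - h s) \<le> a * 1"
      using a by (intro mult_left_mono) auto
    also have "\<dots> \<le> u (s, 1)"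
      using a low[of s 1] s t by simp
    finally show "0 \<le> f s 1"
      by (simp add: f_def)
  qed (use t y in auto)
  moreover have "a * (1 / 2 - E t y) \<le> a * (1 - E t y - h t)"
    using a h_le[of t] t by (intro mult_left_mono) auto
  ultimately show ?thesis
    by (simp add: f_def a_def E_def)
qed

lemma no_limit_at_origin: "\<not> (u \<longlongrightarrow> l) (at (0, 0))"
proof
  assume l: "(u \<longlongrightarrow> l) (at (0, 0))"
  \<comment> \<open>two curves into the origin: along \<open>k = 0\<close> the function vanishes, along \<open>k = 2\<close> it stays away from \<open>0\<close>\<close>
  have t0: "filterlim (\<lambda>t. (t, k * t powr \<nu>)) (at (0, 0)) (at_right (0::real))" for k :: real
  proof -
    have "((\<lambda>t. (t, k * t powr \<nu>)) \<longlongrightarrow> (0, k * 0)) (at_right (0::real))"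
      by (intro tendsto_Pair tendsto_ident_at tendsto_mult tendsto_const powr_tendsto_zero_at_right)
         (use nu in auto)
    moreover have "\<forall>\<^sub>F t in at_right 0. (t, k * t powr \<nu>) \<noteq> (0, 0)"
      using eventually_at_right_less[of "0::real"] by (auto elim!: eventually_mono)
    ultimately show ?thesis
      by (auto simp: filterlim_at)
  qed
  have "((\<lambda>t. u (t, 0)) \<longlongrightarrow> l) (at_right 0)"
    using filterlim_compose[OF l t0[of 0]] by simp
  moreover have "\<forall>\<^sub>F t in at_right 0. u (t, 0) = 0"
    using eventually_at_right_real[of 0 1] by (auto elim!: eventually_mono simp: u_zero)
  ultimately have "((\<lambda>t. 0) \<longlongrightarrow> l) (at_right (0::real))"
    by (rule Lim_transform_eventually)
  then have l0: "l = 0"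
    by (simp add: tendsto_const_iff)
  have lim1: "((\<lambda>T. drift_prim \<nu> 1 - drift_prim \<nu> T) \<longlongrightarrow> drift_prim \<nu> 1 - drift_prim \<nu> 0) (at_right 0)"
    using continuous_on_drift_prim[OF nu(2), of UNIV]
    by (intro tendsto_intros) (auto simp: continuous_on_def intro: tendsto_within_subset)
  have d1: "drift_prim \<nu> 1 - drift_prim \<nu> 0 > 3 / 2"
    using nu by (simp add: drift_prim_def field_simps)
  have "((\<lambda>T. 2 * T powr (2 * \<nu> - 1) / (2 * \<nu> - 1)) \<longlongrightarrow> 2 * 0 / (2 * \<nu> - 1)) (at_right (0::real))"
    by (intro tendsto_divide tendsto_mult tendsto_const powr_tendsto_zero_at_right) (use nu in auto)
  then have lim2: "((\<lambda>T. 2 * T powr (2 * \<nu> - 1) / (2 * \<nu> - 1)) \<longlongrightarrow> 0) (at_right (0::real))"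
    by simp
  have "\<forall>\<^sub>F T in at_right 0. T \<in> {0<..<1::real} \<and> drift_prim \<nu> 1 - drift_prim \<nu> T > 3 / 2
      \<and> 2 * T powr (2 * \<nu> - 1) / (2 * \<nu> - 1) < 1 / 2"
    by (intro eventually_conj eventually_at_right_real order_tendstoD(1)[OF lim1 d1] order_tendstoD(2)[OF lim2]) auto
  then obtain T where T: "0 < T" "T < 1" "drift_prim \<nu> 1 - drift_prim \<nu> T \<ge> 3 / 2"
      "2 * T powr (2 * \<nu> - 1) / (2 * \<nu> - 1) \<le> 1 / 2"
    by (auto dest!: eventually_happens simp: less_imp_le)
  have lim: "((\<lambda>t. u (t, 2 * t powr \<nu>)) \<longlongrightarrow> 0) (at_right 0)"
    using filterlim_compose[OF l t0[of 2]] l0 by simp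
  have e2: "exp (-2::real) \<le> 1 / 3"
    using exp_ge_add_one_self[of 2] by (simp add: exp_minus field_simps)
  have "((\<lambda>t. 2 * t powr \<nu>) \<longlongrightarrow> 2 * 0) (at_right (0::real))"
    by (intro tendsto_mult tendsto_const powr_tendsto_zero_at_right) (use nu in auto)
  then have small: "((\<lambda>t. 2 * t powr \<nu>) \<longlongrightarrow> 0) (at_right (0::real))"
    by simp
  have ev: "\<forall>\<^sub>F t in at_right 0. t \<in> {0<..<T} \<and> 2 * t powr \<nu> < 1"
    by (intro eventually_conj eventually_at_right_real order_tendstoD(2)[OF small]) (use T in auto)
  have "\<forall>\<^sub>F t in at_right 0. T powr \<nu> / 2 * (1 / 6) \<le> u (t, 2 * t powr \<nu>)"
    using ev
  proof eventually_elim
    case (elim t)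
    have "T powr \<nu> / 2 * (1 / 2 - exp (- (t powr (-\<nu>) * (2 * t powr \<nu>)))) \<le> u (t, 2 * t powr \<nu>)"
      by (rule u_lower_bound_near_origin[OF T]) (use elim in auto)
    moreover have "t powr (-\<nu>) * (2 * t powr \<nu>) = 2"
      using elim by (simp add: powr_minus)
    moreover have "T powr \<nu> / 2 * (1 / 6) \<le> T powr \<nu> / 2 * (1 / 2 - exp (-2))"
      using e2 by (intro mult_left_mono) auto
    ultimately show ?case by simp
  qed
  from tendsto_lowerbound[OF lim this] have "T powr \<nu> / 2 * (1 / 6) \<le> 0" by simp
  with T show False by (simp add: mult_le_0_iff)
qed

end

section \<open>Averages over boxes\<close>

text \<open>The mean over \<open>[x - e, x + e]\<close>, written over a fixed interval so that it visibly commutes with translations and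
with continuous dependence on parameters. Its derivative is a central difference of the function itself, so that \<open>n\<close>-fold means
of a merely bounded continuous function have \<open>n\<close> derivatives with explicit bounds.\<close>

definition box_mean :: "real \<Rightarrow> (real \<Rightarrow> real) \<Rightarrow> real \<Rightarrow> real" where
  "box_mean e f x = integral {-1..1} (\<lambda>y. f (x + e * y)) / 2"

definition central_diff :: "real \<Rightarrow> (real \<Rightarrow> real) \<Rightarrow> real \<Rightarrow> real" where
  "central_diff e f x = (f (x + e) - f (x - e)) / (2 * e)"

lemma box_mean_integrable:
  fixes f :: "real \<Rightarrow> real"
  assumes "continuous_on UNIV f"
  shows "(\<lambda>y. f (x + e * y)) integrable_on {-1..1}"
  by (intro integrable_continuous_interval continuous_on_compose2[OF assms] continuous_intros) auto

lemma box_mean_eq_central_diff: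
  assumes F: "\<And>x. (F has_real_derivative f x) (at x)" and e: "0 < e"
  shows "box_mean e f = central_diff e F"
proof
  fix x
  have "((\<lambda>y. f (x + e * y)) has_integral (F (x + e * 1) / e - F (x + e * (-1)) / e)) {-1..1}"
  proof (rule fundamental_theorem_of_calculus)
    fix y :: real
    have "((\<lambda>y. F (x + e * y)) has_real_derivative f (x + e * y) * e) (at y)"
      by (rule DERIV_chain2[OF F]) (auto intro!: derivative_eq_intros)
    from DERIV_cdivide[OF this, of e]
    show "((\<lambda>y. F (x + e * y) / e) has_vector_derivative f (x + e * y)) (at y within {-1..1})"
      using e by (simp add: has_real_derivative_iff_has_vector_derivative has_vector_derivative_at_within)
  qed simp
  then show "box_mean e f x = central_diff e F x"
    unfolding box_mean_def central_diff_def using e by (simp add: integral_unique diff_divide_distrib)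
qed

lemma continuous_antiderivative:
  fixes f :: "real \<Rightarrow> real"
  assumes "continuous_on UNIV f"
  obtains F where "\<And>x. (F has_real_derivative f x) (at x)"
proof -
  have "\<exists>F. \<forall>x :: real. (-\<infinity> :: ereal) < x \<longrightarrow> x < (\<infinity> :: ereal) \<longrightarrow> (F has_vector_derivative f x) (at x)"
    using assms by (intro einterval_antiderivative) (auto simp: continuous_on_eq_continuous_at)
  then show ?thesis
    using that by (auto simp: has_real_derivative_iff_has_vector_derivative)
qed

lemma DERIV_central_diff:
  assumes "\<And>x. (F has_real_derivative f x) (at x)"
  shows "(central_diff e F has_real_derivative central_diff e f x) (at x)"
proof -
  have "((\<lambda>x. F (x + e)) has_real_derivative f (x + e)) (at x)"
    by (subst DERIV_shift[symmetric]) (rule assms)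
  moreover have "((\<lambda>x. F (x + (- e))) has_real_derivative f (x + (- e))) (at x)"
    by (subst DERIV_shift[symmetric]) (rule assms)
  ultimately show ?thesis
    unfolding central_diff_def[abs_def] by (intro DERIV_cdivide DERIV_diff) auto
qed

lemma DERIV_box_mean:
  assumes "continuous_on UNIV f" "0 < e"
  shows "(box_mean e f has_real_derivative central_diff e f x) (at x)"
proof -
  obtain F where F: "\<And>x. (F has_real_derivative f x) (at x)"
    using continuous_antiderivative[OF assms(1)] by blast
  show ?thesis
    unfolding box_mean_eq_central_diff[OF F assms(2)] by (rule DERIV_central_diff[OF F])
qed

lemma continuous_box_mean:
  assumes "continuous_on UNIV f" "0 < e"
  shows "continuous_on UNIV (box_mean e f)"
  by (rule DERIV_continuous_on[OF has_field_derivative_at_within[OF DERIV_box_mean[OF assms]]])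

lemma continuous_central_diff:
  assumes "continuous_on UNIV f"
  shows "continuous_on UNIV (central_diff e f)"
proof (cases "e = 0")
  case False
  then show ?thesis
    unfolding central_diff_def[abs_def]
    by (intro continuous_intros continuous_on_compose2[OF assms]) auto
qed (simp add: central_diff_def[abs_def])

lemma box_mean_diff_bound:
  assumes f: "continuous_on UNIV f" and g: "continuous_on UNIV g" and e: "0 < e"
    and K: "\<And>z. \<bar>z\<bar> \<le> e \<Longrightarrow> \<bar>f (x + z) - g (y + z)\<bar> \<le> K"
  shows "\<bar>box_mean e f x - box_mean e g y\<bar> \<le> K"
proof -
  have "\<bar>integral {-1..1} (\<lambda>z. f (x + e * z) - g (y + e * z))\<bar> \<le> K * (1 - (-1))"
    unfolding real_norm_def[symmetric]
  proof (rule integral_bound)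
    show "continuous_on {-1..1} (\<lambda>z. f (x + e * z) - g (y + e * z))"
      by (intro continuous_intros continuous_on_compose2[OF f] continuous_on_compose2[OF g]) auto
    show "norm (f (x + e * z) - g (y + e * z)) \<le> K" if "z \<in> {-1..1}" for z
      using K[of "e * z"] that e by (auto simp: abs_mult abs_le_iff intro!: mult_left_le)
  qed simp
  then show ?thesis
    by (simp add: box_mean_def integral_diff box_mean_integrable f g flip: diff_divide_distrib)
qed

lemma continuous_box_means:
  assumes "continuous_on UNIV f" "0 < e"
  shows "continuous_on UNIV ((box_mean e ^^ n) f)"
  by (induction n) (auto intro: continuous_box_mean assms)

text \<open>One estimate serves four purposes: with \<open>g = 0\<close> it is the bound by the supremum, with \<open>f = g\<close> it preserves
moduli of continuity, with \<open>K = 0\<close> it says that the means at \<open>x\<close> depend only on values within distance \<open>n e\<close>, and with \<open>g\<close>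
constant it gives convergence as \<open>e \<rightarrow> 0\<close>.\<close>

lemma box_means_diff_bound:
  assumes f: "continuous_on UNIV f" and g: "continuous_on UNIV g" and e: "0 < e"
    and K: "\<And>z. \<bar>z\<bar> \<le> real n * e \<Longrightarrow> \<bar>f (x + z) - g (y + z)\<bar> \<le> K"
  shows "\<bar>(box_mean e ^^ n) f x - (box_mean e ^^ n) g y\<bar> \<le> K"
  using K
proof (induction n arbitrary: x y)
  case 0
  then show ?case by (metis add_0_right abs_zero funpow_0 mult_zero_left of_nat_0 order_refl)
next
  case (Suc n)
  show ?case
    unfolding funpow.simps comp_def
  proof (rule box_mean_diff_bound[OF continuous_box_means[OF f e] continuous_box_means[OF g e] e])
    fix z :: real assume z: "\<bar>z\<bar> \<le> e"
    show "\<bar>(box_mean e ^^ n) f (x + z) - (box_mean e ^^ n) g (y + z)\<bar> \<le> K"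
    proof (rule Suc.IH)
      fix w :: real assume "\<bar>w\<bar> \<le> real n * e"
      then have "\<bar>z + w\<bar> \<le> real (Suc n) * e"
        using z by (simp add: algebra_simps)
      from Suc.prems[OF this] show "\<bar>f (x + z + w) - g (y + z + w)\<bar> \<le> K"
        by (simp add: add.assoc)
    qed
  qed
qed

lemma box_mean_const [simp]: "box_mean e (\<lambda>x. c) = (\<lambda>x. c)"
  by (simp add: box_mean_def fun_eq_iff)

lemma box_means_const [simp]: "(box_mean e ^^ n) (\<lambda>x. c) = (\<lambda>x. c)"
  by (induction n) auto

lemma box_means_bound:
  assumes "continuous_on UNIV f" "0 < e" "\<And>z. \<bar>f z\<bar> \<le> K"
  shows "\<bar>(box_mean e ^^ n) f x\<bar> \<le> K"
  using box_means_diff_bound[of f "\<lambda>_. 0" e n x x K] assms by simp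

lemma box_mean_lincomb:
  assumes "continuous_on UNIV f" "continuous_on UNIV g"
  shows "box_mean e (\<lambda>x. a * f x + b * g x) = (\<lambda>x. a * box_mean e f x + b * box_mean e g x)"
proof
  fix x
  have "integral {-1..1} (\<lambda>y. a * f (x + e * y) + b * g (x + e * y)) =
     a * integral {-1..1} (\<lambda>y. f (x + e * y)) + b * integral {-1..1} (\<lambda>y. g (x + e * y))"
    by (subst Henstock_Kurzweil_Integration.integral_add)
       (auto intro!: integrable_on_mult_right box_mean_integrable[of f] box_mean_integrable[of g] assms)
  then show "box_mean e (\<lambda>x. a * f x + b * g x) x = a * box_mean e f x + b * box_mean e g x"
    by (simp add: box_mean_def add_divide_distrib)
qed

lemma box_mean_shift: "box_mean e (\<lambda>x. f (x + c)) x = box_mean e f (x + c)"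
  by (simp add: box_mean_def algebra_simps)

lemma box_mean_central_diff:
  assumes "continuous_on UNIV f"
  shows "box_mean e (central_diff e f) = central_diff e (box_mean e f)"
proof -
  have 1: "central_diff e f = (\<lambda>x. 1 / (2 * e) * f (x + e) + (- 1 / (2 * e)) * f (x + (- e)))"
    by (simp add: central_diff_def fun_eq_iff diff_divide_distrib)
  have 2: "continuous_on UNIV (\<lambda>x. f (x + c))" for c
    by (intro continuous_on_compose2[OF assms] continuous_intros) auto
  show ?thesis
    unfolding 1 box_mean_lincomb[OF 2 2] box_mean_shift
    by (simp add: central_diff_def fun_eq_iff diff_divide_distrib)
qed

lemma box_means_central_diff:
  assumes "continuous_on UNIV f" "0 < e"
  shows "(box_mean e ^^ n) (central_diff e f) = central_diff e ((box_mean e ^^ n) f)"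
  by (induction n) (auto simp: box_mean_central_diff continuous_box_means assms)

lemma box_means_lincomb:
  assumes "continuous_on UNIV f" "continuous_on UNIV g" "0 < e"
  shows "(box_mean e ^^ n) (\<lambda>x. a * f x + b * g x) = (\<lambda>x. a * (box_mean e ^^ n) f x + b * (box_mean e ^^ n) g x)"
  by (induction n) (auto simp: box_mean_lincomb continuous_box_means assms)

lemma box_mean_reflect: "box_mean e (\<lambda>x. f (- x)) x = box_mean e f (- x)"
proof -
  have "integral {- 1..- (-1)} (\<lambda>y. f (- x + e * - y)) = integral {-1..1} (\<lambda>y. f (- x + e * y))"
    by (rule Henstock_Kurzweil_Integration.integral_reflect_real)
  then show ?thesis
    by (simp add: box_mean_def)
qed

lemma box_means_even:
  assumes "\<And>x. f (- x) = f x"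
  shows "(box_mean e ^^ n) f (- x) = (box_mean e ^^ n) f x"
proof (induction n arbitrary: x)
  case (Suc n)
  have "(\<lambda>x. (box_mean e ^^ n) f (- x)) = (box_mean e ^^ n) f"
    by (simp add: Suc.IH fun_eq_iff)
  with box_mean_reflect[of e "(box_mean e ^^ n) f" x] show ?case by simp
qed (simp add: assms)

lemma central_diff_bound:
  assumes "\<And>x. \<bar>f x\<bar> \<le> K" "0 < e"
  shows "\<bar>central_diff e f x\<bar> \<le> K / e"
proof -
  have "\<bar>f (x + e) - f (x - e)\<bar> \<le> K + K"
    using assms(1)[of "x + e"] assms(1)[of "x - e"] by linarith
  then show ?thesis
    using assms(2) by (simp add: central_diff_def abs_divide field_simps)
qed

lemma lipschitz_if_DERIV_bounded:
  fixes f :: "real \<Rightarrow> real"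
  assumes "\<And>x. (f has_real_derivative f' x) (at x)" "\<And>x. \<bar>f' x\<bar> \<le> K"
  shows "\<bar>f x - f y\<bar> \<le> K * \<bar>x - y\<bar>"
  using field_differentiable_bound[of UNIV f f' K y x] assms
  by (simp add: has_field_derivative_at_within abs_minus_commute)

lemma continuous_on_param_compose:
  fixes h :: "'a::topological_space \<Rightarrow> 'b::topological_space \<Rightarrow> 'c::topological_space"
  assumes "continuous_on (T \<times> UNIV) (\<lambda>(t, x). h t x)"
    and "continuous_on S \<alpha>" "continuous_on S \<beta>" "\<And>z. z \<in> S \<Longrightarrow> \<alpha> z \<in> T"
  shows "continuous_on S (\<lambda>z. h (\<alpha> z) (\<beta> z))"
  using continuous_on_compose2[OF assms(1) continuous_on_Pair[OF assms(2,3)]] assms(4)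
  by (auto simp: image_subset_iff)

lemma continuous_on_box_mean_param:
  fixes h :: "real \<Rightarrow> real \<Rightarrow> real"
  assumes h: "continuous_on (T \<times> UNIV) (\<lambda>(t, x). h t x)"
  shows "continuous_on (T \<times> UNIV) (\<lambda>(t, x). box_mean e (h t) x)"
proof -
  have "continuous_on ((T \<times> UNIV) \<times> cbox (-1) 1) (\<lambda>(z, y). h (fst z) (snd z + e * y))"
    unfolding case_prod_unfold
    by (rule continuous_on_param_compose[OF h]) (auto intro!: continuous_intros)
  from integral_continuous_on_param[OF this]
  show ?thesis
    unfolding box_mean_def case_prod_unfold by (intro continuous_intros) auto
qed

lemma continuous_on_central_diff_param:
  fixes h :: "real \<Rightarrow> real \<Rightarrow> real"
  assumes h: "continuous_on (T \<times> UNIV) (\<lambda>(t, x). h t x)"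
  shows "continuous_on (T \<times> UNIV) (\<lambda>(t, x). central_diff e (h t) x)"
proof (cases "e = 0")
  case False
  have "continuous_on (T \<times> UNIV) (\<lambda>z. h (fst z) (snd z + c))" for c
    by (rule continuous_on_param_compose[OF h]) (auto intro!: continuous_intros)
  from this[of e] this[of "- e"] show ?thesis
    using False unfolding central_diff_def case_prod_unfold by (intro continuous_intros) auto
qed (simp add: central_diff_def case_prod_unfold)

lemma continuous_on_box_means_param:
  fixes h :: "real \<Rightarrow> real \<Rightarrow> real"
  assumes h: "continuous_on (T \<times> UNIV) (\<lambda>(t, x). h t x)"
  shows "continuous_on (T \<times> UNIV) (\<lambda>(t, x). (box_mean e ^^ n) (h t) x)"
proof (induction n)
  case (Suc n)
  from continuous_on_box_mean_param[OF this] show ?case by simp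
qed (use h in simp)

lemma continuous_on_slice:
  assumes "continuous_on (T \<times> UNIV) (\<lambda>(t, x). h t x)" "t \<in> T"
  shows "continuous_on UNIV (h t)"
  using continuous_on_param_compose[OF assms(1), of UNIV "\<lambda>_. t" "\<lambda>x. x"] assms(2)
  by simp

lemma continuous_on_slice2:
  assumes "continuous_on (T \<times> UNIV) (\<lambda>(t, x). h t x)"
  shows "continuous_on T (\<lambda>t. h t x)"
  using continuous_on_param_compose[OF assms(1), of T "\<lambda>t. t" "\<lambda>_. x"]
  by simp

text \<open>Averaging in \<open>x\<close> commutes with integration in time, so that an evolution equation in integrated form passes
to the means.\<close>

lemma has_integral_box_mean:
  fixes f h :: "real \<Rightarrow> real \<Rightarrow> real"
  assumes ab: "a \<le> b"
    and h: "continuous_on ({a..b} \<times> UNIV) (\<lambda>(t, x). h t x)"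
    and int: "\<And>x. ((\<lambda>t. h t x) has_integral (f b x - f a x)) {a..b}"
    and f: "continuous_on UNIV (f a)" "continuous_on UNIV (f b)"
  shows "((\<lambda>t. box_mean e (h t) x) has_integral (box_mean e (f b) x - box_mean e (f a) x)) {a..b}"
proof -
  have c: "continuous_on {a..b} (\<lambda>t. box_mean e (h t) x)"
    by (rule continuous_on_slice2[OF continuous_on_box_mean_param[OF h]])
  have "continuous_on (cbox (a, -1) (b, 1)) (\<lambda>(t, y). h t (x + e * y))"
    unfolding case_prod_unfold
    by (rule continuous_on_param_compose[OF h]) (auto intro!: continuous_intros simp: cbox_Pair_eq)
  from integral_swap_continuous[OF this]
  have "integral {a..b} (\<lambda>t. integral {-1..1} (\<lambda>y. h t (x + e * y)))
      = integral {-1..1} (\<lambda>y. integral {a..b} (\<lambda>t. h t (x + e * y)))"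
    by simp
  also have "\<dots> = integral {-1..1} (\<lambda>y. f b (x + e * y) - f a (x + e * y))"
    by (simp only: integral_unique[OF int])
  also have "\<dots> = integral {-1..1} (\<lambda>y. f b (x + e * y)) - integral {-1..1} (\<lambda>y. f a (x + e * y))"
    by (rule integral_diff) (auto intro: box_mean_integrable f)
  finally have "integral {a..b} (\<lambda>t. box_mean e (h t) x) = box_mean e (f b) x - box_mean e (f a) x"
    by (simp add: box_mean_def diff_divide_distrib)
  then show ?thesis
    using integrable_continuous_interval[OF c] by (metis integrable_integral)
qed

lemma has_integral_box_means:
  fixes f h :: "real \<Rightarrow> real \<Rightarrow> real"
  assumes ab: "a \<le> b" and e: "0 < e"
    and h: "continuous_on ({a..b} \<times> UNIV) (\<lambda>(t, x). h t x)"
    and int: "\<And>x. ((\<lambda>t. h t x) has_integral (f b x - f a x)) {a..b}"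
    and f: "continuous_on UNIV (f a)" "continuous_on UNIV (f b)"
  shows "((\<lambda>t. (box_mean e ^^ n) (h t) x) has_integral ((box_mean e ^^ n) (f b) x - (box_mean e ^^ n) (f a) x)) {a..b}"
proof (induction n arbitrary: x)
  case (Suc n)
  from has_integral_box_mean[where f="\<lambda>t. (box_mean e ^^ n) (f t)", OF ab continuous_on_box_means_param[OF h] Suc.IH continuous_box_means[OF f(1) e] continuous_box_means[OF f(2) e]]
  show ?case by simp
qed (use int in simp)

section \<open>Averaging the solution\<close>

text \<open>The regularity of a test function that the formula of Dynkin needs. All bounds are uniform in \<open>x\<close>,
so that no localisation of the process is necessary, and the time derivative is present only in integrated form.\<close>

locale smooth_test =
  fixes a b C :: real and \<Phi> \<Phi>t \<Phi>x \<Phi>xx :: "real \<Rightarrow> real \<Rightarrow> real"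
  assumes ab: "a \<le> b" and C: "0 \<le> C"
    and int: "a \<le> s \<Longrightarrow> s \<le> s' \<Longrightarrow> s' \<le> b \<Longrightarrow> ((\<lambda>r. \<Phi>t r x) has_integral (\<Phi> s' x - \<Phi> s x)) {s..s'}"
    and cont: "continuous_on ({a..b} \<times> UNIV) (\<lambda>(t, x). \<Phi>t t x)"
      "continuous_on ({a..b} \<times> UNIV) (\<lambda>(t, x). \<Phi>x t x)"
      "continuous_on ({a..b} \<times> UNIV) (\<lambda>(t, x). \<Phi>xx t x)"
    and dx: "s \<in> {a..b} \<Longrightarrow> (\<Phi> s has_real_derivative \<Phi>x s x) (at x)"
    and dxx: "s \<in> {a..b} \<Longrightarrow> (\<Phi>x s has_real_derivative \<Phi>xx s x) (at x)"
    and bound: "s \<in> {a..b} \<Longrightarrow> \<bar>\<Phi> s x\<bar> \<le> C" "s \<in> {a..b} \<Longrightarrow> \<bar>\<Phi>t s x\<bar> \<le> C"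
      "s \<in> {a..b} \<Longrightarrow> \<bar>\<Phi>x s x\<bar> \<le> C" "s \<in> {a..b} \<Longrightarrow> \<bar>\<Phi>xx s x\<bar> \<le> C"
    and lip: "s \<in> {a..b} \<Longrightarrow> \<bar>\<Phi>t s x - \<Phi>t s y\<bar> \<le> C * \<bar>x - y\<bar>"
      "s \<in> {a..b} \<Longrightarrow> \<bar>\<Phi>xx s x - \<Phi>xx s y\<bar> \<le> C * \<bar>x - y\<bar>"
    and lip_time: "s \<in> {a..b} \<Longrightarrow> s' \<in> {a..b} \<Longrightarrow> \<bar>\<Phi>x s x - \<Phi>x s' x\<bar> \<le> C * \<bar>s - s'\<bar>"
      "s \<in> {a..b} \<Longrightarrow> s' \<in> {a..b} \<Longrightarrow> \<bar>\<Phi>xx s x - \<Phi>xx s' x\<bar> \<le> C * \<bar>s - s'\<bar>"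

context odd_solution
begin

lemma p_even:
  assumes "t \<le> 1" "t \<noteq> 0"
  shows "p (t, -x) = p (t, x)"
proof -
  have G: "(t, y) \<in> dom_G" for y using assms by (rule strip_in_dom_G)
  have "((\<lambda>y. u (t, - y)) has_real_derivative p (t, x) * (-1)) (at (- x))"
    by (rule DERIV_chain2[where f="\<lambda>y. u (t, y)"]) (use dx[OF G, of x] in \<open>auto intro!: derivative_eq_intros\<close>)
  moreover have "(\<lambda>y. u (t, - y)) = (\<lambda>y. - u (t, y))"
    using odd[OF G] by auto
  ultimately have "((\<lambda>y. - u (t, y)) has_real_derivative p (t, x) * (-1)) (at (- x))"
    by simp
  from DERIV_unique[OF this DERIV_minus[OF dx[OF G]]] show ?thesis by simp
qed

lemma continuous_on_u_strip:
  assumes "b \<le> 1" "0 \<notin> {a..b}"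
  shows "continuous_on ({a..b} \<times> UNIV) (\<lambda>(t, x). u (t, x))"
    "continuous_on ({a..b} \<times> UNIV) (\<lambda>(t, x). u (t, \<bar>x\<bar>))"
    "continuous_on ({a..b} \<times> UNIV) (\<lambda>(t, x). p (t, x))"
proof -
  have sub: "{a..b} \<times> UNIV \<subseteq> dom_G"
    using assms by (auto simp: dom_G_def)
  show "continuous_on ({a..b} \<times> UNIV) (\<lambda>(t, x). u (t, x))"
    using continuous_on_subset[OF cont sub] by (simp add: case_prod_unfold)
  then show "continuous_on ({a..b} \<times> UNIV) (\<lambda>(t, x). u (t, \<bar>x\<bar>))"
    unfolding case_prod_unfold
    by (intro continuous_on_param_compose[where h="\<lambda>t x. u (t, x)"]) (auto intro!: continuous_intros simp: case_prod_unfold)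
  show "continuous_on ({a..b} \<times> UNIV) (\<lambda>(t, x). p (t, x))"
    using continuous_on_subset[OF p_cont sub] by (simp add: case_prod_unfold)
qed

text \<open>The equation integrated over \<open>[a, b] \<times> [r, x]\<close>: the derivatives in \<open>x\<close> integrate to boundary terms at \<open>r\<close> and \<open>x\<close>.\<close>

lemma integrated_equation_half_line:
  assumes ab: "a \<le> b" "b < 1" "0 \<notin> {a..b}"
    and F: "\<And>x. (F has_real_derivative (u (b, x) - u (a, x))) (at x)"
    and r: "0 < r" "r \<le> x"
  shows "F x - F r = integral {a..b} (\<lambda>t. - (1/2) * (p (t, x) - p (t, r)) - drift_coeff \<nu> t * (u (t, x) - u (t, r)))"
proof -
  define ut where "ut = (\<lambda>t x. - (1/2) * q (t, x) - drift_coeff \<nu> t * p (t, x))"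
  have t0: "t < 1" "t \<noteq> 0" "t \<le> 1" if "t \<in> {a..b}" for t using that ab by auto
  have q: "continuous_on ({r..x} \<times> {a..b}) (\<lambda>z. q (snd z, fst z))"
    by (rule continuous_on_compose2[OF q_cont]) (use r t0 in \<open>auto intro!: continuous_intros\<close>)
  have p: "continuous_on ({r..x} \<times> {a..b}) (\<lambda>z. p (snd z, fst z))"
    by (rule continuous_on_compose2[OF p_cont]) (use r t0 in \<open>auto intro!: continuous_intros strip_in_dom_G\<close>)
  have k: "continuous_on ({r..x} \<times> {a..b}) (\<lambda>z. drift_coeff \<nu> (snd z))"
    by (rule continuous_on_compose2[OF continuous_on_drift_coeff[OF ab(3)]]) (auto intro!: continuous_intros)
  have "continuous_on ({r..x} \<times> {a..b}) (\<lambda>z. - (1/2) * q (snd z, fst z) - drift_coeff \<nu> (snd z) * p (snd z, fst z))"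
    by (intro continuous_intros q p k)
  then have "continuous_on (cbox (r, a) (x, b)) (\<lambda>(y, t). ut t y)"
    by (simp add: ut_def case_prod_unfold cbox_Pair_eq)
  from integral_swap_continuous[OF this]
  have swap: "integral {r..x} (\<lambda>y. integral {a..b} (\<lambda>t. ut t y)) = integral {a..b} (\<lambda>t. integral {r..x} (\<lambda>y. ut t y))"
    by simp
  have "((\<lambda>y. u (b, y) - u (a, y)) has_integral (F x - F r)) {r..x}"
    by (rule fundamental_theorem_of_calculus)
       (use r F in \<open>auto simp: has_real_derivative_iff_has_vector_derivative intro: has_vector_derivative_at_within\<close>)
  then have "F x - F r = integral {r..x} (\<lambda>y. u (b, y) - u (a, y))"
    by (simp add: integral_unique)
  also have "\<dots> = integral {r..x} (\<lambda>y. integral {a..b} (\<lambda>t. ut t y))"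
  proof (rule integral_cong)
    fix y assume y: "y \<in> {r..x}"
    have "((\<lambda>t. ut t y) has_integral (u (b, y) - u (a, y))) {a..b}"
    proof (rule fundamental_theorem_of_calculus[OF ab(1)])
      fix t assume t: "t \<in> {a..b}"
      have "((\<lambda>t. u (t, y)) has_real_derivative ut t y) (at t)"
        unfolding ut_def by (rule dt) (use t0[OF t] y r in auto)
      then show "((\<lambda>t. u (t, y)) has_vector_derivative ut t y) (at t within {a..b})"
        by (simp add: has_real_derivative_iff_has_vector_derivative has_vector_derivative_at_within)
    qed
    then show "u (b, y) - u (a, y) = integral {a..b} (\<lambda>t. ut t y)"
      by (simp add: integral_unique)
  qed
  also note swap
  also have "integral {a..b} (\<lambda>t. integral {r..x} (\<lambda>y. ut t y)) =
      integral {a..b} (\<lambda>t. - (1/2) * (p (t, x) - p (t, r)) - drift_coeff \<nu> t * (u (t, x) - u (t, r)))"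
  proof (rule integral_cong)
    fix t assume t: "t \<in> {a..b}"
    have "((\<lambda>y. ut t y) has_integral ((- (1/2) * p (t, x) - drift_coeff \<nu> t * u (t, x)) - (- (1/2) * p (t, r) - drift_coeff \<nu> t * u (t, r)))) {r..x}"
    proof (rule fundamental_theorem_of_calculus[OF r(2)])
      fix y assume y: "y \<in> {r..x}"
      have "((\<lambda>y. - (1/2) * p (t, y) - drift_coeff \<nu> t * u (t, y)) has_real_derivative ut t y) (at y)"
        unfolding ut_def by (intro DERIV_diff DERIV_cmult dxx dx strip_in_dom_G) (use t0[OF t] y r in auto)
      then show "((\<lambda>y. - (1/2) * p (t, y) - drift_coeff \<nu> t * u (t, y)) has_vector_derivative ut t y) (at y within {r..x})"
        by (simp add: has_real_derivative_iff_has_vector_derivative has_vector_derivative_at_within)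
    qed
    then have "integral {r..x} (ut t) = (- (1/2) * p (t, x) - drift_coeff \<nu> t * u (t, x)) - (- (1/2) * p (t, r) - drift_coeff \<nu> t * u (t, r))"
      by (rule integral_unique)
    then show "integral {r..x} (ut t) = - (1/2) * (p (t, x) - p (t, r)) - drift_coeff \<nu> t * (u (t, x) - u (t, r))"
      by (simp add: algebra_simps)
  qed
  finally show ?thesis .
qed

text \<open>The limit \<open>r \<rightarrow> 0\<close> uses only the continuity of \<open>u\<close> and of its first derivative up to \<open>x = 0\<close>. Both sides are
even in \<open>x\<close>, which extends the identity to the whole line.\<close>

lemma integrated_equation:
  assumes ab: "a \<le> b" "b < 1" "0 \<notin> {a..b}"
    and F: "\<And>x. (F has_real_derivative (u (b, x) - u (a, x))) (at x)"
  shows "F x - F 0 = integral {a..b} (\<lambda>t. - (1/2) * (p (t, x) - p (t, 0)) - drift_coeff \<nu> t * u (t, \<bar>x\<bar>))"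
proof -
  have t0: "t < 1" "t \<noteq> 0" "t \<le> 1" if "t \<in> {a..b}" for t using that ab by auto
  have ab01: "a \<in> {a..b}" "b \<in> {a..b}" using ab by auto
  \<comment> \<open>\<open>F\<close> is a primitive of an odd function\<close>
  have even: "F (- x) = F x" for x
  proof -
    have "\<exists>c. \<forall>x\<in>UNIV. F (- x) - F x = c"
    proof (rule has_derivative_zero_constant)
      fix x
      have "((\<lambda>x. F (- x)) has_real_derivative (u (b, - x) - u (a, - x)) * (- 1)) (at x)"
        by (rule DERIV_chain2[OF F]) (auto intro!: derivative_eq_intros)
      from DERIV_diff[OF this F[of x]]
      have "((\<lambda>x. F (- x) - F x) has_real_derivative 0) (at x)"
        using odd[OF strip_in_dom_G[OF t0(3,2)], OF ab01(1) ab01(1)] odd[OF strip_in_dom_G[OF t0(3,2)], OF ab01(2) ab01(2)] by simp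
      then show "((\<lambda>x. F (- x) - F x) has_derivative (\<lambda>h. 0)) (at x within UNIV)"
        by (simp only: has_field_derivative_def lambda_zero)
    qed simp
    then obtain c where "\<And>x. F (- x) - F x = c" by auto
    from this[of x] this[of 0] show ?thesis by simp
  qed
  have pos: "F x - F 0 = integral {a..b} (\<lambda>t. - (1/2) * (p (t, x) - p (t, 0)) - drift_coeff \<nu> t * u (t, x))" if x: "0 < x" for x
  proof -
    define G where "G = (\<lambda>r. integral {a..b} (\<lambda>t. - (1/2) * (p (t, x) - p (t, r)) - drift_coeff \<nu> t * (u (t, x) - u (t, r))))"
    have k: "continuous_on (UNIV \<times> {a..b}) (\<lambda>z. drift_coeff \<nu> (snd z))"
      by (rule continuous_on_compose2[OF continuous_on_drift_coeff[OF ab(3)]]) (auto intro!: continuous_intros)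
    note c = continuous_on_u_strip[OF less_imp_le[OF ab(2)] ab(3)]
    have "continuous_on (UNIV \<times> {a..b}) (\<lambda>z. - (1/2) * (p (snd z, x) - p (snd z, fst z)) - drift_coeff \<nu> (snd z) * (u (snd z, x) - u (snd z, fst z)))"
      by (intro continuous_intros k continuous_on_param_compose[OF c(1), of "UNIV \<times> {a..b}"] continuous_on_param_compose[OF c(3), of "UNIV \<times> {a..b}"]) auto
    then have "continuous_on (UNIV \<times> cbox a b) (\<lambda>(r, t). - (1/2) * (p (t, x) - p (t, r)) - drift_coeff \<nu> t * (u (t, x) - u (t, r)))"
      by (simp add: case_prod_unfold)
    from integral_continuous_on_param[OF this] have "continuous_on UNIV G"
      by (simp add: G_def)
    then have limG: "(G \<longlongrightarrow> G 0) (at_right 0)"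
      by (auto simp: continuous_on_def intro: tendsto_within_subset)
    have limF: "((\<lambda>r. F x - F r) \<longlongrightarrow> F x - F 0) (at_right 0)"
      using DERIV_isCont[OF F[of 0]] by (intro tendsto_intros) (auto simp: isCont_def intro: tendsto_within_subset)
    have "\<forall>\<^sub>F r in at_right 0. G r = F x - F r"
      using eventually_at_right_real[OF x]
      by eventually_elim (use integrated_equation_half_line[OF ab F] in \<open>auto simp: G_def\<close>)
    from Lim_transform_eventually[OF limG this] limF have "F x - F 0 = G 0"
      by (intro tendsto_unique[OF trivial_limit_at_right_real])
    also have "G 0 = integral {a..b} (\<lambda>t. - (1/2) * (p (t, x) - p (t, 0)) - drift_coeff \<nu> t * u (t, x))"
      unfolding G_def by (rule integral_cong) (use t0 u_zero in auto)
    finally show ?thesis .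
  qed
  consider "0 < x" | "x = 0" | "0 < - x" by linarith
  then show ?thesis
  proof cases
    case 1
    then show ?thesis using pos[of x] by simp
  next
    case 2
    have "integral {a..b} (\<lambda>t. - (1/2) * (p (t, 0) - p (t, 0)) - drift_coeff \<nu> t * u (t, \<bar>0\<bar>)) = integral {a..b} (\<lambda>t. 0)"
      by (rule integral_cong) (use t0 u_zero in auto)
    with 2 show ?thesis by simp
  next
    case 3
    have "F x - F 0 = integral {a..b} (\<lambda>t. - (1/2) * (p (t, - x) - p (t, 0)) - drift_coeff \<nu> t * u (t, - x))"
      using pos[OF 3] even[of x] by simp
    also have "\<dots> = integral {a..b} (\<lambda>t. - (1/2) * (p (t, x) - p (t, 0)) - drift_coeff \<nu> t * u (t, \<bar>x\<bar>))"
      by (rule integral_cong) (use 3 t0 p_even in auto)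
    finally show ?thesis .
  qed
qed

text \<open>The boundary term at \<open>x = 0\<close> is the same at both ends of \<open>[x - e, x + e]\<close> and drops out, even if this interval
contains \<open>0\<close>. The drift acts on \<open>u(t, \<bar>y\<bar>)\<close>, whose derivative is \<open>sgn y\<close> times that of \<open>u\<close>.\<close>

lemma box_mean_time_increment:
  assumes ab: "a \<le> b" "b < 1" "0 \<notin> {a..b}" and e: "0 < e"
  shows "((\<lambda>t. - (1/2) * central_diff e (\<lambda>y. p (t, y)) x - drift_coeff \<nu> t * central_diff e (\<lambda>y. u (t, \<bar>y\<bar>)) x)
    has_integral (box_mean e (\<lambda>y. u (b, y)) x - box_mean e (\<lambda>y. u (a, y)) x)) {a..b}"
proof -
  note c = continuous_on_u_strip[OF less_imp_le[OF ab(2)] ab(3)]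
  have ab01: "a \<in> {a..b}" "b \<in> {a..b}" using ab by auto
  have cu: "continuous_on UNIV (\<lambda>y. u (a, y))" "continuous_on UNIV (\<lambda>y. u (b, y))"
    using continuous_on_slice[OF c(1)] ab01 by auto
  then obtain F where F: "\<And>x. (F has_real_derivative (u (b, x) - u (a, x))) (at x)"
    using continuous_antiderivative[of "\<lambda>x. u (b, x) - u (a, x)"] continuous_on_diff by blast
  define h where "h = (\<lambda>x t. - (1/2) * (p (t, x) - p (t, 0)) - drift_coeff \<nu> t * u (t, \<bar>x\<bar>))"
  have int: "(h x has_integral (F x - F 0)) {a..b}" for x
  proof -
    have "continuous_on {a..b} (h x)"
      unfolding h_def
      by (intro continuous_intros continuous_on_drift_coeff ab(3) continuous_on_slice2[OF c(2)] continuous_on_slice2[OF c(3)])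
    then have "h x integrable_on {a..b}"
      by (rule integrable_continuous_interval)
    then show ?thesis
      using integrated_equation[OF ab F, of x] by (simp add: h_def has_integral_iff)
  qed
  have "((\<lambda>t. (h (x + e) t - h (x - e) t) / (2 * e)) has_integral (((F (x + e) - F 0) - (F (x - e) - F 0)) / (2 * e))) {a..b}"
    by (intro has_integral_divide has_integral_diff int)
  moreover have "(\<lambda>t. (h (x + e) t - h (x - e) t) / (2 * e)) =
      (\<lambda>t. - (1/2) * central_diff e (\<lambda>y. p (t, y)) x - drift_coeff \<nu> t * central_diff e (\<lambda>y. u (t, \<bar>y\<bar>)) x)"
    using e by (auto simp: h_def central_diff_def field_simps)
  moreover have "((F (x + e) - F 0) - (F (x - e) - F 0)) / (2 * e) = box_mean e (\<lambda>y. u (b, y)) x - box_mean e (\<lambda>y. u (a, y)) x"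
  proof -
    have "box_mean e (\<lambda>y. 1 * u (b, y) + (- 1) * u (a, y)) x = 1 * box_mean e (\<lambda>y. u (b, y)) x + (- 1) * box_mean e (\<lambda>y. u (a, y)) x"
      using box_mean_lincomb[OF cu(2,1), of e 1 "-1"] by metis
    then have "box_mean e (\<lambda>y. u (b, y)) x - box_mean e (\<lambda>y. u (a, y)) x = box_mean e (\<lambda>x. u (b, x) - u (a, x)) x"
      by simp
    also have "\<dots> = central_diff e F x"
      by (simp add: box_mean_eq_central_diff[OF F e])
    finally show ?thesis by (simp add: central_diff_def)
  qed
  ultimately show ?thesis by simp
qed

end

lemma central_diff_diff_bound:
  assumes "\<And>x. \<bar>f x - g x\<bar> \<le> K" "0 < e"
  shows "\<bar>central_diff e f x - central_diff e g x\<bar> \<le> K / e"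
proof -
  have "central_diff e f x - central_diff e g x = central_diff e (\<lambda>x. f x - g x) x"
    by (simp add: central_diff_def diff_divide_distrib)
  with central_diff_bound[of "\<lambda>x. f x - g x" K e x] assms show ?thesis by simp
qed

context odd_solution
begin

text \<open>Four averages are the number needed here: the second derivative of \<open>averaged\<close> is then still Lipschitz in \<open>x\<close> and,
as two averages remain for the equation to act on, Lipschitz in \<open>t\<close> as well.\<close>

definition averaged :: "real \<Rightarrow> real \<Rightarrow> real \<Rightarrow> real" where
  "averaged e t = (box_mean e ^^ 4) (\<lambda>y. u (t, y))"

definition averaged_x :: "real \<Rightarrow> real \<Rightarrow> real \<Rightarrow> real" where
  "averaged_x e t = central_diff e ((box_mean e ^^ 3) (\<lambda>y. u (t, y)))"

definition averaged_xx :: "real \<Rightarrow> real \<Rightarrow> real \<Rightarrow> real" where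
  "averaged_xx e t = central_diff e (central_diff e ((box_mean e ^^ 2) (\<lambda>y. u (t, y))))"

text \<open>The derivative of the fourfold average of \<open>u(t, \<bar>y\<bar>)\<close>.\<close>

definition folded_x :: "real \<Rightarrow> real \<Rightarrow> real \<Rightarrow> real" where
  "folded_x e t = central_diff e ((box_mean e ^^ 3) (\<lambda>y. u (t, \<bar>y\<bar>)))"

definition averaged_t :: "real \<Rightarrow> real \<Rightarrow> real \<Rightarrow> real" where
  "averaged_t e t x = - (1/2) * averaged_xx e t x - drift_coeff \<nu> t * folded_x e t x"

lemma M_nonneg: "0 \<le> M"
  using bdd[of "(1, 0)"] by (auto simp: dom_G_def)

lemma continuous_u_slice:
  assumes "t \<le> 1" "t \<noteq> 0"
  shows "continuous_on UNIV (\<lambda>y. u (t, y))" "continuous_on UNIV (\<lambda>y. u (t, \<bar>y\<bar>))" "continuous_on UNIV (\<lambda>y. p (t, y))"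
  using continuous_on_slice[OF continuous_on_u_strip(1)[of t t], of t]
    continuous_on_slice[OF continuous_on_u_strip(2)[of t t], of t]
    continuous_on_slice[OF continuous_on_u_strip(3)[of t t], of t] assms by auto

lemma u_bound: "t \<le> 1 \<Longrightarrow> t \<noteq> 0 \<Longrightarrow> \<bar>u (t, x)\<bar> \<le> M"
  using bdd strip_in_dom_G by blast

lemma drift_coeff_bounded:
  assumes "0 \<notin> {a..b}"
  obtains K where "0 \<le> K" "\<And>t. t \<in> {a..b} \<Longrightarrow> drift_coeff \<nu> t \<le> K"
proof -
  have "compact (drift_coeff \<nu> ` {a..b})"
    by (intro compact_continuous_image continuous_on_drift_coeff assms) auto
  then obtain K where K: "\<And>t. t \<in> {a..b} \<Longrightarrow> \<bar>drift_coeff \<nu> t\<bar> \<le> K"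
    using compact_imp_bounded bounded_iff by (metis (no_types, lifting) imageI real_norm_def)
  show ?thesis
    by (rule that[of "max K 0"]) (use K in force)+
qed

lemma DERIV_averaged:
  assumes t: "t \<le> 1" "t \<noteq> 0" and e: "0 < e"
  shows "(averaged e t has_real_derivative averaged_x e t x) (at x)"
    and "(averaged_x e t has_real_derivative averaged_xx e t x) (at x)"
    and "(averaged_xx e t has_real_derivative
           central_diff e (central_diff e (central_diff e (box_mean e (\<lambda>y. u (t, y))))) x) (at x)"
    and "(folded_x e t has_real_derivative
           central_diff e (central_diff e ((box_mean e ^^ 2) (\<lambda>y. u (t, \<bar>y\<bar>)))) x) (at x)"
proof -
  note cu = continuous_u_slice[OF t]
  note cn = continuous_box_means[OF cu(1) e] continuous_box_means[OF cu(2) e]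
  have s: "(box_mean e ^^ 4) f = box_mean e ((box_mean e ^^ 3) f)"
    "(box_mean e ^^ 3) f = box_mean e ((box_mean e ^^ 2) f)"
    "(box_mean e ^^ 2) f = box_mean e (box_mean e f)" for f
    by (simp_all add: eval_nat_numeral)
  show "(averaged e t has_real_derivative averaged_x e t x) (at x)"
    unfolding averaged_def averaged_x_def s(1) by (rule DERIV_box_mean[OF cn(1) e])
  show "(averaged_x e t has_real_derivative averaged_xx e t x) (at x)"
    unfolding averaged_x_def averaged_xx_def s(2) by (intro DERIV_central_diff DERIV_box_mean cn e)
  show "(averaged_xx e t has_real_derivative
           central_diff e (central_diff e (central_diff e (box_mean e (\<lambda>y. u (t, y))))) x) (at x)"
    unfolding averaged_xx_def s(3) by (intro DERIV_central_diff DERIV_box_mean cu continuous_box_mean e)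
  show "(folded_x e t has_real_derivative
           central_diff e (central_diff e ((box_mean e ^^ 2) (\<lambda>y. u (t, \<bar>y\<bar>)))) x) (at x)"
    unfolding folded_x_def s(2) by (intro DERIV_central_diff DERIV_box_mean cn e)
qed

text \<open>The time derivative of a single average. A bound uniform in \<open>x\<close> would
need a global bound for \<open>p\<close>; further averages remove \<open>p\<close> by \<open>box_mean_eq_central_diff\<close>.\<close>

definition mean_t :: "real \<Rightarrow> real \<Rightarrow> real \<Rightarrow> real" where
  "mean_t e t x = - (1/2) * central_diff e (\<lambda>y. p (t, y)) x
     - drift_coeff \<nu> t * central_diff e (\<lambda>y. u (t, \<bar>y\<bar>)) x"

lemma continuous_on_coeff_fst:
  assumes "0 \<notin> {a..b}"
  shows "continuous_on ({a..b} \<times> UNIV) (\<lambda>z. drift_coeff \<nu> (fst z))"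
  by (rule continuous_on_compose2[OF continuous_on_drift_coeff[OF assms]]) (auto intro!: continuous_intros)

lemma continuous_on_mean_t:
  assumes ab: "b < 1" "0 \<notin> {a..b}"
  shows "continuous_on ({a..b} \<times> UNIV) (\<lambda>(t, x). mean_t e t x)"
  using continuous_on_central_diff_param[OF continuous_on_u_strip(3)[OF less_imp_le[OF ab(1)] ab(2)], of e]
    continuous_on_central_diff_param[OF continuous_on_u_strip(2)[OF less_imp_le[OF ab(1)] ab(2)], of e]
    continuous_on_coeff_fst[OF ab(2)]
  unfolding mean_t_def case_prod_unfold by (intro continuous_intros)

lemma box_means_mean_t:
  assumes t: "t \<le> 1" "t \<noteq> 0" and e: "0 < e"
  shows "(box_mean e ^^ Suc n) (mean_t e t) x =
    - (1/2) * central_diff e (central_diff e ((box_mean e ^^ n) (\<lambda>y. u (t, y)))) x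
    - drift_coeff \<nu> t * central_diff e ((box_mean e ^^ Suc n) (\<lambda>y. u (t, \<bar>y\<bar>))) x"
proof -
  note cu = continuous_u_slice[OF t]
  have p: "box_mean e (\<lambda>y. p (t, y)) = central_diff e (\<lambda>y. u (t, y))"
    by (rule box_mean_eq_central_diff[OF dx e]) (use t in \<open>auto intro: strip_in_dom_G\<close>)
  have eq: "mean_t e t = (\<lambda>x. - (1/2) * central_diff e (\<lambda>y. p (t, y)) x
     + (- drift_coeff \<nu> t) * central_diff e (\<lambda>y. u (t, \<bar>y\<bar>)) x)"
    by (simp add: mean_t_def fun_eq_iff)
  have "(box_mean e ^^ Suc n) (central_diff e (\<lambda>y. p (t, y))) = (box_mean e ^^ n) (central_diff e (box_mean e (\<lambda>y. p (t, y))))"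
    by (simp add: funpow_Suc_right box_mean_central_diff cu del: funpow.simps)
  also have "\<dots> = central_diff e (central_diff e ((box_mean e ^^ n) (\<lambda>y. u (t, y))))"
    by (simp add: p box_means_central_diff cu e continuous_central_diff)
  finally have 1: "(box_mean e ^^ Suc n) (central_diff e (\<lambda>y. p (t, y))) =
      central_diff e (central_diff e ((box_mean e ^^ n) (\<lambda>y. u (t, y))))" .
  show ?thesis
    unfolding eq box_means_lincomb[OF continuous_central_diff[OF cu(3)] continuous_central_diff[OF cu(2)] e] 1
    by (simp only: box_means_central_diff[OF cu(2) e])
qed

lemma has_integral_box_means_u:
  assumes ab: "a \<le> b" "b < 1" "0 \<notin> {a..b}" and e: "0 < e"
  shows "((\<lambda>t. (box_mean e ^^ n) (mean_t e t) x) has_integral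
    ((box_mean e ^^ Suc n) (\<lambda>y. u (b, y)) x - (box_mean e ^^ Suc n) (\<lambda>y. u (a, y)) x)) {a..b}"
proof -
  have t: "a \<le> 1" "a \<noteq> 0" "b \<le> 1" "b \<noteq> 0" using ab by auto
  have "((\<lambda>t. (box_mean e ^^ n) (mean_t e t) x) has_integral
    ((box_mean e ^^ n) (box_mean e (\<lambda>y. u (b, y))) x - (box_mean e ^^ n) (box_mean e (\<lambda>y. u (a, y))) x)) {a..b}"
  proof (rule has_integral_box_means[where f="\<lambda>t. box_mean e (\<lambda>y. u (t, y))", OF ab(1) e continuous_on_mean_t[OF ab(2,3)]])
    show "((\<lambda>t. mean_t e t x) has_integral (box_mean e (\<lambda>y. u (b, y)) x - box_mean e (\<lambda>y. u (a, y)) x)) {a..b}" for x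
      unfolding mean_t_def by (rule box_mean_time_increment[OF ab e])
    show "continuous_on UNIV (box_mean e (\<lambda>y. u (a, y)))" "continuous_on UNIV (box_mean e (\<lambda>y. u (b, y)))"
      by (intro continuous_box_mean continuous_u_slice t e)+
  qed
  then show ?thesis
    by (simp add: funpow_Suc_right del: funpow.simps)
qed

text \<open>All derivatives are central differences of averages of bounded functions, so each costs a factor \<open>1 / e\<close> and
the constant depends on \<open>e\<close>. This is harmless: \<open>e\<close> is fixed while the time steps become small.\<close>

lemma smooth_test_averaged:
  assumes ab: "a \<le> b" "b < 1" "0 \<notin> {a..b}" and e: "0 < e"
  obtains C where "smooth_test a b C (averaged e) (averaged_t e) (averaged_x e) (averaged_xx e)"
proof -
  obtain K where K: "0 \<le> K" "\<And>t. t \<in> {a..b} \<Longrightarrow> drift_coeff \<nu> t \<le> K"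
    using drift_coeff_bounded[OF ab(3)] by blast
  define C1 where "C1 = M / e"
  define C2 where "C2 = C1 / e"
  define C3 where "C3 = C2 / e"
  define D0 where "D0 = 1/2 * C2 + K * C1"
  define D where "D = 1/2 * C3 + K * C2"
  define C where "C = M + C1 + C2 + C3 + D0 + D + D0 / e + D0 / e / e"
  note nn = M_nonneg
  have pos: "0 \<le> C1" "0 \<le> C2" "0 \<le> C3" "0 \<le> D0" "0 \<le> D" "0 \<le> D0 / e" "0 \<le> D0 / e / e"
    using nn e K by (auto simp: C1_def C2_def C3_def D0_def D_def)
  have le: "M \<le> C" "C1 \<le> C" "C2 \<le> C" "C3 \<le> C" "D0 \<le> C" "D \<le> C" "D0 / e \<le> C" "D0 / e / e \<le> C" "0 \<le> C"
    using pos nn unfolding C_def by linarith+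
  have t0: "t \<le> 1" "t \<noteq> 0" if "t \<in> {a..b}" for t using that ab by auto
  have bM: "\<bar>(box_mean e ^^ n) (\<lambda>y. u (t, y)) x\<bar> \<le> M" "\<bar>(box_mean e ^^ n) (\<lambda>y. u (t, \<bar>y\<bar>)) x\<bar> \<le> M"
    if "t \<in> {a..b}" for n t x
    by (intro box_means_bound continuous_u_slice t0[OF that] e u_bound)+
  have bM': "\<bar>box_mean e (\<lambda>y. u (t, y)) x\<bar> \<le> M" if "t \<in> {a..b}" for t x
    using bM(1)[OF that, of 1] by simp
  have b1: "\<bar>central_diff e ((box_mean e ^^ n) (\<lambda>y. u (t, y))) x\<bar> \<le> C1"
    "\<bar>central_diff e ((box_mean e ^^ n) (\<lambda>y. u (t, \<bar>y\<bar>))) x\<bar> \<le> C1" if "t \<in> {a..b}" for n t x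
    unfolding C1_def by (intro central_diff_bound bM that e)+
  have b2: "\<bar>central_diff e (central_diff e ((box_mean e ^^ n) (\<lambda>y. u (t, y)))) x\<bar> \<le> C2"
    "\<bar>central_diff e (central_diff e ((box_mean e ^^ n) (\<lambda>y. u (t, \<bar>y\<bar>)))) x\<bar> \<le> C2" if "t \<in> {a..b}" for n t x
    unfolding C2_def by (intro central_diff_bound b1 that e)+
  have b3: "\<bar>central_diff e (central_diff e (central_diff e (box_mean e (\<lambda>y. u (t, y))))) x\<bar> \<le> C3" if "t \<in> {a..b}" for t x
    unfolding C3_def C2_def C1_def by (intro central_diff_bound bM' that e)
  have comb: "\<bar>- (1/2) * x - drift_coeff \<nu> t * y\<bar> \<le> 1/2 * X + K * Y" if "t \<in> {a..b}" "\<bar>x\<bar> \<le> X" "\<bar>y\<bar> \<le> Y" for x y X Y t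
  proof -
    have "drift_coeff \<nu> t * \<bar>y\<bar> \<le> K * Y"
      using K(2)[OF that(1)] that drift_coeff_nonneg[of \<nu> t] K(1) by (intro mult_mono) auto
    then have "\<bar>drift_coeff \<nu> t * y\<bar> \<le> K * Y"
      by (simp add: abs_mult drift_coeff_nonneg)
    with that(2) show ?thesis by linarith
  qed
  \<comment> \<open>two averages are enough for a time derivative that is bounded uniformly in \<open>x\<close>\<close>
  have time2: "\<bar>(box_mean e ^^ 2) (\<lambda>y. u (s', y)) x - (box_mean e ^^ 2) (\<lambda>y. u (s, y)) x\<bar> \<le> D0 * (s' - s)"
    if "s \<in> {a..b}" "s' \<in> {a..b}" "s \<le> s'" for s s' x
  proof -
    have ss: "s' < 1" "0 \<notin> {s..s'}" using that ab by auto
    have "norm ((box_mean e ^^ 2) (\<lambda>y. u (s', y)) x - (box_mean e ^^ 2) (\<lambda>y. u (s, y)) x) \<le> D0 * measure lborel {s..s'}"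
    proof (rule has_integral_bound_real[where S="{}"])
      show "((\<lambda>t. (box_mean e ^^ 1) (mean_t e t) x) has_integral
         ((box_mean e ^^ 2) (\<lambda>y. u (s', y)) x - (box_mean e ^^ 2) (\<lambda>y. u (s, y)) x)) {s..s'}"
        using has_integral_box_means_u[OF that(3) ss e, of 1 x] by (simp only: Suc_1)
      fix t assume "t \<in> {s..s'} - {}"
      then have t: "t \<in> {a..b}" using that by auto
      show "norm ((box_mean e ^^ 1) (mean_t e t) x) \<le> D0"
        unfolding D0_def One_nat_def box_means_mean_t[OF t0[OF t] e] real_norm_def
        by (intro comb t b1 b2)
    qed (use pos in auto)
    then show ?thesis using that by simp
  qed
  have time2': "\<bar>(box_mean e ^^ 2) (\<lambda>y. u (s, y)) x - (box_mean e ^^ 2) (\<lambda>y. u (s', y)) x\<bar> \<le> D0 * \<bar>s - s'\<bar>"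
    if "s \<in> {a..b}" "s' \<in> {a..b}" for s s' x
    using time2[OF that, of x] time2[OF that(2,1), of x] by (cases "s \<le> s'") (auto simp: abs_minus_commute)
  have time3: "\<bar>(box_mean e ^^ 3) (\<lambda>y. u (s, y)) x - (box_mean e ^^ 3) (\<lambda>y. u (s', y)) x\<bar> \<le> D0 * \<bar>s - s'\<bar>"
    if "s \<in> {a..b}" "s' \<in> {a..b}" for s s' x
  proof -
    have 3: "(box_mean e ^^ 3) f = box_mean e ((box_mean e ^^ 2) f)" for f by (simp add: eval_nat_numeral)
    show ?thesis
      unfolding 3 by (intro box_mean_diff_bound continuous_box_means continuous_u_slice time2' that t0[OF that(1)] t0[OF that(2)] e)
  qed
  have mono: "B * \<bar>z\<bar> \<le> C * \<bar>z\<bar>" if "B \<le> C" for B z :: real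
    using that by (intro mult_right_mono) auto
  show ?thesis
  proof (rule that[of C], unfold_locales)
    show "a \<le> b" "0 \<le> C" using ab le by auto
    show "((\<lambda>r. averaged_t e r x) has_integral (averaged e s' x - averaged e s x)) {s..s'}"
      if "a \<le> s" "s \<le> s'" "s' \<le> b" for s s' x
    proof -
      have ss: "s' < 1" "0 \<notin> {s..s'}" using that ab by auto
      have "((\<lambda>t. (box_mean e ^^ 3) (mean_t e t) x) has_integral (averaged e s' x - averaged e s x)) {s..s'}"
        using has_integral_box_means_u[OF that(2) ss e, of 3 x] unfolding averaged_def by (simp del: funpow.simps)
      moreover have "(box_mean e ^^ 3) (mean_t e t) x = averaged_t e t x" if "t \<in> {s..s'}" for t
        using box_means_mean_t[of t e 2 x] e that ss
        by (auto simp: averaged_t_def averaged_xx_def folded_x_def eval_nat_numeral)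
      ultimately show ?thesis
        by (rule has_integral_eq[rotated]) auto
    qed
    note c = continuous_on_u_strip[OF less_imp_le[OF ab(2)] ab(3)]
    have cxx: "continuous_on ({a..b} \<times> UNIV) (\<lambda>(t, x). averaged_xx e t x)"
      unfolding averaged_xx_def by (intro continuous_on_central_diff_param continuous_on_box_means_param c)
    then show "continuous_on ({a..b} \<times> UNIV) (\<lambda>(t, x). averaged_xx e t x)" .
    show "continuous_on ({a..b} \<times> UNIV) (\<lambda>(t, x). averaged_x e t x)"
      unfolding averaged_x_def by (intro continuous_on_central_diff_param continuous_on_box_means_param c)
    have "continuous_on ({a..b} \<times> UNIV) (\<lambda>(t, x). folded_x e t x)"
      unfolding folded_x_def by (intro continuous_on_central_diff_param continuous_on_box_means_param c)
    with cxx continuous_on_coeff_fst[OF ab(3)]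
    show "continuous_on ({a..b} \<times> UNIV) (\<lambda>(t, x). averaged_t e t x)"
      unfolding averaged_t_def case_prod_unfold by (intro continuous_intros)
    fix s x assume s: "s \<in> {a..b}"
    show "(averaged e s has_real_derivative averaged_x e s x) (at x)"
      "(averaged_x e s has_real_derivative averaged_xx e s x) (at x)"
      by (intro DERIV_averaged t0[OF s] e)+
    show "\<bar>averaged e s x\<bar> \<le> C" "\<bar>averaged_x e s x\<bar> \<le> C" "\<bar>averaged_xx e s x\<bar> \<le> C"
      unfolding averaged_def averaged_x_def averaged_xx_def
      by (intro order_trans[OF _ le(1)] order_trans[OF _ le(2)] order_trans[OF _ le(3)] bM b1 b2 s)+
    show "\<bar>averaged_t e s x\<bar> \<le> C"
      by (rule order_trans[OF _ le(5)], unfold averaged_t_def D0_def averaged_xx_def folded_x_def) (intro comb b1 b2 s)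
    show "\<bar>averaged_xx e s x - averaged_xx e s y\<bar> \<le> C * \<bar>x - y\<bar>" for y
      by (rule order_trans[OF _ mono[OF le(4)]], rule lipschitz_if_DERIV_bounded[OF DERIV_averaged(3)[OF t0[OF s] e] b3[OF s]])
    show "\<bar>averaged_t e s x - averaged_t e s y\<bar> \<le> C * \<bar>x - y\<bar>" for y
    proof (rule order_trans[OF _ mono[OF le(6)]], rule lipschitz_if_DERIV_bounded)
      show "(averaged_t e s has_real_derivative
          (- (1/2) * central_diff e (central_diff e (central_diff e (box_mean e (\<lambda>y. u (s, y))))) x
           - drift_coeff \<nu> s * central_diff e (central_diff e ((box_mean e ^^ 2) (\<lambda>y. u (s, \<bar>y\<bar>)))) x)) (at x)" for x
        unfolding averaged_t_def[abs_def] by (intro DERIV_diff DERIV_cmult DERIV_averaged t0[OF s] e)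
      show "\<bar>- (1/2) * central_diff e (central_diff e (central_diff e (box_mean e (\<lambda>y. u (s, y))))) x
           - drift_coeff \<nu> s * central_diff e (central_diff e ((box_mean e ^^ 2) (\<lambda>y. u (s, \<bar>y\<bar>)))) x\<bar> \<le> D" for x
        unfolding D_def by (intro comb b3 b2 s)
    qed
    fix s' assume s': "s' \<in> {a..b}"
    have "\<bar>averaged_x e s x - averaged_x e s' x\<bar> \<le> D0 * \<bar>s - s'\<bar> / e"
      unfolding averaged_x_def by (intro central_diff_diff_bound time3 s s' e)
    also have "\<dots> \<le> C * \<bar>s - s'\<bar>"
      using mono[OF le(7), of "s - s'"] by simp
    finally show "\<bar>averaged_x e s x - averaged_x e s' x\<bar> \<le> C * \<bar>s - s'\<bar>" .
    have "\<bar>averaged_xx e s x - averaged_xx e s' x\<bar> \<le> D0 * \<bar>s - s'\<bar> / e / e"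
      unfolding averaged_xx_def by (intro central_diff_diff_bound time2' s s' e)
    also have "\<dots> \<le> C * \<bar>s - s'\<bar>"
      using mono[OF le(8), of "s - s'"] by simp
    finally show "\<bar>averaged_xx e s x - averaged_xx e s' x\<bar> \<le> C * \<bar>s - s'\<bar>" .
  qed
qed

text \<open>The commutator of multiplication by \<open>sgn\<close> with averaging.\<close>

definition defect :: "real \<Rightarrow> real \<Rightarrow> real \<Rightarrow> real" where
  "defect e t x = sgn x * averaged_x e t x - folded_x e t x"

lemma generator_averaged:
  "averaged_t e t x + 1/2 * averaged_xx e t x + drift_coeff \<nu> t * sgn x * averaged_x e t x = drift_coeff \<nu> t * defect e t x"
  by (simp add: averaged_t_def defect_def algebra_simps)

lemma defect_away:
  assumes t: "t \<le> 1" "t \<noteq> 0" and e: "0 < e" and x: "4 * e < \<bar>x\<bar>"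
  shows "defect e t x = 0"
proof -
  note cu = continuous_u_slice[OF t]
  define U where "U = (\<lambda>y. u (t, y))"
  define V where "V = (\<lambda>y. u (t, \<bar>y\<bar>))"
  have cU: "continuous_on UNIV U" and cV: "continuous_on UNIV V" using cu by (simp_all add: U_def V_def)
  have sU: "continuous_on UNIV (\<lambda>y. sgn x * U y + 0 * U y)"
    using cU by (intro continuous_intros)
  have eq: "sgn x * (box_mean e ^^ 3) U y = (box_mean e ^^ 3) V y" if y: "\<bar>y - x\<bar> \<le> e" for y
  proof -
    have "\<bar>(box_mean e ^^ 3) (\<lambda>y. sgn x * U y + 0 * U y) y - (box_mean e ^^ 3) V y\<bar> \<le> 0"
    proof (rule box_means_diff_bound[OF sU cV e])
      fix z assume z: "\<bar>z\<bar> \<le> real 3 * e"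
      have G: "(t, y) \<in> dom_G" for y using t by (rule strip_in_dom_G)
      show "\<bar>sgn x * U (y + z) + 0 * U (y + z) - V (y + z)\<bar> \<le> 0"
      proof (cases "0 < x")
        case True
        then have "0 < y + z" using z y x by (auto simp: abs_if split: if_splits)
        with True show ?thesis by (simp add: U_def V_def)
      next
        case False
        then have "x < 0" "y + z < 0" using z y x e by (auto simp: abs_if split: if_splits)
        then show ?thesis using odd[OF G, of "y + z"] by (simp add: U_def V_def)
      qed
    qed
    then show ?thesis
      using fun_cong[OF box_means_lincomb[OF cU cU e, of 3 "sgn x" 0], of y] by linarith
  qed
  show ?thesis
    using eq[of "x + e"] eq[of "x - e"] e
    by (simp add: defect_def averaged_x_def folded_x_def central_diff_def U_def[symmetric] V_def[symmetric]
        right_diff_distrib)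
qed

lemma defect_at_zero: "defect e t 0 = 0"
  using box_means_even[where f="\<lambda>y. u (t, \<bar>y\<bar>)" and e=e and n=3 and x=e]
  by (simp add: defect_def folded_x_def central_diff_def)

text \<open>For \<open>\<bar>x\<bar> \<le> 4 e \<le> 4\<close> only values of \<open>u\<close> on \<open>[-8, 8]\<close> enter, and there \<open>u\<close> is Lipschitz with a constant that does not
depend on \<open>e\<close>.\<close>

lemma defect_bounded:
  assumes ab: "b < 1" "0 \<notin> {a..b}"
  obtains B where "0 \<le> B" "\<And>e t x. 0 < e \<Longrightarrow> e \<le> 1 \<Longrightarrow> t \<in> {a..b} \<Longrightarrow> \<bar>defect e t x\<bar> \<le> B"
proof -
  have t0: "t \<le> 1" "t \<noteq> 0" if "t \<in> {a..b}" for t using that ab by auto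
  have "continuous_on ({a..b} \<times> {-8..8}) p"
    by (rule continuous_on_subset[OF p_cont]) (use ab in \<open>auto intro!: strip_in_dom_G\<close>)
  then have "compact (p ` ({a..b} \<times> {-8..8}))"
    by (intro compact_continuous_image compact_Times) auto
  then obtain L where L: "\<And>t x. t \<in> {a..b} \<Longrightarrow> x \<in> {-8..8} \<Longrightarrow> \<bar>p (t, x)\<bar> \<le> L"
    using compact_imp_bounded bounded_iff by (metis (no_types, lifting) imageI mem_Sigma_iff real_norm_def)
  have lipU: "\<bar>u (t, x) - u (t, y)\<bar> \<le> L * \<bar>x - y\<bar>" if t: "t \<in> {a..b}" and "x \<in> {-8..8}" "y \<in> {-8..8}" for t x y
    using field_differentiable_bound[of "{-8..8}" "\<lambda>x. u (t, x)" "\<lambda>x. p (t, x)" L x y] that L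
      dx[OF strip_in_dom_G[OF t0[OF t]]] by (auto intro: has_field_derivative_at_within)
  have L0: "0 \<le> L" if "t \<in> {a..b}" for t using L[OF that, of 0] by simp
  have "\<bar>defect e t x\<bar> \<le> 2 * \<bar>L\<bar>" if e: "0 < e" "e \<le> 1" and t: "t \<in> {a..b}" for e t x
  proof (cases "4 * e < \<bar>x\<bar>")
    case True
    then show ?thesis using defect_away[OF t0[OF t] e(1)] by simp
  next
    case False
    note cu = continuous_u_slice[OF t0[OF t]]
    have le: "\<bar>x + c + z\<bar> \<le> 8" if "\<bar>c\<bar> \<le> e" "\<bar>z\<bar> \<le> real 3 * e" for c z
      using that False e by linarith
    have in8: "x + e + z \<in> {-8..8}" "x - e + z \<in> {-8..8}" "\<bar>x + e + z\<bar> \<in> {-8..8}" "\<bar>x - e + z\<bar> \<in> {-8..8}"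
      if "\<bar>z\<bar> \<le> real 3 * e" for z
      using le[of e z] le[of "- e" z] that e by (auto simp: abs_le_iff)
    have 1: "\<bar>(box_mean e ^^ 3) (\<lambda>y. u (t, y)) (x + e) - (box_mean e ^^ 3) (\<lambda>y. u (t, y)) (x - e)\<bar> \<le> L * (2 * e)"
    proof (rule box_means_diff_bound[OF cu(1) cu(1) e(1)])
      fix z assume "\<bar>z\<bar> \<le> real 3 * e"
      from lipU[OF t in8(1,2)[OF this]] e show "\<bar>u (t, x + e + z) - u (t, x - e + z)\<bar> \<le> L * (2 * e)" by simp
    qed
    have 2: "\<bar>(box_mean e ^^ 3) (\<lambda>y. u (t, \<bar>y\<bar>)) (x + e) - (box_mean e ^^ 3) (\<lambda>y. u (t, \<bar>y\<bar>)) (x - e)\<bar> \<le> L * (2 * e)"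
    proof (rule box_means_diff_bound[OF cu(2) cu(2) e(1)])
      fix z assume "\<bar>z\<bar> \<le> real 3 * e"
      have "\<bar>u (t, \<bar>x + e + z\<bar>) - u (t, \<bar>x - e + z\<bar>)\<bar> \<le> L * \<bar>\<bar>x + e + z\<bar> - \<bar>x - e + z\<bar>\<bar>"
        by (rule lipU[OF t in8(3,4)]) fact+
      also have "\<dots> \<le> L * (2 * e)"
        using L0[OF t] e by (intro mult_left_mono) auto
      finally show "\<bar>u (t, \<bar>x + e + z\<bar>) - u (t, \<bar>x - e + z\<bar>)\<bar> \<le> L * (2 * e)" .
    qed
    have "\<bar>averaged_x e t x\<bar> \<le> L" "\<bar>folded_x e t x\<bar> \<le> L"
      using 1 2 e by (simp_all add: averaged_x_def folded_x_def central_diff_def abs_divide field_simps)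
    moreover have "\<bar>sgn x * averaged_x e t x\<bar> \<le> \<bar>averaged_x e t x\<bar>"
      by (simp add: abs_mult sgn_if)
    ultimately show ?thesis
      unfolding defect_def by linarith
  qed
  then show ?thesis by (intro that[of "2 * \<bar>L\<bar>"]) auto
qed

lemma averaged_bound:
  assumes "t \<le> 1" "t \<noteq> 0" "0 < e"
  shows "\<bar>averaged e t x\<bar> \<le> M"
  unfolding averaged_def by (intro box_means_bound continuous_u_slice u_bound assms)

lemma averaged_tendsto:
  assumes t: "t \<le> 1" "t \<noteq> 0"
  shows "((\<lambda>e. averaged e t x) \<longlongrightarrow> u (t, x)) (at_right 0)"
proof (rule tendstoI)
  fix d :: real assume d: "0 < d"
  note cu = continuous_u_slice[OF t]
  have "isCont (\<lambda>y. u (t, y)) x"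
    using cu(1) by (simp add: continuous_on_eq_continuous_at)
  then obtain r where r: "0 < r" "\<And>y. \<bar>y - x\<bar> < r \<Longrightarrow> \<bar>u (t, y) - u (t, x)\<bar> < d / 2"
    unfolding continuous_at_eps_delta dist_real_def using d by (meson half_gt_zero)
  have "\<forall>\<^sub>F e in at_right 0. e \<in> {0<..<r / 4}"
    by (rule eventually_at_right_real) (use r in auto)
  then show "\<forall>\<^sub>F e in at_right 0. dist (averaged e t x) (u (t, x)) < d"
  proof eventually_elim
    case (elim e)
    have "\<bar>(box_mean e ^^ 4) (\<lambda>y. u (t, y)) x - (box_mean e ^^ 4) (\<lambda>y. u (t, x)) x\<bar> \<le> d / 2"
    proof (rule box_means_diff_bound[OF cu(1)])
      fix z assume "\<bar>z\<bar> \<le> real 4 * e"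
      then have "\<bar>x + z - x\<bar> < r" using elim by auto
      from less_imp_le[OF r(2)[OF this]] show "\<bar>u (t, x + z) - u (t, x)\<bar> \<le> d / 2" .
    qed (use elim in auto)
    then show ?case
      using d by (simp add: averaged_def dist_real_def)
  qed
qed

lemma defect_tendsto:
  assumes t: "t \<le> 1" "t \<noteq> 0"
  shows "((\<lambda>e. defect e t x) \<longlongrightarrow> 0) (at_right 0)"
proof (cases "x = 0")
  case False
  have "\<forall>\<^sub>F e in at_right 0. e \<in> {0<..<\<bar>x\<bar> / 4}"
    by (rule eventually_at_right_real) (use False in auto)
  then have "\<forall>\<^sub>F e in at_right 0. defect e t x = 0"
    by eventually_elim (use defect_away[OF t] in auto)
  then show ?thesis by (rule tendsto_eventually)
qed (simp add: defect_at_zero)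

end

section \<open>A formula of Dynkin type\<close>

lemma taylor2_lipschitz:
  fixes f f' f'' :: "real \<Rightarrow> real"
  assumes f: "\<And>x. (f has_real_derivative f' x) (at x)"
    and f': "\<And>x. (f' has_real_derivative f'' x) (at x)"
    and lip: "\<And>x y. \<bar>f'' x - f'' y\<bar> \<le> C * \<bar>x - y\<bar>" and C: "0 \<le> C"
  shows "\<bar>f y - f x - f' x * (y - x) - 1/2 * f'' x * (y - x)\<^sup>2\<bar> \<le> C * \<bar>y - x\<bar> ^ 3"
proof -
  let ?S = "closed_segment x y"
  have seg: "\<bar>z - x\<bar> \<le> \<bar>y - x\<bar>" if "z \<in> ?S" for z
    using that by (auto simp: closed_segment_eq_real_ivl split: if_splits)
  have 1: "\<bar>f' z - f' x - f'' x * (z - x)\<bar> \<le> (C * \<bar>y - x\<bar>) * \<bar>y - x\<bar>" if z: "z \<in> ?S" for z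
  proof -
    have "norm ((f' z - f'' x * z) - (f' x - f'' x * x)) \<le> (C * \<bar>y - x\<bar>) * norm (z - x)"
    proof (rule field_differentiable_bound[of ?S "\<lambda>z. f' z - f'' x * z" "\<lambda>z. f'' z - f'' x * 1"])
      fix z assume z: "z \<in> ?S"
      show "((\<lambda>z. f' z - f'' x * z) has_field_derivative f'' z - f'' x * 1) (at z within ?S)"
        by (intro DERIV_diff DERIV_cmult DERIV_ident has_field_derivative_at_within[OF f'])
      have "\<bar>f'' z - f'' x\<bar> \<le> C * \<bar>z - x\<bar>" by (rule lip)
      also have "\<dots> \<le> C * \<bar>y - x\<bar>" using seg[OF z] C by (rule mult_left_mono)
      finally show "norm (f'' z - f'' x * 1) \<le> C * \<bar>y - x\<bar>" by simp
    qed (use z in auto)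
    also have "\<dots> \<le> (C * \<bar>y - x\<bar>) * \<bar>y - x\<bar>"
      using seg[OF z] C by (intro mult_left_mono) auto
    finally show ?thesis by (simp add: algebra_simps)
  qed
  have "norm ((f y - f' x * y - 1/2 * f'' x * (y - x)\<^sup>2) - (f x - f' x * x - 1/2 * f'' x * (x - x)\<^sup>2))
      \<le> (C * \<bar>y - x\<bar> * \<bar>y - x\<bar>) * norm (y - x)"
  proof (rule field_differentiable_bound[of ?S "\<lambda>z. f z - f' x * z - 1/2 * f'' x * (z - x)\<^sup>2"
        "\<lambda>z. f' z - f' x - f'' x * (z - x)"])
    fix z assume z: "z \<in> ?S"
    have "((\<lambda>z. f z - f' x * z - 1/2 * f'' x * (z - x)\<^sup>2) has_field_derivative f' z - f' x - f'' x * (z - x)) (at z)"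
      by (auto intro!: derivative_eq_intros f)
    then show "((\<lambda>z. f z - f' x * z - 1/2 * f'' x * (z - x)\<^sup>2) has_field_derivative f' z - f' x - f'' x * (z - x)) (at z within ?S)"
      by (rule has_field_derivative_at_within)
    show "norm (f' z - f' x - f'' x * (z - x)) \<le> C * \<bar>y - x\<bar> * \<bar>y - x\<bar>"
      using 1[OF z] by simp
  qed auto
  then show ?thesis by (simp add: algebra_simps power3_eq_cube)
qed

text \<open>The exponent exceeds \<open>1\<close>, so the derivative vanishes.\<close>

lemma constant_if_increment_power_three_halves:
  fixes f :: "real \<Rightarrow> real"
  assumes "a \<le> b" and C: "0 \<le> C"
    and f: "\<And>s s'. a \<le> s \<Longrightarrow> s \<le> s' \<Longrightarrow> s' \<le> b \<Longrightarrow> s' - s \<le> 1 \<Longrightarrow> \<bar>f s' - f s\<bar> \<le> C * ((s' - s) * sqrt (s' - s))"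
  shows "f b = f a"
proof -
  have "\<exists>c. \<forall>s\<in>{a..b}. f s = c"
  proof (rule has_derivative_zero_constant)
    fix s assume s: "s \<in> {a..b}"
    have bound: "norm ((f y - f s) / (y - s)) \<le> C * sqrt \<bar>y - s\<bar>" if y: "y \<in> {a..b}" "\<bar>y - s\<bar> \<le> 1" "y \<noteq> s" for y
    proof -
      have "\<bar>f y - f s\<bar> \<le> C * (\<bar>y - s\<bar> * sqrt \<bar>y - s\<bar>)"
        using f[of s y] f[of y s] s y by (cases "s \<le> y") (auto simp: abs_minus_commute)
      then show ?thesis
        using y by (simp add: abs_divide field_simps)
    qed
    have "((\<lambda>y. C * sqrt \<bar>y - s\<bar>) \<longlongrightarrow> C * sqrt \<bar>s - s\<bar>) (at s within {a..b})"
      by (intro tendsto_intros)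
    then have lim: "((\<lambda>y. C * sqrt \<bar>y - s\<bar>) \<longlongrightarrow> 0) (at s within {a..b})" by simp
    have "\<forall>\<^sub>F y in at s within {a..b}. norm ((f y - f s) / (y - s)) \<le> C * sqrt \<bar>y - s\<bar>"
      unfolding eventually_at by (rule exI[of _ 1]) (use bound in \<open>auto simp: dist_real_def\<close>)
    from Lim_null_comparison[OF this lim]
    have "(f has_field_derivative 0) (at s within {a..b})"
      by (simp add: has_field_derivative_iff)
    then show "(f has_derivative (\<lambda>h. 0)) (at s within {a..b})"
      by (simp only: has_field_derivative_def lambda_zero)
  qed simp
  with assms(1) show ?thesis by auto
qed

text \<open>A continuous process is the limit of its discretisations in time, and these are jointly
measurable since they involve only countably many times.\<close>

lemma measurable_continuous_process:
  fixes X :: "real \<Rightarrow> 'v \<Rightarrow> real"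
  assumes ab: "a \<le> b" and X: "\<And>s. s \<in> {a..b} \<Longrightarrow> X s \<in> borel_measurable N"
    and cont: "\<And>\<omega>. \<omega> \<in> space N \<Longrightarrow> continuous_on {a..b} (\<lambda>s. X s \<omega>)"
  shows "(\<lambda>(r, \<omega>). X (max a (min b r)) \<omega>) \<in> borel_measurable (borel \<Otimes>\<^sub>M N)"
proof -
  define Y where "Y = (\<lambda>r. X (max a (min b r)))"
  have Y: "Y r \<in> borel_measurable N" for r
    unfolding Y_def using ab by (intro X) auto
  have Yc: "continuous_on UNIV (\<lambda>r. Y r \<omega>)" if "\<omega> \<in> space N" for \<omega>
    unfolding Y_def by (rule continuous_on_compose2[OF cont[OF that]]) (use ab in \<open>auto intro!: continuous_intros\<close>)
  have "(\<lambda>z. Y (fst z) (snd z)) \<in> borel_measurable (borel \<Otimes>\<^sub>M N)"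
  proof (rule borel_measurable_LIMSEQ_real)
    fix n :: nat
    show "(\<lambda>z. Y (real_of_int \<lfloor>fst z * real (Suc n)\<rfloor> / real (Suc n)) (snd z)) \<in> borel_measurable (borel \<Otimes>\<^sub>M N)"
      by (rule measurable_compose_countable[where f="\<lambda>i z. Y (real_of_int i / real (Suc n)) (snd z)" and g="\<lambda>z. \<lfloor>fst z * real (Suc n)\<rfloor>"])
         (auto intro!: measurable_compose[OF _ Y])
  next
    fix z :: "real \<times> 'v" assume z: "z \<in> space (borel \<Otimes>\<^sub>M N)"
    have "(\<lambda>n. real_of_int \<lfloor>fst z * real (Suc n)\<rfloor> / real (Suc n)) \<longlonglongrightarrow> fst z"
    proof (rule LIM_zero_cancel, rule Lim_null_comparison[OF _ LIMSEQ_inverse_real_of_nat])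
      have "\<bar>real_of_int \<lfloor>fst z * m\<rfloor> / m - fst z\<bar> \<le> inverse m" if "0 < m" for m :: real
      proof -
        have "\<bar>real_of_int \<lfloor>fst z * m\<rfloor> - fst z * m\<bar> \<le> 1"
          by linarith
        moreover have "real_of_int \<lfloor>fst z * m\<rfloor> / m - fst z = (real_of_int \<lfloor>fst z * m\<rfloor> - fst z * m) / m"
          using that by (simp add: field_simps)
        ultimately show ?thesis
          using that divide_right_mono[of "\<bar>real_of_int \<lfloor>fst z * m\<rfloor> - fst z * m\<bar>" 1 m]
          by (simp add: abs_divide inverse_eq_divide)
      qed
      from this[of "real (Suc _)"]
      show "\<forall>\<^sub>F n in sequentially. norm (real_of_int \<lfloor>fst z * real (Suc n)\<rfloor> / real (Suc n) - fst z) \<le> inverse (real (Suc n))"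
        by (auto simp del: of_nat_Suc)
    qed
    moreover have "isCont (\<lambda>r. Y r (snd z)) (fst z)"
      using Yc[of "snd z"] z by (auto simp: continuous_on_eq_continuous_at space_pair_measure)
    ultimately show "(\<lambda>n. Y (real_of_int \<lfloor>fst z * real (Suc n)\<rfloor> / real (Suc n)) (snd z)) \<longlonglongrightarrow> Y (fst z) (snd z)"
      by (intro isCont_tendsto_compose[where g="\<lambda>r. Y r (snd z)"])
  qed
  then show ?thesis by (simp add: Y_def case_prod_unfold)
qed

lemma (in prob_space) bounded_strip_integrable:
  fixes f :: "real \<times> 'a \<Rightarrow> real"
  assumes f: "f \<in> borel_measurable (borel \<Otimes>\<^sub>M M)"
    and B: "\<And>r \<omega>. r \<in> {s..s'} \<Longrightarrow> \<omega> \<in> space M \<Longrightarrow> \<bar>f (r, \<omega>)\<bar> \<le> B"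
  shows "integrable (lborel \<Otimes>\<^sub>M M) (\<lambda>(r, \<omega>). indicator {s..s'} r *\<^sub>R f (r, \<omega>))"
proof -
  have sf: "sigma_finite_measure M" by unfold_locales
  interpret pair_sigma_finite lborel M ..
  have sets: "{s..s'} \<times> space M \<in> sets (lborel \<Otimes>\<^sub>M M)"
    by (intro pair_measureI) auto
  have f': "f \<in> borel_measurable (lborel \<Otimes>\<^sub>M M)"
    using f by (simp cong: measurable_cong_sets sets_pair_measure_cong)
  have "integrable (lborel \<Otimes>\<^sub>M M) (\<lambda>z. indicator ({s..s'} \<times> space M) z *\<^sub>R f z)"
  proof (rule integrableI_bounded_set_indicator[OF sets f', of B])
    have "emeasure (lborel \<Otimes>\<^sub>M M) ({s..s'} \<times> space M) = emeasure lborel {s..s'} * emeasure M (space M)"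
      by (rule sigma_finite_measure.emeasure_pair_measure_Times) (auto intro: sf)
    also have "\<dots> < \<infinity>"
      by (simp add: emeasure_space_1 emeasure_lborel_Icc_eq)
    finally show "emeasure (lborel \<Otimes>\<^sub>M M) ({s..s'} \<times> space M) < \<infinity>" .
    show "AE z in lborel \<Otimes>\<^sub>M M. z \<in> {s..s'} \<times> space M \<longrightarrow> norm (f z) \<le> B"
      using B by (intro AE_I2) auto
  qed
  then show ?thesis
    by (rule Bochner_Integration.integrable_cong[THEN iffD1, OF refl, rotated])
       (auto simp: space_pair_measure indicator_def)
qed

lemma (in prob_space) strip_Fubini:
  fixes f :: "real \<times> 'a \<Rightarrow> real"
  assumes f: "f \<in> borel_measurable (borel \<Otimes>\<^sub>M M)"
    and B: "\<And>r \<omega>. r \<in> {s..s'} \<Longrightarrow> \<omega> \<in> space M \<Longrightarrow> \<bar>f (r, \<omega>)\<bar> \<le> B"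
  shows "(\<integral>\<omega>. (LINT r:{s..s'}|lborel. f (r, \<omega>)) \<partial>M) = (LINT r:{s..s'}|lborel. \<integral>\<omega>. f (r, \<omega>) \<partial>M)"
    and "set_integrable lborel {s..s'} (\<lambda>r. \<integral>\<omega>. f (r, \<omega>) \<partial>M)"
    and "integrable M (\<lambda>\<omega>. LINT r:{s..s'}|lborel. f (r, \<omega>))"
proof -
  interpret pair_sigma_finite lborel M ..
  note int = bounded_strip_integrable[OF f B, of s s']
  show "(\<integral>\<omega>. (LINT r:{s..s'}|lborel. f (r, \<omega>)) \<partial>M) = (LINT r:{s..s'}|lborel. \<integral>\<omega>. f (r, \<omega>) \<partial>M)"
    using Fubini_integral[OF int] by (simp add: set_lebesgue_integral_def)
  show "set_integrable lborel {s..s'} (\<lambda>r. \<integral>\<omega>. f (r, \<omega>) \<partial>M)"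
    using integrable_fst[OF int] by (simp add: set_integrable_def)
  show "integrable M (\<lambda>\<omega>. LINT r:{s..s'}|lborel. f (r, \<omega>))"
    using integrable_snd[OF int] by (simp add: set_lebesgue_integral_def)
qed

lemma integrable_bounded_times:
  fixes f g :: "'a \<Rightarrow> real"
  assumes "integrable M g" "f \<in> borel_measurable M" "\<And>x. \<bar>f x\<bar> \<le> C"
  shows "integrable M (\<lambda>x. f x * g x)"
proof (rule Bochner_Integration.integrable_bound)
  show "integrable M (\<lambda>x. C * g x)" using assms(1) by simp
  show "AE x in M. norm (f x * g x) \<le> norm (C * g x)"
  proof (intro AE_I2)
    fix x
    have "\<bar>f x\<bar> \<le> \<bar>C\<bar>" using assms(3)[of x] by linarith
    then show "norm (f x * g x) \<le> norm (C * g x)"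
      by (simp add: abs_mult mult_right_mono)
  qed
qed (use assms in measurable)

lemma abs_integral_le:
  fixes f g :: "'a \<Rightarrow> real"
  assumes "integrable M f" "integrable M g" "\<And>x. x \<in> space M \<Longrightarrow> \<bar>f x\<bar> \<le> g x"
  shows "\<bar>\<integral>x. f x \<partial>M\<bar> \<le> (\<integral>x. g x \<partial>M)"
proof -
  have "\<bar>\<integral>x. f x \<partial>M\<bar> \<le> (\<integral>x. \<bar>f x\<bar> \<partial>M)"
    using integral_norm_bound[of M f] by simp
  also have "\<dots> \<le> (\<integral>x. g x \<partial>M)"
    by (intro integral_mono integrable_abs assms)
  finally show ?thesis .
qed

lemma three_halves_powers:
  assumes "0 \<le> h" "h \<le> (1::real)"
  shows "h \<le> sqrt h" "h\<^sup>2 \<le> h * sqrt h" "h ^ 3 \<le> h * sqrt h"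
proof -
  define q where "q = sqrt h"
  have q: "0 \<le> q" "q \<le> 1" "h = q\<^sup>2" using assms by (auto simp: q_def)
  have "q\<^sup>2 \<le> q" using q by (simp add: mult_left_le power2_eq_square)
  then show "h \<le> sqrt h"
    using q(3) by (simp add: q_def[symmetric])
  have "h * sqrt h = q\<^sup>2 * q"
    unfolding q_def[symmetric] using q(3) by simp
  then have "h * sqrt h = q ^ 3" by (simp add: power2_eq_square power3_eq_cube)
  moreover have "q ^ 4 \<le> q ^ 3" "q ^ 6 \<le> q ^ 3" using q by (auto intro: power_decreasing)
  moreover have "h\<^sup>2 = q ^ 4" "h ^ 3 = q ^ 6" by (simp_all add: q(3) flip: power_mult)
  ultimately show "h\<^sup>2 \<le> h * sqrt h" "h ^ 3 \<le> h * sqrt h" by simp_all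
qed

text \<open>A process with drift \<open>k(r) sgn(X\<^sub>r)\<close>, in absolute time and with all pathwise
properties valid for every \<open>\<omega>\<close>. The Wiener property enters through expectations only, because these are
insensitive to a modification on a null set, whereas adaptedness to a filtration that is not complete is not.\<close>

locale sgn_drift_process = prob_space N
  for N :: "'v measure" +
  fixes lo hi K :: real and k :: "real \<Rightarrow> real" and X w :: "real \<Rightarrow> 'v \<Rightarrow> real"
  assumes lo_le_hi: "lo \<le> hi"
    and k_meas [measurable]: "k \<in> borel_measurable borel"
    and k_bound: "r \<in> {lo..hi} \<Longrightarrow> \<bar>k r\<bar> \<le> K"
    and X_meas: "s \<in> {lo..hi} \<Longrightarrow> X s \<in> borel_measurable N"
    and X_cont: "\<omega> \<in> space N \<Longrightarrow> continuous_on {lo..hi} (\<lambda>s. X s \<omega>)"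
    and w_meas: "s \<in> {lo..hi} \<Longrightarrow> w s \<in> borel_measurable N"
    and X_eq: "\<omega> \<in> space N \<Longrightarrow> lo \<le> s \<Longrightarrow> s \<le> s' \<Longrightarrow> s' \<le> hi \<Longrightarrow>
      X s' \<omega> - X s \<omega> = w s' \<omega> - w s \<omega> + (LINT r:{s..s'}|lborel. k r * sgn (X r \<omega>))"
    and w_int: "lo \<le> s \<Longrightarrow> s \<le> s' \<Longrightarrow> s' \<le> hi \<Longrightarrow> integrable N (\<lambda>\<omega>. \<bar>w s' \<omega> - w s \<omega>\<bar> ^ n)"
    and w_mean: "lo \<le> s \<Longrightarrow> s \<le> s' \<Longrightarrow> s' \<le> hi \<Longrightarrow> f \<in> borel_measurable borel \<Longrightarrow> (\<And>x. \<bar>f x\<bar> \<le> B) \<Longrightarrow>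
      (\<integral>\<omega>. f (X s \<omega>) * (w s' \<omega> - w s \<omega>) \<partial>N) = 0"
    and w_variance: "lo \<le> s \<Longrightarrow> s \<le> s' \<Longrightarrow> s' \<le> hi \<Longrightarrow> f \<in> borel_measurable borel \<Longrightarrow> (\<And>x. \<bar>f x\<bar> \<le> B) \<Longrightarrow>
      (\<integral>\<omega>. f (X s \<omega>) * ((w s' \<omega> - w s \<omega>)\<^sup>2 - (s' - s)) \<partial>N) = 0"
    and w_abs: "lo \<le> s \<Longrightarrow> s \<le> s' \<Longrightarrow> s' \<le> hi \<Longrightarrow> (\<integral>\<omega>. \<bar>w s' \<omega> - w s \<omega>\<bar> \<partial>N) \<le> sqrt (s' - s)"
    and w_abs3: "lo \<le> s \<Longrightarrow> s \<le> s' \<Longrightarrow> s' \<le> hi \<Longrightarrow> (\<integral>\<omega>. \<bar>w s' \<omega> - w s \<omega>\<bar> ^ 3 \<partial>N) \<le> 2 * ((s' - s) * sqrt (s' - s))"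
begin

lemma K_nonneg: "0 \<le> K"
  using k_bound[of lo] lo_le_hi by auto

definition clamp :: "real \<Rightarrow> real" where
  "clamp r = max lo (min hi r)"

lemma clamp_in: "clamp r \<in> {lo..hi}"
  using lo_le_hi by (auto simp: clamp_def)

lemma clamp_eq [simp]: "r \<in> {lo..hi} \<Longrightarrow> clamp r = r"
  by (auto simp: clamp_def)

lemma continuous_clamp: "continuous_on S clamp"
  unfolding clamp_def by (intro continuous_intros)

lemma clamp_meas [measurable]: "clamp \<in> borel_measurable borel"
  unfolding clamp_def by measurable

lemma X_joint [measurable]: "(\<lambda>z. X (clamp (fst z)) (snd z)) \<in> borel_measurable (borel \<Otimes>\<^sub>M N)"
  using measurable_continuous_process[OF lo_le_hi X_meas X_cont] by (simp add: clamp_def case_prod_unfold)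

lemma path_integrable:
  assumes "\<omega> \<in> space N" "lo \<le> s" "s' \<le> hi"
  shows "set_integrable lborel {s..s'} (\<lambda>r. k r * sgn (X (clamp r) \<omega>))"
    and "(LINT r:{s..s'}|lborel. k r * sgn (X (clamp r) \<omega>)) = (LINT r:{s..s'}|lborel. k r * sgn (X r \<omega>))"
proof -
  have m: "(\<lambda>r. X (clamp r) \<omega>) \<in> borel_measurable borel"
    using measurable_compose[OF measurable_Pair2'[OF assms(1)] X_joint] by simp
  show "set_integrable lborel {s..s'} (\<lambda>r. k r * sgn (X (clamp r) \<omega>))"
    unfolding set_integrable_def
  proof (rule integrableI_bounded_set_indicator[where B=K])
    show "(\<lambda>r. k r * sgn (X (clamp r) \<omega>)) \<in> borel_measurable lborel"
      using m by measurable
    show "AE r in lborel. r \<in> {s..s'} \<longrightarrow> norm (k r * sgn (X (clamp r) \<omega>)) \<le> K"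
    proof (intro AE_I2 impI)
      fix r assume "r \<in> {s..s'}"
      then have "\<bar>k r\<bar> \<le> K" using assms by (intro k_bound) auto
      then show "norm (k r * sgn (X (clamp r) \<omega>)) \<le> K"
        using K_nonneg by (auto simp: abs_mult sgn_if)
    qed
  qed (auto simp: emeasure_lborel_Icc_eq)
  show "(LINT r:{s..s'}|lborel. k r * sgn (X (clamp r) \<omega>)) = (LINT r:{s..s'}|lborel. k r * sgn (X r \<omega>))"
    by (rule set_lebesgue_integral_cong) (use assms in auto)
qed

lemma drift_part_bound:
  assumes \<omega>: "\<omega> \<in> space N" and s: "lo \<le> s" "s \<le> s'" "s' \<le> hi"
  shows "\<bar>LINT r:{s..s'}|lborel. k r * sgn (X (clamp r) \<omega>)\<bar> \<le> K * (s' - s)"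
proof -
  note int = path_integrable(1)[OF \<omega> s(1,3)]
  have "norm (LINT r:{s..s'}|lborel. k r * sgn (X (clamp r) \<omega>)) \<le> (LINT r:{s..s'}|lborel. norm (k r * sgn (X (clamp r) \<omega>)))"
    by (rule set_integral_norm_bound[OF int])
  also have "\<dots> \<le> (LINT r:{s..s'}|lborel. K)"
  proof (rule set_integral_mono)
    show "set_integrable lborel {s..s'} (\<lambda>r. norm (k r * sgn (X (clamp r) \<omega>)))"
      by (rule set_integrable_norm[OF int])
    fix r assume "r \<in> {s..s'}"
    then have "\<bar>k r\<bar> \<le> K" using s by (intro k_bound) auto
    then show "norm (k r * sgn (X (clamp r) \<omega>)) \<le> K"
      using K_nonneg by (auto simp: abs_mult sgn_if)
  qed (rule borel_integrable_atLeastAtMost'[OF continuous_on_const])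
  also have "\<dots> = K * (s' - s)"
    using s by (simp add: set_lebesgue_integral_def)
  finally show ?thesis by simp
qed

lemma increment_bound:
  assumes \<omega>: "\<omega> \<in> space N" and s: "lo \<le> s" "s \<le> s'" "s' \<le> hi"
  shows "\<bar>X s' \<omega> - X s \<omega>\<bar> \<le> \<bar>w s' \<omega> - w s \<omega>\<bar> + K * (s' - s)"
  using X_eq[OF \<omega> s] drift_part_bound[OF \<omega> s] path_integrable(2)[OF \<omega> s(1,3)] by linarith

lemma expected_increment_bound:
  assumes s: "lo \<le> s" "s \<le> s'" "s' \<le> hi"
  shows "integrable N (\<lambda>\<omega>. \<bar>X s' \<omega> - X s \<omega>\<bar>)"
    and "(\<integral>\<omega>. \<bar>X s' \<omega> - X s \<omega>\<bar> \<partial>N) \<le> sqrt (s' - s) + K * (s' - s)"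
proof -
  have [measurable]: "X s \<in> borel_measurable N" "X s' \<in> borel_measurable N"
    using X_meas s by auto
  have i: "integrable N (\<lambda>\<omega>. \<bar>w s' \<omega> - w s \<omega>\<bar> + K * (s' - s))"
    using w_int[OF s, of 1] by simp
  show j: "integrable N (\<lambda>\<omega>. \<bar>X s' \<omega> - X s \<omega>\<bar>)"
    by (rule Bochner_Integration.integrable_bound[OF i])
       (use increment_bound[OF _ s] in \<open>auto intro!: AE_I2 order_trans[OF _ abs_ge_self]\<close>)
  have "(\<integral>\<omega>. \<bar>X s' \<omega> - X s \<omega>\<bar> \<partial>N) \<le> (\<integral>\<omega>. \<bar>w s' \<omega> - w s \<omega>\<bar> + K * (s' - s) \<partial>N)"
    by (rule integral_mono[OF j i increment_bound[OF _ s]])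
  also have "\<dots> = (\<integral>\<omega>. \<bar>w s' \<omega> - w s \<omega>\<bar> \<partial>N) + K * (s' - s)"
    using w_int[OF s, of 1] by (simp add: prob_space)
  finally show "(\<integral>\<omega>. \<bar>X s' \<omega> - X s \<omega>\<bar> \<partial>N) \<le> sqrt (s' - s) + K * (s' - s)"
    using w_abs[OF s] by linarith
qed

end

locale dynkin = sgn_drift_process N lo hi K k X w + smooth_test lo hi C \<Phi> \<Phi>t \<Phi>x \<Phi>xx
  for N :: "'v measure" and lo hi K :: real and k :: "real \<Rightarrow> real" and X w :: "real \<Rightarrow> 'v \<Rightarrow> real"
    and C :: real and \<Phi> \<Phi>t \<Phi>x \<Phi>xx :: "real \<Rightarrow> real \<Rightarrow> real"
begin

text \<open>The generator applied to the test function, along the path; \<open>clamp\<close> extends it to all times so that it is jointly measurable on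
the whole product space.\<close>

definition gen :: "real \<times> 'v \<Rightarrow> real" where
  "gen z = (let r = clamp (fst z); x = X r (snd z) in
     \<Phi>t r x + 1/2 * \<Phi>xx r x + k (fst z) * sgn x * \<Phi>x r x)"

lemma joint_meas:
  fixes h :: "real \<Rightarrow> real \<Rightarrow> real"
  assumes h: "continuous_on ({lo..hi} \<times> UNIV) (\<lambda>(t, x). h t x)"
    and f: "f \<in> borel_measurable (borel \<Otimes>\<^sub>M N)"
  shows "(\<lambda>z. h (clamp (fst z)) (f z)) \<in> borel_measurable (borel \<Otimes>\<^sub>M N)"
proof -
  have "continuous_on UNIV (\<lambda>z::real \<times> real. h (clamp (fst z)) (snd z))"
    by (rule continuous_on_param_compose[OF h]) (use clamp_in in \<open>auto intro!: continuous_intros continuous_on_compose2[OF continuous_clamp[of UNIV]]\<close>)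
  then have m: "(\<lambda>z::real \<times> real. h (clamp (fst z)) (snd z)) \<in> borel_measurable (borel \<Otimes>\<^sub>M borel)"
    by (simp add: borel_prod borel_measurable_continuous_onI)
  have "(\<lambda>z. (fst z, f z)) \<in> (borel \<Otimes>\<^sub>M N) \<rightarrow>\<^sub>M (borel \<Otimes>\<^sub>M borel)"
    using f by measurable
  from measurable_compose[OF this m] show ?thesis by simp
qed

lemma slice_meas:
  assumes h: "continuous_on ({lo..hi} \<times> UNIV) (\<lambda>(t, x). h t x)" and s: "s \<in> {lo..hi}"
  shows "h s \<in> borel_measurable borel"
  using continuous_on_slice[OF h s] by (rule borel_measurable_continuous_onI)

lemma \<Phi>_meas: "s \<in> {lo..hi} \<Longrightarrow> \<Phi> s \<in> borel_measurable borel"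
  by (intro borel_measurable_continuous_onI DERIV_continuous_on[OF has_field_derivative_at_within[OF dx]])

lemma gen_meas: "gen \<in> borel_measurable (borel \<Otimes>\<^sub>M N)"
proof -
  note [measurable] = joint_meas[OF cont(1) X_joint] joint_meas[OF cont(2) X_joint] joint_meas[OF cont(3) X_joint]
  show ?thesis unfolding gen_def Let_def by measurable
qed

lemma abs_coeff_mult:
  assumes "r \<in> {lo..hi}" "\<bar>y\<bar> \<le> Y"
  shows "\<bar>k r * sgn x * y\<bar> \<le> K * Y"
proof -
  have "\<bar>k r * sgn x * y\<bar> = \<bar>k r\<bar> * \<bar>sgn x * y\<bar>" by (simp add: abs_mult mult.assoc)
  also have "\<dots> \<le> K * Y"
    using assms k_bound[OF assms(1)] K_nonneg by (intro mult_mono) (auto simp: abs_mult sgn_if)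
  finally show ?thesis .
qed

lemma gen_bound:
  assumes "r \<in> {lo..hi}"
  shows "\<bar>gen (r, \<omega>)\<bar> \<le> C + 1/2 * C + K * C"
  using bound(2)[OF assms, of "X r \<omega>"] bound(4)[OF assms, of "X r \<omega>"]
    abs_coeff_mult[OF assms bound(3)[OF assms], of "X r \<omega>" "X r \<omega>"] assms
  unfolding gen_def Let_def by simp

text \<open>The generator with its arguments partly frozen at the ends of a time step, so that its integral over the step
is an exact increment (\<open>one_step_integral\<close>) while it stays close to \<open>gen\<close> in expectation (\<open>one_step_minus_gen\<close>).\<close>

definition one_step :: "real \<Rightarrow> real \<Rightarrow> real \<times> 'v \<Rightarrow> real" where
  "one_step s s' z = \<Phi>t (clamp (fst z)) (X s (snd z)) + 1/2 * \<Phi>xx s' (X s (snd z))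
     + k (fst z) * sgn (X (clamp (fst z)) (snd z)) * \<Phi>x s' (X s (snd z))"

lemma one_step_meas:
  assumes s: "s \<in> {lo..hi}" "s' \<in> {lo..hi}"
  shows "one_step s s' \<in> borel_measurable (borel \<Otimes>\<^sub>M N)"
proof -
  have X: "(\<lambda>z. X s (snd z)) \<in> borel_measurable (borel \<Otimes>\<^sub>M N)"
    by (rule measurable_compose[OF measurable_snd X_meas[OF s(1)]])
  note [measurable] = joint_meas[OF cont(1) X] measurable_compose[OF X slice_meas[OF cont(2) s(2)]] measurable_compose[OF X slice_meas[OF cont(3) s(2)]]
  show ?thesis unfolding one_step_def by measurable
qed

lemma one_step_bound:
  assumes s: "s' \<in> {lo..hi}" and r: "r \<in> {lo..hi}"
  shows "\<bar>one_step s s' (r, \<omega>)\<bar> \<le> C + 1/2 * C + K * C"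
  using bound(2)[OF r, of "X s \<omega>"] bound(4)[OF s, of "X s \<omega>"]
    abs_coeff_mult[OF r bound(3)[OF s], of "X r \<omega>" "X s \<omega>"] r
  unfolding one_step_def by simp

lemma one_step_integral:
  assumes \<omega>: "\<omega> \<in> space N" and s: "lo \<le> s" "s \<le> s'" "s' \<le> hi"
  shows "(LINT r:{s..s'}|lborel. one_step s s' (r, \<omega>)) =
    \<Phi> s' (X s \<omega>) - \<Phi> s (X s \<omega>) + 1/2 * \<Phi>xx s' (X s \<omega>) * (s' - s)
    + \<Phi>x s' (X s \<omega>) * (LINT r:{s..s'}|lborel. k r * sgn (X r \<omega>))"
proof -
  have "continuous_on {s..s'} (\<lambda>r. \<Phi>t r (X s \<omega>))"
    using continuous_on_slice2[OF cont(1)] by (rule continuous_on_subset) (use s in auto)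
  then have 1: "set_integrable lborel {s..s'} (\<lambda>r. \<Phi>t r (X s \<omega>))"
    by (rule borel_integrable_atLeastAtMost')
  have I1: "(LINT r:{s..s'}|lborel. \<Phi>t r (X s \<omega>)) = \<Phi> s' (X s \<omega>) - \<Phi> s (X s \<omega>)"
    using set_borel_integral_eq_integral(2)[OF 1] int[OF s, of "X s \<omega>"] by (simp add: integral_unique)
  have 2: "set_integrable lborel {s..s'} (\<lambda>r. 1/2 * \<Phi>xx s' (X s \<omega>))"
    by (rule borel_integrable_atLeastAtMost') simp
  have I2: "(LINT r:{s..s'}|lborel. 1/2 * \<Phi>xx s' (X s \<omega>)) = 1/2 * \<Phi>xx s' (X s \<omega>) * (s' - s)"
    using s by (simp add: set_lebesgue_integral_def)
  note 3 = path_integrable[OF \<omega> s(1,3)]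
  have 4: "set_integrable lborel {s..s'} (\<lambda>r. k r * sgn (X (clamp r) \<omega>) * \<Phi>x s' (X s \<omega>))"
    by (rule set_integrable_mult_left) (use 3 in simp)
  have "(LINT r:{s..s'}|lborel. one_step s s' (r, \<omega>)) =
      (LINT r:{s..s'}|lborel. (\<Phi>t r (X s \<omega>) + 1/2 * \<Phi>xx s' (X s \<omega>)) + k r * sgn (X (clamp r) \<omega>) * \<Phi>x s' (X s \<omega>))"
    by (rule set_lebesgue_integral_cong) (use s in \<open>auto simp: one_step_def\<close>)
  also have "\<dots> = (LINT r:{s..s'}|lborel. \<Phi>t r (X s \<omega>)) + (LINT r:{s..s'}|lborel. 1/2 * \<Phi>xx s' (X s \<omega>))
      + (LINT r:{s..s'}|lborel. k r * sgn (X (clamp r) \<omega>) * \<Phi>x s' (X s \<omega>))"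
    by (simp only: set_integral_add[OF set_integral_add(1)[OF 1 2] 4] set_integral_add[OF 1 2])
  also have "(LINT r:{s..s'}|lborel. k r * sgn (X (clamp r) \<omega>) * \<Phi>x s' (X s \<omega>)) =
      \<Phi>x s' (X s \<omega>) * (LINT r:{s..s'}|lborel. k r * sgn (X r \<omega>))"
    by (simp add: 3(2))
  finally show ?thesis by (simp only: I1 I2)
qed

lemma one_step_minus_gen:
  assumes s: "lo \<le> s" "s \<le> s'" "s' \<le> hi" and r: "r \<in> {s..s'}"
  shows "\<bar>one_step s s' (r, \<omega>) - gen (r, \<omega>)\<bar> \<le> C * (2 + K) * (\<bar>X r \<omega> - X s \<omega>\<bar> + (s' - s))"
proof -
  have rr: "r \<in> {lo..hi}" and ss: "s' \<in> {lo..hi}" using s r by auto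
  define x where "x = X s \<omega>"
  define z where "z = X r \<omega>"
  define d where "d = \<bar>z - x\<bar>"
  have t: "\<bar>\<Phi>t r x - \<Phi>t r z\<bar> \<le> C * d"
    using lip(1)[OF rr, of x z] by (simp add: d_def abs_minus_commute)
  have h: "C * \<bar>s' - r\<bar> \<le> C * (s' - s)"
    using C r by (intro mult_left_mono) auto
  have xx: "\<bar>\<Phi>xx s' x - \<Phi>xx r z\<bar> \<le> C * d + C * (s' - s)"
    using lip(2)[OF rr, of x z] lip_time(2)[OF ss rr, of x] h unfolding d_def abs_minus_commute[of z x] by linarith
  have lx: "\<bar>\<Phi>x r x - \<Phi>x r z\<bar> \<le> C * \<bar>x - z\<bar>"
    by (rule lipschitz_if_DERIV_bounded[OF dxx[OF rr] bound(4)[OF rr]])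
  have x: "\<bar>\<Phi>x s' x - \<Phi>x r z\<bar> \<le> C * d + C * (s' - s)"
    using lx lip_time(1)[OF ss rr, of x] h unfolding d_def abs_minus_commute[of z x] by linarith
  have tri: "\<bar>\<alpha> + 1/2 * \<beta> + \<gamma>\<bar> \<le> a + 1/2 * b + c" if "\<bar>\<alpha>\<bar> \<le> a" "\<bar>\<beta>\<bar> \<le> b" "\<bar>\<gamma>\<bar> \<le> c" for \<alpha> \<beta> \<gamma> a b c :: real
    using that by linarith
  have "one_step s s' (r, \<omega>) - gen (r, \<omega>) =
      (\<Phi>t r x - \<Phi>t r z) + 1/2 * (\<Phi>xx s' x - \<Phi>xx r z) + k r * sgn z * (\<Phi>x s' x - \<Phi>x r z)"
    unfolding one_step_def gen_def Let_def fst_conv snd_conv clamp_eq[OF rr] x_def z_def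
    by (simp add: right_diff_distrib)
  also have "\<bar>\<dots>\<bar> \<le> C * d + 1/2 * (C * d + C * (s' - s)) + K * (C * d + C * (s' - s))"
    by (rule tri[OF t xx abs_coeff_mult[OF rr x]])
  also have "\<dots> \<le> C * (2 + K) * (d + (s' - s))"
  proof -
    have "0 \<le> C * d" "0 \<le> C * (s' - s)" using C s by (auto simp: d_def)
    then show ?thesis by (simp add: algebra_simps)
  qed
  finally show ?thesis by (simp add: d_def x_def z_def)
qed

lemma expected_one_step_minus_gen:
  assumes s: "lo \<le> s" "s \<le> s'" "s' \<le> hi" "s' - s \<le> 1"
  shows "\<bar>(LINT r:{s..s'}|lborel. \<integral>\<omega>. one_step s s' (r, \<omega>) \<partial>N) - (LINT r:{s..s'}|lborel. \<integral>\<omega>. gen (r, \<omega>) \<partial>N)\<bar>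
    \<le> C * (2 + K) * (2 + K) * ((s' - s) * sqrt (s' - s))"
proof -
  have ss: "s \<in> {lo..hi}" "s' \<in> {lo..hi}" using s by auto
  have rr: "r \<in> {lo..hi}" if "r \<in> {s..s'}" for r using that s by auto
  note om = one_step_meas[OF ss]
  have ob: "\<bar>one_step s s' (r, \<omega>)\<bar> \<le> C + 1/2 * C + K * C" if "r \<in> {s..s'}" for r \<omega>
    by (rule one_step_bound[OF ss(2) rr[OF that]])
  have gb: "\<bar>gen (r, \<omega>)\<bar> \<le> C + 1/2 * C + K * C" if "r \<in> {s..s'}" for r \<omega>
    by (rule gen_bound[OF rr[OF that]])
  have io: "set_integrable lborel {s..s'} (\<lambda>r. \<integral>\<omega>. one_step s s' (r, \<omega>) \<partial>N)"
    by (rule strip_Fubini(2)[OF om ob])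
  have ig: "set_integrable lborel {s..s'} (\<lambda>r. \<integral>\<omega>. gen (r, \<omega>) \<partial>N)"
    by (rule strip_Fubini(2)[OF gen_meas gb])
  define B where "B = C * (2 + K) * (2 + K) * sqrt (s' - s)"
  have pt: "\<bar>(\<integral>\<omega>. one_step s s' (r, \<omega>) \<partial>N) - (\<integral>\<omega>. gen (r, \<omega>) \<partial>N)\<bar> \<le> B" if r: "r \<in> {s..s'}" for r
  proof -
    have lr: "lo \<le> s" "s \<le> r" "r \<le> hi" using r s by auto
    have 1: "integrable N (\<lambda>\<omega>. one_step s s' (r, \<omega>))"
      by (rule integrable_const_bound[of _ "C + 1/2 * C + K * C"]) (use ob[OF r] measurable_Pair2[OF om, of r] in auto)
    have 2: "integrable N (\<lambda>\<omega>. gen (r, \<omega>))"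
      by (rule integrable_const_bound[of _ "C + 1/2 * C + K * C"]) (use gb[OF r] measurable_Pair2[OF gen_meas, of r] in auto)
    have 3: "integrable N (\<lambda>\<omega>. C * (2 + K) * (\<bar>X r \<omega> - X s \<omega>\<bar> + (s' - s)))"
      using expected_increment_bound(1)[OF lr] by simp
    have "\<bar>(\<integral>\<omega>. one_step s s' (r, \<omega>) \<partial>N) - (\<integral>\<omega>. gen (r, \<omega>) \<partial>N)\<bar> = \<bar>\<integral>\<omega>. one_step s s' (r, \<omega>) - gen (r, \<omega>) \<partial>N\<bar>"
      using 1 2 by simp
    also have "\<dots> \<le> (\<integral>\<omega>. C * (2 + K) * (\<bar>X r \<omega> - X s \<omega>\<bar> + (s' - s)) \<partial>N)"
      by (rule abs_integral_le) (use 1 2 3 one_step_minus_gen[OF s(1-3) r] in auto)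
    also have "\<dots> = C * (2 + K) * ((\<integral>\<omega>. \<bar>X r \<omega> - X s \<omega>\<bar> \<partial>N) + (s' - s))"
      using expected_increment_bound(1)[OF lr] by (simp add: prob_space)
    also have "\<dots> \<le> C * (2 + K) * ((2 + K) * sqrt (s' - s))"
    proof (rule mult_left_mono)
      have "K * (r - s) \<le> K * sqrt (s' - s)"
        using three_halves_powers(1)[of "s' - s"] s r K_nonneg by (intro mult_left_mono) auto
      moreover have "sqrt (r - s) \<le> sqrt (s' - s)" using r by simp
      ultimately show "(\<integral>\<omega>. \<bar>X r \<omega> - X s \<omega>\<bar> \<partial>N) + (s' - s) \<le> (2 + K) * sqrt (s' - s)"
        using expected_increment_bound(2)[OF lr] three_halves_powers(1)[of "s' - s"] s
        unfolding distrib_right by linarith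
    qed (use C K_nonneg in auto)
    finally show ?thesis by (simp add: B_def mult.assoc)
  qed
  have "\<bar>(LINT r:{s..s'}|lborel. \<integral>\<omega>. one_step s s' (r, \<omega>) \<partial>N) - (LINT r:{s..s'}|lborel. \<integral>\<omega>. gen (r, \<omega>) \<partial>N)\<bar>
      = norm (LINT r:{s..s'}|lborel. (\<integral>\<omega>. one_step s s' (r, \<omega>) \<partial>N) - (\<integral>\<omega>. gen (r, \<omega>) \<partial>N))"
    using set_integral_diff(2)[OF io ig] by simp
  also have "\<dots> \<le> (LINT r:{s..s'}|lborel. norm ((\<integral>\<omega>. one_step s s' (r, \<omega>) \<partial>N) - (\<integral>\<omega>. gen (r, \<omega>) \<partial>N)))"
    by (rule set_integral_norm_bound[OF set_integral_diff(1)[OF io ig]])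
  also have "\<dots> \<le> (LINT r:{s..s'}|lborel. B)"
    by (rule set_integral_mono[OF set_integrable_norm[OF set_integral_diff(1)[OF io ig]] borel_integrable_atLeastAtMost'[OF continuous_on_const]])
       (use pt in auto)
  also have "\<dots> = B * (s' - s)"
    using s by (simp add: set_lebesgue_integral_def)
  finally show ?thesis by (simp add: B_def mult_ac)
qed

definition remainder :: "real \<Rightarrow> real \<Rightarrow> 'v \<Rightarrow> real" where
  "remainder s s' \<omega> = \<Phi> s' (X s' \<omega>) - \<Phi> s (X s \<omega>) - (LINT r:{s..s'}|lborel. one_step s s' (r, \<omega>))
     - \<Phi>x s' (X s \<omega>) * (w s' \<omega> - w s \<omega>) - 1/2 * (\<Phi>xx s' (X s \<omega>) * ((w s' \<omega> - w s \<omega>)\<^sup>2 - (s' - s)))"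

text \<open>What is left after the parts with vanishing expectation have been taken out consists of the third-order Taylor
remainder and of the quadratic terms that contain the drift at least once.\<close>

lemma remainder_bound:
  assumes \<omega>: "\<omega> \<in> space N" and s: "lo \<le> s" "s \<le> s'" "s' \<le> hi"
  shows "\<bar>remainder s s' \<omega>\<bar> \<le> C * (K * (s' - s) * \<bar>w s' \<omega> - w s \<omega>\<bar> + K\<^sup>2 * (s' - s)\<^sup>2)
      + 4 * C * (\<bar>w s' \<omega> - w s \<omega>\<bar> ^ 3 + K ^ 3 * (s' - s) ^ 3)"
proof -
  have ss: "s' \<in> {lo..hi}" using s by auto
  define x where "x = X s \<omega>"
  define y where "y = X s' \<omega>"
  define W where "W = w s' \<omega> - w s \<omega>"
  define A where "A = (LINT r:{s..s'}|lborel. k r * sgn (X r \<omega>))"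
  define H where "H = K * (s' - s)"
  have H: "0 \<le> H" using K_nonneg s by (simp add: H_def)
  have yx: "y - x = W + A"
    using X_eq[OF \<omega> s] by (simp add: x_def y_def W_def A_def)
  have A: "\<bar>A\<bar> \<le> H"
    using drift_part_bound[OF \<omega> s] path_integrable(2)[OF \<omega> s(1,3)] by (simp add: A_def H_def)
  have tay: "\<bar>\<Phi> s' y - \<Phi> s' x - \<Phi>x s' x * (y - x) - 1/2 * \<Phi>xx s' x * (y - x)\<^sup>2\<bar> \<le> C * \<bar>y - x\<bar> ^ 3"
    by (rule taylor2_lipschitz[OF dx[OF ss] dxx[OF ss] lip(2)[OF ss] C])
  have "\<bar>y - x\<bar> ^ 3 \<le> (\<bar>W\<bar> + H) ^ 3"
    using A yx by (intro power_mono) auto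
  also have "\<dots> \<le> 4 * (\<bar>W\<bar> ^ 3 + H ^ 3)"
  proof -
    define a where "a = \<bar>W\<bar>"
    \<comment> \<open>convexity of the third power\<close>
    have "0 \<le> 3 * (a + H) * (a - H)\<^sup>2" using H by (simp add: a_def)
    also have "\<dots> = 4 * (a ^ 3 + H ^ 3) - (a + H) ^ 3"
      by (simp add: power2_eq_square power3_eq_cube algebra_simps)
    finally show ?thesis by (simp add: a_def)
  qed
  finally have c: "C * \<bar>y - x\<bar> ^ 3 \<le> C * (4 * (\<bar>W\<bar> ^ 3 + H ^ 3))"
    using C by (rule mult_left_mono)
  have "\<bar>2 * W * A + A\<^sup>2\<bar> \<le> 2 * \<bar>W\<bar> * H + H\<^sup>2"
  proof -
    have "\<bar>W\<bar> * \<bar>A\<bar> \<le> \<bar>W\<bar> * H" using A by (intro mult_left_mono) auto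
    moreover have "A\<^sup>2 \<le> H\<^sup>2" using A H by (simp add: abs_le_square_iff[symmetric])
    ultimately show ?thesis
      using abs_triangle_ineq[of "2 * W * A" "A\<^sup>2"] by (simp add: abs_mult)
  qed
  then have "\<bar>\<Phi>xx s' x\<bar> * \<bar>2 * W * A + A\<^sup>2\<bar> \<le> C * (2 * \<bar>W\<bar> * H + H\<^sup>2)"
    using bound(4)[OF ss, of x] C by (intro mult_mono) auto
  then have q: "\<bar>1/2 * (\<Phi>xx s' x * (2 * W * A + A\<^sup>2))\<bar> \<le> C * (H * \<bar>W\<bar> + H\<^sup>2)"
  proof -
    have "0 \<le> C * H\<^sup>2" using C by simp
    moreover assume "\<bar>\<Phi>xx s' x\<bar> * \<bar>2 * W * A + A\<^sup>2\<bar> \<le> C * (2 * \<bar>W\<bar> * H + H\<^sup>2)"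
    moreover have "\<bar>1/2 * (\<Phi>xx s' x * (2 * W * A + A\<^sup>2))\<bar> = 1/2 * (\<bar>\<Phi>xx s' x\<bar> * \<bar>2 * W * A + A\<^sup>2\<bar>)"
      by (simp add: abs_mult)
    moreover have "C * (2 * \<bar>W\<bar> * H + H\<^sup>2) = 2 * (C * (H * \<bar>W\<bar>)) + C * H\<^sup>2"
      "C * (H * \<bar>W\<bar> + H\<^sup>2) = C * (H * \<bar>W\<bar>) + C * H\<^sup>2"
      by (simp_all add: algebra_simps)
    ultimately show ?thesis by linarith
  qed
  have "remainder s s' \<omega> = (\<Phi> s' y - \<Phi> s' x - \<Phi>x s' x * (y - x) - 1/2 * \<Phi>xx s' x * (y - x)\<^sup>2)
      + 1/2 * (\<Phi>xx s' x * (2 * W * A + A\<^sup>2))"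
    unfolding remainder_def one_step_integral[OF \<omega> s]
    unfolding x_def[symmetric] y_def[symmetric] W_def[symmetric] A_def[symmetric] yx
    by (simp add: power2_eq_square field_simps)
  then have "\<bar>remainder s s' \<omega>\<bar> \<le> C * (4 * (\<bar>W\<bar> ^ 3 + H ^ 3)) + C * (H * \<bar>W\<bar> + H\<^sup>2)"
    using tay c q by linarith
  also have "\<dots> = C * (K * (s' - s) * \<bar>W\<bar> + K\<^sup>2 * (s' - s)\<^sup>2) + 4 * C * (\<bar>W\<bar> ^ 3 + K ^ 3 * (s' - s) ^ 3)"
    unfolding H_def power_mult_distrib by algebra
  finally show ?thesis
    by (simp only: W_def)
qed

text \<open>The increment of the noise over a step of length \<open>h\<close> has size \<open>sqrt h\<close> and the drift contributes \<open>h\<close>, so all errors are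
of the order \<open>h * sqrt h\<close>.\<close>

lemma step_estimate:
  assumes s: "lo \<le> s" "s \<le> s'" "s' \<le> hi" "s' - s \<le> 1"
  shows "\<bar>(\<integral>\<omega>. \<Phi> s' (X s' \<omega>) \<partial>N) - (\<integral>\<omega>. \<Phi> s (X s \<omega>) \<partial>N) - (LINT r:{s..s'}|lborel. \<integral>\<omega>. gen (r, \<omega>) \<partial>N)\<bar>
    \<le> (C * (2 + K) * (2 + K) + C * (K + K\<^sup>2) + 4 * C * (2 + K ^ 3)) * ((s' - s) * sqrt (s' - s))"
proof -
  define h where "h = s' - s"
  have h: "0 \<le> h" "h \<le> 1" using s by (auto simp: h_def)
  have ss: "s \<in> {lo..hi}" "s' \<in> {lo..hi}" using s by auto
  note s3 = s(1-3)
  define W where "W = (\<lambda>\<omega>. w s' \<omega> - w s \<omega>)"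
  have Xm [measurable]: "X s \<in> borel_measurable N" "X s' \<in> borel_measurable N"
    using X_meas ss by auto
  have Wm [measurable]: "W \<in> borel_measurable N"
    unfolding W_def using w_meas ss by auto
  note iW = w_int[OF s3, folded W_def]
  have iW1: "integrable N (\<lambda>\<omega>. \<bar>W \<omega>\<bar>)" using w_int[OF s3, of 1] by (simp add: W_def)
  have iW2: "integrable N (\<lambda>\<omega>. (W \<omega>)\<^sup>2)" using w_int[OF s3, of 2] by (simp add: W_def)
  have iW3: "integrable N (\<lambda>\<omega>. \<bar>W \<omega>\<bar> ^ 3)" using w_int[OF s3, of 3] by (simp add: W_def)
  have iWp: "integrable N W" using iW1 by (simp add: integrable_abs_iff)
  have m: "\<Phi>x s' \<in> borel_measurable borel" "\<Phi>xx s' \<in> borel_measurable borel"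
    by (rule slice_meas[OF cont(2) ss(2)], rule slice_meas[OF cont(3) ss(2)])
  have i1: "integrable N (\<lambda>\<omega>. \<Phi> s' (X s' \<omega>))" "integrable N (\<lambda>\<omega>. \<Phi> s (X s \<omega>))"
    by (rule integrable_const_bound[of _ C], use bound(1) ss measurable_compose[OF Xm(2) \<Phi>_meas[OF ss(2)]] measurable_compose[OF Xm(1) \<Phi>_meas[OF ss(1)]] in auto)+
  have bo: "\<bar>one_step s s' (r, \<omega>)\<bar> \<le> C + 1/2 * C + K * C" if "r \<in> {s..s'}" for r \<omega>
    using that s by (intro one_step_bound ss) auto
  note fub = strip_Fubini[OF one_step_meas[OF ss] bo]
  have fub1: "(\<integral>\<omega>. (LINT r:{s..s'}|lborel. one_step s s' (r, \<omega>)) \<partial>N) = (LINT r:{s..s'}|lborel. \<integral>\<omega>. one_step s s' (r, \<omega>) \<partial>N)"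
    by (rule fub(1))
  have i2: "integrable N (\<lambda>\<omega>. LINT r:{s..s'}|lborel. one_step s s' (r, \<omega>))"
    by (rule fub(3))
  have i3: "integrable N (\<lambda>\<omega>. \<Phi>x s' (X s \<omega>) * W \<omega>)"
    by (rule integrable_bounded_times[OF iWp measurable_compose[OF Xm(1) m(1)] bound(3)[OF ss(2)]])
  have i4: "integrable N (\<lambda>\<omega>. \<Phi>xx s' (X s \<omega>) * ((W \<omega>)\<^sup>2 - h))"
    by (rule integrable_bounded_times[OF _ measurable_compose[OF Xm(1) m(2)] bound(4)[OF ss(2)]]) (use iW2 in simp)
  have rem: "remainder s s' = (\<lambda>\<omega>. \<Phi> s' (X s' \<omega>) - \<Phi> s (X s \<omega>) - (LINT r:{s..s'}|lborel. one_step s s' (r, \<omega>))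
     - \<Phi>x s' (X s \<omega>) * W \<omega> - 1/2 * (\<Phi>xx s' (X s \<omega>) * ((W \<omega>)\<^sup>2 - h)))"
    by (simp add: remainder_def[abs_def] W_def h_def)
  have i5: "integrable N (remainder s s')"
    unfolding rem by (intro Bochner_Integration.integrable_diff integrable_mult_right i1 i2 i3 i4)
  have z3: "(\<integral>\<omega>. \<Phi>x s' (X s \<omega>) * W \<omega> \<partial>N) = 0"
    unfolding W_def by (rule w_mean[OF s3 m(1) bound(3)[OF ss(2)]])
  have z4: "(\<integral>\<omega>. \<Phi>xx s' (X s \<omega>) * ((W \<omega>)\<^sup>2 - h) \<partial>N) = 0"
    unfolding W_def h_def by (rule w_variance[OF s3 m(2) bound(4)[OF ss(2)]])
  note i12 = Bochner_Integration.integrable_diff[OF Bochner_Integration.integrable_diff[OF i1] i2]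
  have Erem: "(\<integral>\<omega>. remainder s s' \<omega> \<partial>N) = (\<integral>\<omega>. \<Phi> s' (X s' \<omega>) \<partial>N) - (\<integral>\<omega>. \<Phi> s (X s \<omega>) \<partial>N)
      - (LINT r:{s..s'}|lborel. \<integral>\<omega>. one_step s s' (r, \<omega>) \<partial>N)"
    unfolding rem
    by (simp add: fub1 Bochner_Integration.integral_diff i1 i2 i3 i4 z3 z4 i12 Bochner_Integration.integrable_diff)
  define q where "q = h * sqrt h"
  have q: "h\<^sup>2 \<le> q" "h ^ 3 \<le> q" using three_halves_powers[OF h] by (simp_all add: q_def)
  have ib: "integrable N (\<lambda>\<omega>. C * (K * h * \<bar>W \<omega>\<bar> + K\<^sup>2 * h\<^sup>2) + 4 * C * (\<bar>W \<omega>\<bar> ^ 3 + K ^ 3 * h ^ 3))"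
    using iW1 iW3 by simp
  have "\<bar>\<integral>\<omega>. remainder s s' \<omega> \<partial>N\<bar> \<le> (\<integral>\<omega>. C * (K * h * \<bar>W \<omega>\<bar> + K\<^sup>2 * h\<^sup>2) + 4 * C * (\<bar>W \<omega>\<bar> ^ 3 + K ^ 3 * h ^ 3) \<partial>N)"
    by (rule abs_integral_le[OF i5 ib])
       (use remainder_bound[OF _ s3] in \<open>simp add: W_def h_def\<close>)
  also have "\<dots> = C * (K * h * (\<integral>\<omega>. \<bar>W \<omega>\<bar> \<partial>N) + K\<^sup>2 * h\<^sup>2) + 4 * C * ((\<integral>\<omega>. \<bar>W \<omega>\<bar> ^ 3 \<partial>N) + K ^ 3 * h ^ 3)"
    using iW1 iW3 by (simp add: prob_space)
  also have "\<dots> \<le> C * (K * q + K\<^sup>2 * q) + 4 * C * (2 * q + K ^ 3 * q)"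
  proof -
    have "K * h * (\<integral>\<omega>. \<bar>W \<omega>\<bar> \<partial>N) \<le> K * h * sqrt h"
      using w_abs[OF s3] K_nonneg h by (intro mult_left_mono) (auto simp: W_def h_def)
    then have 1: "K * h * (\<integral>\<omega>. \<bar>W \<omega>\<bar> \<partial>N) \<le> K * q" by (simp add: q_def mult.assoc)
    have 2: "(\<integral>\<omega>. \<bar>W \<omega>\<bar> ^ 3 \<partial>N) \<le> 2 * q"
      using w_abs3[OF s3] by (simp add: W_def h_def q_def)
    have 3: "K\<^sup>2 * h\<^sup>2 \<le> K\<^sup>2 * q" "K ^ 3 * h ^ 3 \<le> K ^ 3 * q"
      using q K_nonneg by (auto intro!: mult_left_mono)
    show ?thesis
      by (intro add_mono mult_left_mono) (use 1 2 3 C q K_nonneg in auto)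
  qed
  also have "\<dots> = (C * (K + K\<^sup>2) + 4 * C * (2 + K ^ 3)) * q"
    by (simp add: algebra_simps)
  finally have r: "\<bar>\<integral>\<omega>. remainder s s' \<omega> \<partial>N\<bar> \<le> (C * (K + K\<^sup>2) + 4 * C * (2 + K ^ 3)) * q" .
  have g: "\<bar>(LINT r:{s..s'}|lborel. \<integral>\<omega>. one_step s s' (r, \<omega>) \<partial>N) - (LINT r:{s..s'}|lborel. \<integral>\<omega>. gen (r, \<omega>) \<partial>N)\<bar>
    \<le> C * (2 + K) * (2 + K) * q"
    using expected_one_step_minus_gen[OF s] by (simp add: q_def h_def)
  have "(C * (2 + K) * (2 + K) + C * (K + K\<^sup>2) + 4 * C * (2 + K ^ 3)) * q
      = C * (2 + K) * (2 + K) * q + (C * (K + K\<^sup>2) + 4 * C * (2 + K ^ 3)) * q"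
    by (simp add: algebra_simps)
  then show ?thesis
    using r g Erem unfolding h_def[symmetric] q_def[symmetric] by linarith
qed

text \<open>The difference of both sides, as a function of the final time, has increments of the order \<open>h * sqrt h\<close>.\<close>

lemma dynkin_formula:
  "(\<integral>\<omega>. \<Phi> hi (X hi \<omega>) \<partial>N) - (\<integral>\<omega>. \<Phi> lo (X lo \<omega>) \<partial>N) = (LINT r:{lo..hi}|lborel. \<integral>\<omega>. gen (r, \<omega>) \<partial>N)"
proof -
  define l where "l = (\<lambda>r. \<integral>\<omega>. gen (r, \<omega>) \<partial>N)"
  have gb: "\<bar>gen (r, \<omega>)\<bar> \<le> C + 1/2 * C + K * C" if "r \<in> {lo..hi}" for r \<omega>
    by (rule gen_bound[OF that])
  have li: "set_integrable lborel {s..s'} l" if "lo \<le> s" "s' \<le> hi" for s s'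
    unfolding l_def by (rule strip_Fubini(2)[OF gen_meas gb]) (use that in auto)
  have LI: "(LINT r:{s..s'}|lborel. l r) = integral {s..s'} l" if "lo \<le> s" "s' \<le> hi" for s s'
    by (rule set_borel_integral_eq_integral(2)[OF li[OF that]])
  have lhk: "l integrable_on {lo..hi}"
    using li[of lo hi] by (simp add: set_borel_integral_eq_integral(1))
  define f where "f = (\<lambda>s. (\<integral>\<omega>. \<Phi> s (X s \<omega>) \<partial>N) - integral {lo..s} l)"
  have "f hi = f lo"
  proof (rule constant_if_increment_power_three_halves[OF lo_le_hi])
    show "0 \<le> C * (2 + K) * (2 + K) + C * (K + K\<^sup>2) + 4 * C * (2 + K ^ 3)"
      using C K_nonneg by simp
    fix s s' assume s: "lo \<le> s" "s \<le> s'" "s' \<le> hi" "s' - s \<le> 1"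
    have "integral {lo..s} l + integral {s..s'} l = integral {lo..s'} l"
      by (rule Henstock_Kurzweil_Integration.integral_combine[OF s(1,2)])
         (rule integrable_subinterval_real[OF lhk], use s in auto)
    then have "f s' - f s = (\<integral>\<omega>. \<Phi> s' (X s' \<omega>) \<partial>N) - (\<integral>\<omega>. \<Phi> s (X s \<omega>) \<partial>N) - (LINT r:{s..s'}|lborel. l r)"
      unfolding f_def LI[OF s(1,3)] by linarith
    then show "\<bar>f s' - f s\<bar> \<le> (C * (2 + K) * (2 + K) + C * (K + K\<^sup>2) + 4 * C * (2 + K ^ 3)) * ((s' - s) * sqrt (s' - s))"
      using step_estimate[OF s] by (simp only: l_def)
  qed
  then show ?thesis
    using LI[of lo hi] by (simp add: f_def l_def)
qed

end

section \<open>Constancy of the expectation away from time zero\<close>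

context odd_solution
begin

text \<open>The formula of Dynkin for the averages of \<open>u\<close>, in the limit \<open>e \<rightarrow> 0\<close>; the right-hand side is the expected
integral of the defect and disappears by dominated convergence.\<close>

lemma expectation_constant:
  assumes proc: "sgn_drift_process N lo hi K (drift_coeff \<nu>) X w" and hi: "hi < 1" "0 \<notin> {lo..hi}"
  shows "(\<integral>\<omega>. u (hi, X hi \<omega>) \<partial>N) = (\<integral>\<omega>. u (lo, X lo \<omega>) \<partial>N)"
proof -
  interpret P: sgn_drift_process N lo hi K "drift_coeff \<nu>" X w by (rule proc)
  have t0: "t \<le> 1" "t \<noteq> 0" if "t \<in> {lo..hi}" for t using that hi by auto
  have ends: "lo \<in> {lo..hi}" "hi \<in> {lo..hi}" using P.lo_le_hi by auto
  define e where "e = (\<lambda>n. 1 / real (n + 2))"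
  have e: "0 < e n" "e n \<le> 1" for n by (auto simp: e_def)
  have "e \<longlonglongrightarrow> 0"
    unfolding e_def by (rule LIMSEQ_ignore_initial_segment[OF lim_1_over_n])
  then have e0: "filterlim e (at_right 0) sequentially"
    using e by (auto simp: filterlim_at less_imp_neq[OF e(1), symmetric])
  obtain B where B: "0 \<le> B" "\<And>e t x. 0 < e \<Longrightarrow> e \<le> 1 \<Longrightarrow> t \<in> {lo..hi} \<Longrightarrow> \<bar>defect e t x\<bar> \<le> B"
    using defect_bounded[OF hi] by blast
  define l where "l = (\<lambda>n r. \<integral>\<omega>. drift_coeff \<nu> r * defect (e n) r (X r \<omega>) \<partial>N)"
  have step: "(\<integral>\<omega>. averaged (e n) hi (X hi \<omega>) \<partial>N) - (\<integral>\<omega>. averaged (e n) lo (X lo \<omega>) \<partial>N) = (LINT r:{lo..hi}|lborel. l n r)"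
    and l_int: "set_integrable lborel {lo..hi} (l n)" for n
  proof -
    obtain C where C: "smooth_test lo hi C (averaged (e n)) (averaged_t (e n)) (averaged_x (e n)) (averaged_xx (e n))"
      using smooth_test_averaged[OF P.lo_le_hi hi e(1)] by blast
    interpret D: dynkin N lo hi K "drift_coeff \<nu>" X w C "averaged (e n)" "averaged_t (e n)" "averaged_x (e n)" "averaged_xx (e n)"
      using proc C by (rule dynkin.intro)
    have gen: "(\<integral>\<omega>. D.gen (r, \<omega>) \<partial>N) = l n r" if "r \<in> {lo..hi}" for r
      unfolding l_def D.gen_def Let_def fst_conv snd_conv P.clamp_eq[OF that] generator_averaged ..
    have "(LINT r:{lo..hi}|lborel. \<integral>\<omega>. D.gen (r, \<omega>) \<partial>N) = (LINT r:{lo..hi}|lborel. l n r)"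
      by (rule set_lebesgue_integral_cong) (use gen in auto)
    with D.dynkin_formula
    show "(\<integral>\<omega>. averaged (e n) hi (X hi \<omega>) \<partial>N) - (\<integral>\<omega>. averaged (e n) lo (X lo \<omega>) \<partial>N) = (LINT r:{lo..hi}|lborel. l n r)"
      by simp
    have "set_integrable lborel {lo..hi} (\<lambda>r. \<integral>\<omega>. D.gen (r, \<omega>) \<partial>N)"
      by (rule P.strip_Fubini(2)[OF D.gen_meas D.gen_bound])
    then show "set_integrable lborel {lo..hi} (l n)"
      by (rule set_integrable_cong[THEN iffD1, rotated -1]) (use gen in auto)
  qed
  have X_u: "(\<lambda>\<omega>. u (t, X t \<omega>)) \<in> borel_measurable N" if "t \<in> {lo..hi}" for t
    by (rule measurable_compose[OF P.X_meas[OF that] borel_measurable_continuous_onI[OF continuous_u_slice(1)[OF t0[OF that]]]])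
  have X_reg: "(\<lambda>\<omega>. averaged (e n) t (X t \<omega>)) \<in> borel_measurable N" if "t \<in> {lo..hi}" for t n
    by (rule measurable_compose[OF P.X_meas[OF that] borel_measurable_continuous_onI])
       (rule DERIV_continuous_on[OF has_field_derivative_at_within[OF DERIV_averaged(1)[OF t0[OF that] e(1)]]])
  have lim: "(\<lambda>n. \<integral>\<omega>. averaged (e n) t (X t \<omega>) \<partial>N) \<longlonglongrightarrow> (\<integral>\<omega>. u (t, X t \<omega>) \<partial>N)" if t: "t \<in> {lo..hi}" for t
  proof (rule integral_dominated_convergence[where w="\<lambda>_. M"])
    show "AE \<omega> in N. (\<lambda>n. averaged (e n) t (X t \<omega>)) \<longlonglongrightarrow> u (t, X t \<omega>)"
      by (intro AE_I2 filterlim_compose[OF averaged_tendsto[OF t0[OF t]] e0])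
    show "AE \<omega> in N. norm (averaged (e n) t (X t \<omega>)) \<le> M" for n
      using averaged_bound[OF t0[OF t] e(1)] by simp
  qed (use X_u[OF t] X_reg[OF t] in auto)
  have "(\<lambda>n. LINT r:{lo..hi}|lborel. l n r) \<longlonglongrightarrow> (LINT r|(lborel :: real measure). (0::real))"
    unfolding set_lebesgue_integral_def
  proof (rule integral_dominated_convergence[where w="\<lambda>r. indicator {lo..hi} r *\<^sub>R (K * B)"])
    show "(\<lambda>r. indicator {lo..hi} r *\<^sub>R l n r) \<in> borel_measurable lborel" for n
      using l_int[of n] by (auto simp: set_integrable_def)
    show "integrable lborel (\<lambda>r. indicator {lo..hi} r *\<^sub>R (K * B))"
      using borel_integrable_atLeastAtMost'[OF continuous_on_const[of "{lo..hi}" "K * B"]] by (simp only: set_integrable_def)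
    have db: "\<bar>drift_coeff \<nu> r * defect (e n) r x\<bar> \<le> K * B" if "r \<in> {lo..hi}" for r n x
      unfolding abs_mult using P.k_bound[OF that] B(2)[OF e that] P.K_nonneg by (intro mult_mono) auto
    have dm: "(\<lambda>\<omega>. drift_coeff \<nu> r * defect (e n) r (X r \<omega>)) \<in> borel_measurable N" if "r \<in> {lo..hi}" for r n
    proof -
      have [measurable]: "averaged_x (e n) r \<in> borel_measurable borel" "folded_x (e n) r \<in> borel_measurable borel"
        by (rule borel_measurable_continuous_onI, rule DERIV_continuous_on[OF has_field_derivative_at_within[OF DERIV_averaged(2)[OF t0[OF that] e(1)]]])
           (rule borel_measurable_continuous_onI, rule DERIV_continuous_on[OF has_field_derivative_at_within[OF DERIV_averaged(4)[OF t0[OF that] e(1)]]])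
      note [measurable] = P.X_meas[OF that]
      show ?thesis unfolding defect_def by measurable
    qed
    have dl: "(\<lambda>n. l n r) \<longlonglongrightarrow> 0" if r: "r \<in> {lo..hi}" for r
    proof -
      have "(\<lambda>n. l n r) \<longlonglongrightarrow> (\<integral>\<omega>. 0 \<partial>N)"
        unfolding l_def
      proof (rule integral_dominated_convergence[where w="\<lambda>_. K * B"])
        show "AE \<omega> in N. (\<lambda>n. drift_coeff \<nu> r * defect (e n) r (X r \<omega>)) \<longlonglongrightarrow> 0"
          by (intro AE_I2 tendsto_mult_right_zero filterlim_compose[OF defect_tendsto[OF t0[OF r]] e0])
      qed (use db[OF r] dm[OF r] in auto)
      then show ?thesis by simp
    qed
    show "AE r in lborel. (\<lambda>n. indicator {lo..hi} r *\<^sub>R l n r) \<longlonglongrightarrow> 0"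
    proof (intro AE_I2)
      fix r
      show "(\<lambda>n. indicator {lo..hi} r *\<^sub>R l n r) \<longlonglongrightarrow> 0"
        using dl[of r] by (cases "r \<in> {lo..hi}") auto
    qed
    show "AE r in lborel. norm (indicator {lo..hi} r *\<^sub>R l n r) \<le> indicator {lo..hi} r *\<^sub>R (K * B)" for n
    proof (intro AE_I2)
      fix r
      have "\<bar>l n r\<bar> \<le> (\<integral>\<omega>. K * B \<partial>N)" if "r \<in> {lo..hi}"
        unfolding l_def
      proof (rule abs_integral_le)
        show "integrable N (\<lambda>\<omega>. drift_coeff \<nu> r * defect (e n) r (X r \<omega>))"
          by (rule P.integrable_const_bound[of _ "K * B"]) (use db[OF that] dm[OF that] in auto)
      qed (use db[OF that] in auto)
      then show "norm (indicator {lo..hi} r *\<^sub>R l n r) \<le> indicator {lo..hi} r *\<^sub>R (K * B)"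
        by (cases "r \<in> {lo..hi}") (auto simp: P.prob_space)
    qed
  qed auto
  then have "(\<lambda>n. LINT r:{lo..hi}|lborel. l n r) \<longlonglongrightarrow> 0" by simp
  moreover have "(\<lambda>n. LINT r:{lo..hi}|lborel. l n r) \<longlonglongrightarrow> (\<integral>\<omega>. u (hi, X hi \<omega>) \<partial>N) - (\<integral>\<omega>. u (lo, X lo \<omega>) \<partial>N)"
    unfolding step[symmetric] by (intro tendsto_diff lim ends)
  ultimately show ?thesis
    using LIMSEQ_unique by fastforce
qed

end

section \<open>Solutions of the stochastic equation\<close>

lemma measurable_from_filtration:
  assumes "filtration_on M F" "f \<in> borel_measurable (F s)" "sets N = sets M"
  shows "f \<in> borel_measurable N"
proof -
  have "space (F s) = space M" "sets (F s) \<subseteq> sets M"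
    using assms(1) by (auto simp: filtration_on_def filtration_def)
  with measurable_mono[of borel borel "F s" N] assms(2,3) sets_eq_imp_space_eq[OF assms(3)]
  show ?thesis by auto
qed

context
  fixes N :: "'v measure" and F w
  assumes wiener: "wiener_process N F w"
begin

lemma wiener_prob_space: "prob_space N"
  using wiener by (simp add: wiener_process_def)

lemma wiener_filtration: "filtration_on N F"
  using wiener by (simp add: wiener_process_def)

lemma wiener_measurable: "0 \<le> s \<Longrightarrow> w s \<in> borel_measurable N"
  using wiener measurable_from_filtration[OF wiener_filtration _ refl] by (auto simp: wiener_process_def adapted_def)

lemma wiener_distributed:
  assumes "0 \<le> r" "r < s"
  shows "distributed N lborel (\<lambda>\<omega>. w s \<omega> - w r \<omega>) (\<lambda>y. ennreal (normal_density 0 (sqrt (s - r)) y))"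
  using wiener assms by (simp add: wiener_process_def)

lemma wiener_integral:
  assumes rs: "0 \<le> r" "r < s" and g: "g \<in> borel_measurable borel"
  shows "integrable lborel (\<lambda>x. normal_density 0 (sqrt (s - r)) x * g x) \<longleftrightarrow> integrable N (\<lambda>\<omega>. g (w s \<omega> - w r \<omega>))"
    and "(\<integral>x. normal_density 0 (sqrt (s - r)) x * g x \<partial>lborel) = (\<integral>\<omega>. g (w s \<omega> - w r \<omega>) \<partial>N)"
  using distributed_integrable[OF wiener_distributed[OF rs], of g] distributed_integral[OF wiener_distributed[OF rs], of g] g
  by auto

lemma wiener_abs_moments:
  assumes rs: "0 \<le> r" "r \<le> s"
  shows "integrable N (\<lambda>\<omega>. \<bar>w s \<omega> - w r \<omega>\<bar> ^ n)"
    and "(\<integral>\<omega>. \<bar>w s \<omega> - w r \<omega>\<bar> \<partial>N) \<le> sqrt (s - r)"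
    and "(\<integral>\<omega>. \<bar>w s \<omega> - w r \<omega>\<bar> ^ 3 \<partial>N) \<le> 2 * ((s - r) * sqrt (s - r))"
proof -
  interpret prob_space N by (rule wiener_prob_space)
  have "integrable N (\<lambda>\<omega>. \<bar>w s \<omega> - w r \<omega>\<bar> ^ n) \<and> (\<integral>\<omega>. \<bar>w s \<omega> - w r \<omega>\<bar> \<partial>N) \<le> sqrt (s - r)
     \<and> (\<integral>\<omega>. \<bar>w s \<omega> - w r \<omega>\<bar> ^ 3 \<partial>N) \<le> 2 * ((s - r) * sqrt (s - r))"
  proof (cases "r = s")
    case False
    define \<sigma> where "\<sigma> = sqrt (s - r)"
    have \<sigma>: "0 < \<sigma>" using rs False by (simp add: \<sigma>_def)
    have rs': "r < s" using rs False by simp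
    have c: "sqrt (2 / pi) \<le> 1" using pi_gt3 by simp
    note W = wiener_integral[OF rs(1) rs', folded \<sigma>_def]
    have "integrable N (\<lambda>\<omega>. \<bar>w s \<omega> - w r \<omega>\<bar> ^ n)"
      using W(1)[of "\<lambda>x. \<bar>x\<bar> ^ n"] integrable_normal_moment_abs[OF \<sigma>, of 0 n] by simp
    moreover have "(\<integral>\<omega>. \<bar>w s \<omega> - w r \<omega>\<bar> \<partial>N) \<le> \<sigma>"
    proof -
      have "(\<integral>\<omega>. \<bar>w s \<omega> - w r \<omega>\<bar> \<partial>N) = \<sigma> * sqrt (2 / pi)"
        using W(2)[of abs] integral_normal_moment_abs_odd[OF \<sigma>, of 0 0] by simp
      then show ?thesis using \<sigma> c by (simp add: mult_left_le)
    qed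
    moreover have "(\<integral>\<omega>. \<bar>w s \<omega> - w r \<omega>\<bar> ^ 3 \<partial>N) \<le> 2 * ((s - r) * \<sigma>)"
    proof -
      have "(\<integral>\<omega>. \<bar>w s \<omega> - w r \<omega>\<bar> ^ 3 \<partial>N) = 2 * \<sigma> ^ 3 * sqrt (2 / pi)"
        using W(2)[of "\<lambda>x. \<bar>x\<bar> ^ 3"] integral_normal_moment_abs_odd[OF \<sigma>, of 0 1] by simp
      also have "\<dots> \<le> 2 * \<sigma> ^ 3" using \<sigma> c by (simp add: mult_left_le)
      also have "\<sigma> ^ 3 = (s - r) * \<sigma>"
        using rs' by (simp add: \<sigma>_def power3_eq_cube)
      finally show ?thesis .
    qed
    ultimately show ?thesis by (simp add: \<sigma>_def)
  qed (simp add: power_0_left)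
  then show "integrable N (\<lambda>\<omega>. \<bar>w s \<omega> - w r \<omega>\<bar> ^ n)" "(\<integral>\<omega>. \<bar>w s \<omega> - w r \<omega>\<bar> \<partial>N) \<le> sqrt (s - r)"
    "(\<integral>\<omega>. \<bar>w s \<omega> - w r \<omega>\<bar> ^ 3 \<partial>N) \<le> 2 * ((s - r) * sqrt (s - r))" by auto
qed

lemma wiener_independent_product:
  assumes rs: "0 \<le> r" "r < s" and \<xi>: "\<xi> \<in> borel_measurable (F (ennreal r))"
    and f: "f \<in> borel_measurable borel" "\<And>x. \<bar>f x\<bar> \<le> (B :: real)"
    and g: "g \<in> borel_measurable borel" "integrable N (\<lambda>\<omega>. g (w s \<omega> - w r \<omega>))"
  shows "(\<integral>\<omega>. f (\<xi> \<omega>) * g (w s \<omega> - w r \<omega>) \<partial>N) = (\<integral>\<omega>. f (\<xi> \<omega>) \<partial>N) * (\<integral>\<omega>. g (w s \<omega> - w r \<omega>) \<partial>N)"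
proof -
  interpret prob_space N by (rule wiener_prob_space)
  define D where "D = (\<lambda>\<omega>. w s \<omega> - w r \<omega>)"
  have D: "D \<in> borel_measurable N"
    unfolding D_def using wiener_measurable rs by auto
  have \<xi>N: "\<xi> \<in> borel_measurable N"
    by (rule measurable_from_filtration[OF wiener_filtration \<xi> refl])
  have sp: "space (F (ennreal r)) = space N"
    using wiener_filtration by (auto simp: filtration_on_def filtration_def)
  \<comment> \<open>both functions generate sub-\<open>\<sigma>\<close>-algebras of the independent ones\<close>
  have ind: "indep_set (sets (F (ennreal r))) (sets (vimage_algebra (space N) D borel))"
    using wiener rs unfolding wiener_process_def D_def by blast
  have fm: "(\<lambda>\<omega>. f (\<xi> \<omega>)) \<in> borel_measurable (F (ennreal r))"
    by (rule measurable_compose[OF \<xi> f(1)])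
  have "indep_var borel (\<lambda>\<omega>. f (\<xi> \<omega>)) borel (\<lambda>\<omega>. g (D \<omega>))"
    unfolding indep_var_eq
  proof (intro conjI)
    show "(\<lambda>\<omega>. f (\<xi> \<omega>)) \<in> borel_measurable N" by (rule measurable_compose[OF \<xi>N f(1)])
    show "(\<lambda>\<omega>. g (D \<omega>)) \<in> borel_measurable N" by (rule measurable_compose[OF D g(1)])
    have 1: "sigma_sets (space N) {(\<lambda>\<omega>. f (\<xi> \<omega>)) -` A \<inter> space N |A. A \<in> sets borel} \<subseteq> sets (F (ennreal r))"
      unfolding sp[symmetric]
      by (rule sets.sigma_sets_subset) (use measurable_sets[OF fm] in auto)
    have gm: "(\<lambda>\<omega>. g (D \<omega>)) \<in> borel_measurable (vimage_algebra (space N) D borel)"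
      by (rule measurable_compose[OF measurable_vimage_algebra1 g(1)]) auto
    have 2: "sigma_sets (space N) {(\<lambda>\<omega>. g (D \<omega>)) -` A \<inter> space N |A. A \<in> sets borel} \<subseteq> sets (vimage_algebra (space N) D borel)"
      using sets.sigma_sets_subset[of "{(\<lambda>\<omega>. g (D \<omega>)) -` A \<inter> space N |A. A \<in> sets borel}" "vimage_algebra (space N) D borel"]
        measurable_sets[OF gm] by auto
    show "indep_set (sigma_sets (space N) {(\<lambda>\<omega>. f (\<xi> \<omega>)) -` A \<inter> space N |A. A \<in> sets borel})
        (sigma_sets (space N) {(\<lambda>\<omega>. g (D \<omega>)) -` A \<inter> space N |A. A \<in> sets borel})"
      using ind 1 2 unfolding indep_set_def
      by (elim indep_sets_mono_sets) (auto split: bool.split)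
  qed
  moreover have "integrable N (\<lambda>\<omega>. f (\<xi> \<omega>))"
    by (rule integrable_const_bound[of _ B]) (use f measurable_compose[OF \<xi>N f(1)] in auto)
  ultimately show ?thesis
    using indep_var_lebesgue_integral[of "\<lambda>\<omega>. f (\<xi> \<omega>)" "\<lambda>\<omega>. g (D \<omega>)"] g(2) by (simp add: D_def)
qed

text \<open>The increment is centred with variance \<open>s - r\<close> and independent of the past.\<close>

lemma wiener_orthogonality:
  assumes rs: "0 \<le> r" "r \<le> s" and \<xi>: "\<xi> \<in> borel_measurable (F (ennreal r))"
    and f: "f \<in> borel_measurable borel" "\<And>x. \<bar>f x\<bar> \<le> (B :: real)"
  shows "(\<integral>\<omega>. f (\<xi> \<omega>) * (w s \<omega> - w r \<omega>) \<partial>N) = 0"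
    and "(\<integral>\<omega>. f (\<xi> \<omega>) * ((w s \<omega> - w r \<omega>)\<^sup>2 - (s - r)) \<partial>N) = 0"
proof -
  interpret prob_space N by (rule wiener_prob_space)
  have "(\<integral>\<omega>. f (\<xi> \<omega>) * (w s \<omega> - w r \<omega>) \<partial>N) = 0 \<and> (\<integral>\<omega>. f (\<xi> \<omega>) * ((w s \<omega> - w r \<omega>)\<^sup>2 - (s - r)) \<partial>N) = 0"
  proof (cases "r = s")
    case False
    define \<sigma> where "\<sigma> = sqrt (s - r)"
    have \<sigma>: "0 < \<sigma>" using rs False by (simp add: \<sigma>_def)
    have rs': "r < s" using rs False by simp
    note W = wiener_integral[OF rs(1) rs', folded \<sigma>_def]
    have i2: "integrable N (\<lambda>\<omega>. (w s \<omega> - w r \<omega>)\<^sup>2)"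
      using wiener_abs_moments(1)[OF rs, of 2] by simp
    have i1: "integrable N (\<lambda>\<omega>. w s \<omega> - w r \<omega>)"
      using W(1)[of "\<lambda>x. x"] integrable_normal_moment_nz_1[OF \<sigma>, of 0] by simp
    have e1: "(\<integral>\<omega>. w s \<omega> - w r \<omega> \<partial>N) = 0"
      using W(2)[of "\<lambda>x. x"] integral_normal_moment_nz_1[OF \<sigma>, of 0] by simp
    have "(\<integral>\<omega>. (w s \<omega> - w r \<omega>)\<^sup>2 \<partial>N) = \<sigma>\<^sup>2"
      using W(2)[of "\<lambda>x. x\<^sup>2"] integral_normal_moment_even[OF \<sigma>, of 0 1] by simp
    then have e2: "(\<integral>\<omega>. (w s \<omega> - w r \<omega>)\<^sup>2 - (s - r) \<partial>N) = 0"
      using i2 rs by (simp add: \<sigma>_def prob_space)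
    show ?thesis
      using wiener_independent_product[OF rs(1) rs' \<xi> f, of "\<lambda>x. x"]
        wiener_independent_product[OF rs(1) rs' \<xi> f, of "\<lambda>x. x\<^sup>2 - (s - r)"] i1 i2 e1 e2 by simp
  qed simp
  then show "(\<integral>\<omega>. f (\<xi> \<omega>) * (w s \<omega> - w r \<omega>) \<partial>N) = 0"
    "(\<integral>\<omega>. f (\<xi> \<omega>) * ((w s \<omega> - w r \<omega>)\<^sup>2 - (s - r)) \<partial>N) = 0" by auto
qed

lemma wiener_AE_neq:
  assumes "0 \<le> r" "r < s"
  shows "AE \<omega> in N. w s \<omega> - w r \<omega> \<noteq> c"
proof -
  define D where "D = (\<lambda>\<omega>. w s \<omega> - w r \<omega>)"
  note d = wiener_distributed[OF assms, folded D_def]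
  have D: "D \<in> borel_measurable N" using distributed_measurable[OF d] by simp
  have "emeasure N (D -` {c} \<inter> space N) = (\<integral>\<^sup>+y. ennreal (normal_density 0 (sqrt (s - r)) y) * indicator {c} y \<partial>lborel)"
    by (rule distributed_emeasure[OF d]) simp
  also have "\<dots> = (\<integral>\<^sup>+(y::real). 0 \<partial>lborel)"
    by (rule nn_integral_cong_AE) (use AE_lborel_singleton[of c] in \<open>auto elim: eventually_mono\<close>)
  finally have "D -` {c} \<inter> space N \<in> null_sets N"
    using measurable_sets[OF D, of "{c}"] by (simp add: null_sets_def)
  then show ?thesis
    by (rule AE_I') (auto simp: D_def)
qed

end

lemma lborel_set_integral_shift:
  fixes f :: "real \<Rightarrow> real"
  shows "(LINT r:{a..b}|lborel. f (t + r)) = (LINT r:{t + a..t + b}|lborel. f r)"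
proof -
  have "(LINT r:{t + a..t + b}|lborel. f r) = (\<integral>r. indicator {t + a..t + b} (t + 1 * r) *\<^sub>R f (t + 1 * r) \<partial>lborel)"
    unfolding set_lebesgue_integral_def by (subst lborel_integral_real_affine[of 1 _ t]) simp_all
  also have "\<dots> = (LINT r:{a..b}|lborel. f (t + r))"
    unfolding set_lebesgue_integral_def by (rule Bochner_Integration.integral_cong) (auto simp: indicator_def)
  finally show ?thesis ..
qed

locale solution_from_point =
  fixes \<nu> t x :: real and N :: "'v measure" and F w Y
  assumes nu: "\<nu> < 1" and sol: "weak_solution \<nu> (t, x) N F w Y"
begin

lemma wiener: "wiener_process N F w"
  using sol by (simp add: weak_solution_def)

sublocale prob_space N
  by (rule wiener_prob_space[OF wiener])

definition good :: "'v \<Rightarrow> bool" where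
  "good \<omega> \<longleftrightarrow> w 0 \<omega> = 0 \<and> continuous_on {0..} (\<lambda>s. w s \<omega>) \<and> (\<forall>s\<ge>0.
     fst (Y s \<omega>) = t + s \<and>
     set_integrable lborel {0..s} (\<lambda>r. drift \<nu> (Y r \<omega>)) \<and>
     snd (Y s \<omega>) = x + w s \<omega> + (LINT r:{0..s}|lborel. drift \<nu> (Y r \<omega>)))"

lemma AE_good: "AE \<omega> in N. good \<omega>"
proof -
  have "AE \<omega> in N. w 0 \<omega> = 0 \<and> continuous_on {0..} (\<lambda>s. w s \<omega>)"
    using wiener by (simp add: wiener_process_def)
  moreover have "AE \<omega> in N. \<forall>s\<ge>0. fst (Y s \<omega>) = t + s \<and>
     set_integrable lborel {0..s} (\<lambda>r. drift \<nu> (Y r \<omega>)) \<and>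
     snd (Y s \<omega>) = x + w s \<omega> + (LINT r:{0..s}|lborel. drift \<nu> (Y r \<omega>))"
    using sol by (simp add: weak_solution_def)
  ultimately show ?thesis
    by eventually_elim (simp add: good_def)
qed

text \<open>A measurable set of full probability on which all almost sure properties hold; the set of good \<open>\<omega>\<close> itself need not be
measurable.\<close>

definition regular_paths :: "'v set" where
  "regular_paths = space N - (SOME Z. Z \<in> null_sets N \<and> {\<omega>\<in>space N. \<not> good \<omega>} \<subseteq> Z)"

lemma regular_paths:
  shows "regular_paths \<in> sets N" "AE \<omega> in N. \<omega> \<in> regular_paths" "\<omega> \<in> regular_paths \<Longrightarrow> good \<omega>" "regular_paths \<subseteq> space N"
proof -
  define Z where "Z = (SOME Z. Z \<in> null_sets N \<and> {\<omega>\<in>space N. \<not> good \<omega>} \<subseteq> Z)"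
  have "\<exists>Z. Z \<in> null_sets N \<and> {\<omega>\<in>space N. \<not> good \<omega>} \<subseteq> Z"
    using AE_good unfolding eventually_ae_filter by auto
  from someI_ex[OF this] have Z: "Z \<in> null_sets N" "{\<omega>\<in>space N. \<not> good \<omega>} \<subseteq> Z"
    by (auto simp: Z_def)
  have eq: "regular_paths = space N - Z" by (simp add: regular_paths_def Z_def)
  show "regular_paths \<in> sets N" using Z by (auto simp: eq)
  show "AE \<omega> in N. \<omega> \<in> regular_paths"
    unfolding eq using AE_not_in[OF Z(1)] by (auto elim: eventually_mono)
  show "\<omega> \<in> regular_paths \<Longrightarrow> good \<omega>" "regular_paths \<subseteq> space N" using Z by (auto simp: eq)
qed

text \<open>The solution in absolute time. On the exceptional null set it is replaced, together with the noise, by \<open>0\<close>, which solves the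
equation because \<open>sgn 0 = 0\<close>.\<close>

definition path :: "real \<Rightarrow> 'v \<Rightarrow> real" where
  "path r \<omega> = (if \<omega> \<in> regular_paths then snd (Y (r - t) \<omega>) else 0)"

definition noise :: "real \<Rightarrow> 'v \<Rightarrow> real" where
  "noise r \<omega> = (if \<omega> \<in> regular_paths then w (r - t) \<omega> else 0)"

lemma Y_adapted: "0 \<le> s \<Longrightarrow> (\<lambda>\<omega>. snd (Y s \<omega>)) \<in> borel_measurable (F (ennreal s))"
proof -
  assume "0 \<le> s"
  then have "Y s \<in> borel_measurable (F (ennreal s))"
    using sol by (simp add: weak_solution_def adapted_def)
  then show ?thesis
    by (rule measurable_compose) (simp add: borel_measurable_continuous_onI continuous_on_snd)
qed

lemma Y_measurable: "0 \<le> s \<Longrightarrow> (\<lambda>\<omega>. snd (Y s \<omega>)) \<in> borel_measurable N"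
  by (rule measurable_from_filtration[OF wiener_filtration[OF wiener] Y_adapted refl])

lemma path_measurable: "t \<le> r \<Longrightarrow> path r \<in> borel_measurable N"
  unfolding path_def using regular_paths(1) Y_measurable[of "r - t"]
  by (intro measurable_If_set) auto

lemma noise_measurable: "t \<le> r \<Longrightarrow> noise r \<in> borel_measurable N"
  unfolding noise_def using regular_paths(1) wiener_measurable[OF wiener, of "r - t"]
  by (intro measurable_If_set) auto

lemma AE_path: "AE \<omega> in N. path r \<omega> = snd (Y (r - t) \<omega>)"
  using regular_paths(2) by eventually_elim (simp add: path_def)

lemma AE_noise: "AE \<omega> in N. noise r \<omega> - noise r' \<omega> = w (r - t) \<omega> - w (r' - t) \<omega>"
  using regular_paths(2) by eventually_elim (simp add: noise_def)

lemma AE_path_noise: "AE \<omega> in N. path r \<omega> = snd (Y (r - t) \<omega>) \<and> noise s \<omega> - noise s' \<omega> = w (s - t) \<omega> - w (s' - t) \<omega>"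
  using AE_path[of r] AE_noise[of s s'] by eventually_elim simp

lemma path_HK:
  assumes \<omega>: "\<omega> \<in> regular_paths" and s: "0 \<le> s"
  shows "(\<lambda>r. drift_coeff \<nu> (t + r) * sgn (path (t + r) \<omega>)) integrable_on {0..s}"
    and "path (t + s) \<omega> = x + noise (t + s) \<omega> + integral {0..s} (\<lambda>r. drift_coeff \<nu> (t + r) * sgn (path (t + r) \<omega>))"
proof -
  have g: "good \<omega>" by (rule regular_paths(3)[OF \<omega>])
  have eq: "drift \<nu> (Y r \<omega>) = drift_coeff \<nu> (t + r) * sgn (path (t + r) \<omega>)" if "r \<in> {0..s}" for r
    using g that \<omega> by (simp add: good_def drift_eq path_def)
  have int: "set_integrable lborel {0..s} (\<lambda>r. drift \<nu> (Y r \<omega>))"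
    using g s by (simp add: good_def)
  from set_borel_integral_eq_integral(1)[OF int]
  show "(\<lambda>r. drift_coeff \<nu> (t + r) * sgn (path (t + r) \<omega>)) integrable_on {0..s}"
    by (rule integrable_eq) (rule eq)
  have "path (t + s) \<omega> = x + noise (t + s) \<omega> + (LINT r:{0..s}|lborel. drift \<nu> (Y r \<omega>))"
    using g s \<omega> by (simp add: good_def path_def noise_def)
  also have "(LINT r:{0..s}|lborel. drift \<nu> (Y r \<omega>)) = integral {0..s} (\<lambda>r. drift \<nu> (Y r \<omega>))"
    by (rule set_borel_integral_eq_integral(2)[OF int])
  also have "\<dots> = integral {0..s} (\<lambda>r. drift_coeff \<nu> (t + r) * sgn (path (t + r) \<omega>))"
    by (rule integral_cong) (rule eq)
  finally show "path (t + s) \<omega> = x + noise (t + s) \<omega> + integral {0..s} (\<lambda>r. drift_coeff \<nu> (t + r) * sgn (path (t + r) \<omega>))" .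
qed

lemma path_start: "AE \<omega> in N. path t \<omega> = x"
  using regular_paths(2)
proof eventually_elim
  case (elim \<omega>)
  with path_HK(2)[OF elim, of 0] regular_paths(3)[OF elim] show ?case
    by (simp add: noise_def good_def)
qed

lemma noise_continuous:
  assumes "\<omega> \<in> regular_paths"
  shows "continuous_on {t..T} (\<lambda>r. noise r \<omega>)"
proof -
  have "continuous_on {0..} (\<lambda>s. w s \<omega>)"
    using regular_paths(3)[OF assms] by (simp add: good_def)
  then have "continuous_on {t..T} (\<lambda>r. w (r - t) \<omega>)"
    by (rule continuous_on_compose2) (auto intro!: continuous_intros)
  with assms show ?thesis by (simp add: noise_def)
qed

lemma path_continuous: "continuous_on {t..T} (\<lambda>r. path r \<omega>)"
proof (cases "\<omega> \<in> regular_paths \<and> t \<le> T")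
  case True
  define f where "f = (\<lambda>r. drift_coeff \<nu> (t + r) * sgn (path (t + r) \<omega>))"
  have "continuous_on {0..T - t} (\<lambda>s. integral {0..s} f)"
    by (rule indefinite_integral_continuous_1) (use path_HK(1)[of \<omega> "T - t"] True in \<open>auto simp: f_def\<close>)
  then have "continuous_on {t..T} (\<lambda>r. integral {0..r - t} f)"
    by (rule continuous_on_compose2) (auto intro!: continuous_intros)
  then have "continuous_on {t..T} (\<lambda>r. x + noise r \<omega> + integral {0..r - t} f)"
    using noise_continuous[of \<omega> T] True by (intro continuous_intros) auto
  then show ?thesis
    by (rule continuous_on_eq) (use path_HK(2)[of \<omega> "_ - t"] True in \<open>auto simp: f_def\<close>)
next
  case False
  then show ?thesis by (cases "t \<le> T") (auto simp: path_def)
qed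

lemma path_equation:
  assumes "t \<le> s" "s \<le> s'"
  shows "path s' \<omega> - path s \<omega> = noise s' \<omega> - noise s \<omega> + (LINT r:{s..s'}|lborel. drift_coeff \<nu> r * sgn (path r \<omega>))"
proof (cases "\<omega> \<in> regular_paths")
  case True
  define f where "f = (\<lambda>r. drift_coeff \<nu> (t + r) * sgn (path (t + r) \<omega>))"
  have g: "good \<omega>" by (rule regular_paths(3)[OF True])
  have st: "0 \<le> s - t" "s - t \<le> s' - t" "0 \<le> s' - t" using assms by auto
  have eq: "drift \<nu> (Y r \<omega>) = f r" if "0 \<le> r" for r
    using g that True by (simp add: good_def drift_eq path_def f_def)
  have "set_integrable lborel {0..s' - t} (\<lambda>r. drift \<nu> (Y r \<omega>))"
    using g st by (simp add: good_def)
  then have "set_integrable lborel {s - t..s' - t} (\<lambda>r. drift \<nu> (Y r \<omega>))"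
    by (rule set_integrable_subset) (use st in auto)
  then have i: "set_integrable lborel {s - t..s' - t} f"
    by (rule set_integrable_cong[THEN iffD1, rotated -1]) (use st eq in auto)
  have "integral {0..s - t} f + integral {s - t..s' - t} f = integral {0..s' - t} f"
    by (rule Henstock_Kurzweil_Integration.integral_combine[OF st(1,2)]) (use path_HK(1)[OF True st(3)] in \<open>simp add: f_def\<close>)
  then have "path s' \<omega> - path s \<omega> = noise s' \<omega> - noise s \<omega> + integral {s - t..s' - t} f"
    using path_HK(2)[OF True st(1)] path_HK(2)[OF True st(3)] by (simp add: f_def)
  also have "integral {s - t..s' - t} f = (LINT r:{s - t..s' - t}|lborel. f r)"
    by (rule set_borel_integral_eq_integral(2)[OF i, symmetric])
  also have "\<dots> = (LINT r:{s..s'}|lborel. drift_coeff \<nu> r * sgn (path r \<omega>))"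
    unfolding f_def using lborel_set_integral_shift[of "s - t" "s' - t" "\<lambda>r. drift_coeff \<nu> r * sgn (path r \<omega>)" t] by simp
  finally show ?thesis .
next
  case False
  then show ?thesis by (simp add: path_def noise_def set_lebesgue_integral_def)
qed

lemma is_sgn_drift_process:
  assumes lo: "t \<le> lo" "lo \<le> hi" and K: "\<And>r. r \<in> {lo..hi} \<Longrightarrow> drift_coeff \<nu> r \<le> K"
  shows "sgn_drift_process N lo hi K (drift_coeff \<nu>) path noise"
proof
  show "lo \<le> hi" by fact
  show "drift_coeff \<nu> \<in> borel_measurable borel" by measurable
  show "\<bar>drift_coeff \<nu> r\<bar> \<le> K" if "r \<in> {lo..hi}" for r
    using K[OF that] drift_coeff_nonneg[of \<nu> r] by simp
  show "path s \<in> borel_measurable N" "noise s \<in> borel_measurable N" if "s \<in> {lo..hi}" for s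
    using that lo by (auto intro!: path_measurable noise_measurable)
  show "continuous_on {lo..hi} (\<lambda>s. path s \<omega>)" for \<omega>
    by (rule continuous_on_subset[OF path_continuous[of hi]]) (use lo in auto)
  show "path s' \<omega> - path s \<omega> = noise s' \<omega> - noise s \<omega> + (LINT r:{s..s'}|lborel. drift_coeff \<nu> r * sgn (path r \<omega>))"
    if "lo \<le> s" "s \<le> s'" for \<omega> s s'
    by (rule path_equation) (use that lo in auto)
  fix s s' assume s: "lo \<le> s" "s \<le> s'" "s' \<le> hi"
  then have st: "0 \<le> s - t" "s - t \<le> s' - t" and ts: "t \<le> s" "t \<le> s'" using lo by auto
  have d: "(s' - t) - (s - t) = s' - s" by simp
  have [measurable]: "noise s \<in> borel_measurable N" "noise s' \<in> borel_measurable N" "path s \<in> borel_measurable N"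
    "w (s - t) \<in> borel_measurable N" "w (s' - t) \<in> borel_measurable N" "(\<lambda>\<omega>. snd (Y (s - t) \<omega>)) \<in> borel_measurable N"
    using ts st by (auto intro!: noise_measurable path_measurable wiener_measurable[OF wiener] Y_measurable)
  have abs_AE: "AE \<omega> in N. \<bar>noise s' \<omega> - noise s \<omega>\<bar> ^ n = \<bar>w (s' - t) \<omega> - w (s - t) \<omega>\<bar> ^ n" for n
    using AE_noise[of s' s] by eventually_elim simp
  note mom = wiener_abs_moments[OF wiener st, unfolded d]
  show "integrable N (\<lambda>\<omega>. \<bar>noise s' \<omega> - noise s \<omega>\<bar> ^ n)" for n
    by (subst integrable_cong_AE[OF _ _ abs_AE]) (auto intro: mom)
  have "(\<integral>\<omega>. \<bar>noise s' \<omega> - noise s \<omega>\<bar> \<partial>N) = (\<integral>\<omega>. \<bar>w (s' - t) \<omega> - w (s - t) \<omega>\<bar> \<partial>N)"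
    by (rule integral_cong_AE) (use abs_AE[of 1] in auto)
  with mom(2) show "(\<integral>\<omega>. \<bar>noise s' \<omega> - noise s \<omega>\<bar> \<partial>N) \<le> sqrt (s' - s)" by simp
  have "(\<integral>\<omega>. \<bar>noise s' \<omega> - noise s \<omega>\<bar> ^ 3 \<partial>N) = (\<integral>\<omega>. \<bar>w (s' - t) \<omega> - w (s - t) \<omega>\<bar> ^ 3 \<partial>N)"
    by (rule integral_cong_AE) (use abs_AE[of 3] in auto)
  with mom(3) show "(\<integral>\<omega>. \<bar>noise s' \<omega> - noise s \<omega>\<bar> ^ 3 \<partial>N) \<le> 2 * ((s' - s) * sqrt (s' - s))" by simp
  fix f :: "real \<Rightarrow> real" and B :: real
  assume f [measurable]: "f \<in> borel_measurable borel" and fB: "\<And>x. \<bar>f x\<bar> \<le> B"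
  note orth = wiener_orthogonality[OF wiener st Y_adapted[OF st(1)] f fB, unfolded d]
  have "(\<integral>\<omega>. f (path s \<omega>) * (noise s' \<omega> - noise s \<omega>) \<partial>N) = (\<integral>\<omega>. f (snd (Y (s - t) \<omega>)) * (w (s' - t) \<omega> - w (s - t) \<omega>) \<partial>N)"
  proof (rule integral_cong_AE)
    show "AE \<omega> in N. f (path s \<omega>) * (noise s' \<omega> - noise s \<omega>) = f (snd (Y (s - t) \<omega>)) * (w (s' - t) \<omega> - w (s - t) \<omega>)"
      using AE_path_noise[of s s' s] by eventually_elim simp
  qed measurable
  with orth(1) show "(\<integral>\<omega>. f (path s \<omega>) * (noise s' \<omega> - noise s \<omega>) \<partial>N) = 0" by simp
  have "(\<integral>\<omega>. f (path s \<omega>) * ((noise s' \<omega> - noise s \<omega>)\<^sup>2 - (s' - s)) \<partial>N) =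
      (\<integral>\<omega>. f (snd (Y (s - t) \<omega>)) * ((w (s' - t) \<omega> - w (s - t) \<omega>)\<^sup>2 - (s' - s)) \<partial>N)"
  proof (rule integral_cong_AE)
    show "AE \<omega> in N. f (path s \<omega>) * ((noise s' \<omega> - noise s \<omega>)\<^sup>2 - (s' - s)) =
        f (snd (Y (s - t) \<omega>)) * ((w (s' - t) \<omega> - w (s - t) \<omega>)\<^sup>2 - (s' - s))"
      using AE_path_noise[of s s' s] by eventually_elim simp
  qed measurable
  with orth(2) show "(\<integral>\<omega>. f (path s \<omega>) * ((noise s' \<omega> - noise s \<omega>)\<^sup>2 - (s' - s)) \<partial>N) = 0" by simp
qed

text \<open>Up to time \<open>0\<close> there is no drift, so the position at time \<open>0\<close> is \<open>x\<close> plus a Gaussian variable, degenerate only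
if \<open>t = 0\<close>, and then \<open>x \<noteq> 0\<close>.\<close>

lemma path_avoids_origin:
  assumes "t \<le> 0" "(t, x) \<noteq> (0, 0)"
  shows "AE \<omega> in N. path 0 \<omega> \<noteq> 0"
proof (cases "t = 0")
  case True
  then have "x \<noteq> 0" using assms by simp
  then show ?thesis using path_start True by (auto elim: eventually_mono)
next
  case False
  have "AE \<omega> in N. w (- t) \<omega> - w 0 \<omega> \<noteq> - x"
    by (rule wiener_AE_neq[OF wiener]) (use False assms in auto)
  with regular_paths(2) show ?thesis
  proof eventually_elim
    case (elim \<omega>)
    have "integral {0..- t} (\<lambda>r. drift_coeff \<nu> (t + r) * sgn (path (t + r) \<omega>)) = integral {0..- t} (\<lambda>r. 0)"
      by (rule integral_cong) (auto simp: drift_coeff_def)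
    then have "path 0 \<omega> = x + noise 0 \<omega>"
      using path_HK(2)[OF elim(1), of "- t"] assms by simp
    with elim regular_paths(3)[OF elim(1)] show ?case
      by (auto simp: noise_def good_def)
  qed
qed

end

section \<open>The representation\<close>

context odd_solution
begin

lemma u_slice_measurable:
  assumes "t \<le> 1"
  shows "(\<lambda>y. u (t, y)) \<in> borel_measurable borel"
proof (rule borel_measurable_continuous_countable_exceptions[of "{0}"])
  show "continuous_on (- {0}) (\<lambda>y. u (t, y))"
    by (rule continuous_on_compose2[OF cont]) (use assms in \<open>auto intro!: continuous_intros simp: dom_G_def\<close>)
qed simp

text \<open>The function \<open>f\<close> of the proof is locally constant off time \<open>0\<close> and continuous on \<open>[t, 1]\<close>, hence constant. It is \<open>u(t, x)\<close> at the initial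
time and the expectation of the terminal value at time \<open>1\<close>.\<close>

lemma representation:
  assumes sol: "weak_solution \<nu> (t, x) N F w Y" and t: "t < 1" and origin: "(t, x) \<noteq> (0, 0)"
  shows "u (t, x) = (\<integral>\<omega>. terminal \<zeta> (snd (Y (1 - t) \<omega>)) \<partial>N)"
proof -
  interpret S: solution_from_point \<nu> t x N F w Y
    by unfold_locales (use nu sol in auto)
  define f where "f = (\<lambda>s. \<integral>\<omega>. u (s, S.path s \<omega>) \<partial>N)"
  have meas: "(\<lambda>\<omega>. u (s, S.path s \<omega>)) \<in> borel_measurable N" if "s \<in> {t..1}" for s
    by (rule measurable_compose[OF S.path_measurable u_slice_measurable]) (use that in auto)
  have inG: "AE \<omega> in N. (s, S.path s \<omega>) \<in> dom_G" if "s \<in> {t..1}" for s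
  proof (cases "s = 0")
    case True
    then show ?thesis
      using S.path_avoids_origin that origin by (auto elim!: eventually_mono simp: dom_G_def)
  next
    case False
    then show ?thesis using that by (auto intro!: AE_I2 strip_in_dom_G)
  qed
  have const: "f hi = f lo" if "t \<le> lo" "lo \<le> hi" "hi < 1" "0 \<notin> {lo..hi}" for lo hi
  proof -
    note away = that(4)
    obtain K where K: "\<And>r. r \<in> {lo..hi} \<Longrightarrow> drift_coeff \<nu> r \<le> K"
      using drift_coeff_bounded[OF away] by blast
    show ?thesis
      unfolding f_def by (rule expectation_constant[OF S.is_sgn_drift_process[OF that(1,2) K] that(3,4)])
  qed
  have cont_f: "continuous_on {t..1} f"
    unfolding continuous_on_sequentially comp_def
  proof (intro allI ballI impI, elim conjE)
    fix s :: "nat \<Rightarrow> real" and s0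
    assume s0: "s0 \<in> {t..1}" and s: "\<forall>n. s n \<in> {t..1}" and lim: "s \<longlonglongrightarrow> s0"
    \<comment> \<open>at time \<open>0\<close> the bound on \<open>u\<close> is available outside the origin only, hence almost surely\<close>
    have all: "AE \<omega> in N. \<forall>n. (s n, S.path (s n) \<omega>) \<in> dom_G"
      unfolding AE_all_countable using inG s by blast
    show "(\<lambda>n. f (s n)) \<longlonglongrightarrow> f s0"
      unfolding f_def
    proof (rule integral_dominated_convergence[where w="\<lambda>_. M"])
      show "AE \<omega> in N. (\<lambda>n. u (s n, S.path (s n) \<omega>)) \<longlonglongrightarrow> u (s0, S.path s0 \<omega>)"
        using all inG[OF s0]
      proof eventually_elim
        case (elim \<omega>)
        have "(\<lambda>n. S.path (s n) \<omega>) \<longlonglongrightarrow> S.path s0 \<omega>"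
          by (rule continuous_on_tendsto_compose[OF S.path_continuous lim s0]) (use s in auto)
        then have "(\<lambda>n. (s n, S.path (s n) \<omega>)) \<longlonglongrightarrow> (s0, S.path s0 \<omega>)"
          by (intro tendsto_Pair lim)
        from continuous_on_tendsto_compose[OF cont this elim(2)] elim(1) show ?case by simp
      qed
      show "AE \<omega> in N. norm (u (s n, S.path (s n) \<omega>)) \<le> M" for n
        using all by eventually_elim (auto intro: bdd)
    qed (use meas s s0 in auto)
  qed
  have "f 1 = f t"
  proof (rule has_derivative_zero_unique_strong_interval[where k="{t, 0, 1}" and a=t and b=1 and f=f])
    fix s assume "s \<in> {t..1} - {t, 0, 1}"
    then have s: "t < s" "s < 1" "s \<noteq> 0" by auto
    define d where "d = min (min (s - t) (1 - s)) \<bar>s\<bar>"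
    have d: "0 < d" using s by (auto simp: d_def)
    have near: "f y = f s" if "dist y s < d" for y
    proof (cases "y \<le> s")
      case True
      then have "t \<le> y" "0 \<notin> {y..s}"
        using that s by (auto simp: d_def dist_real_def abs_if split: if_splits)
      with const[of y s] True s show ?thesis by simp
    next
      case False
      then have "y < 1" "0 \<notin> {s..y}"
        using that s by (auto simp: d_def dist_real_def abs_if split: if_splits)
      with const[of s y] False s show ?thesis by simp
    qed
    show "(f has_derivative (\<lambda>h. 0)) (at s within {t..1})"
    proof (rule has_derivative_transform_within[where f="\<lambda>_. f s" and d=d])
      show "f s = f y" if "dist y s < d" for y using near[OF that] by simp
    qed (use d s in auto)
  qed (use cont_f t in auto)
  moreover have "f t = u (t, x)"
  proof -
    have "f t = (\<integral>\<omega>. u (t, x) \<partial>N)"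
      unfolding f_def
    proof (rule integral_cong_AE)
      show "AE \<omega> in N. u (t, S.path t \<omega>) = u (t, x)"
        using S.path_start by eventually_elim simp
    qed (use meas[of t] t in auto)
    then show ?thesis by (simp add: S.prob_space)
  qed
  moreover have "f 1 = (\<integral>\<omega>. terminal \<zeta> (snd (Y (1 - t) \<omega>)) \<partial>N)"
    unfolding f_def
  proof (rule integral_cong_AE)
    show "AE \<omega> in N. u (1, S.path 1 \<omega>) = terminal \<zeta> (snd (Y (1 - t) \<omega>))"
      using S.AE_path[of 1] by eventually_elim (simp add: terminal)
    show "(\<lambda>\<omega>. u (1, S.path 1 \<omega>)) \<in> borel_measurable N"
      using meas[of 1] t by simp
    have "(\<lambda>\<omega>. u (1, snd (Y (1 - t) \<omega>))) \<in> borel_measurable N"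
      by (rule measurable_compose[OF S.Y_measurable u_slice_measurable]) (use t in auto)
    then show "(\<lambda>\<omega>. terminal \<zeta> (snd (Y (1 - t) \<omega>))) \<in> borel_measurable N"
      by (simp add: terminal)
  qed
  ultimately show ?thesis by simp
qed

end

text \<open>Only the one-dimensional marginals of the law of the trajectories matter for the representation.\<close>

lemma expectation_path_law:
  fixes X :: "real \<Rightarrow> 'w \<Rightarrow> real \<times> real" and h :: "real \<times> real \<Rightarrow> real"
  assumes X: "\<And>r. 0 \<le> r \<Longrightarrow> X r \<in> borel_measurable M" and h: "h \<in> borel_measurable borel" and s: "0 \<le> s"
  shows "(\<integral>\<phi>. h (\<phi> s) \<partial>path_law M X) = (\<integral>\<omega>. h (X s \<omega>) \<partial>M)"
proof -
  have "(\<lambda>\<omega>. \<lambda>s\<in>{0..}. X s \<omega>) \<in> M \<rightarrow>\<^sub>M (\<Pi>\<^sub>M s\<in>{0..}. borel)"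
    by (rule measurable_restrict) (use X in auto)
  moreover have "(\<lambda>\<phi>. h (\<phi> s)) \<in> borel_measurable (\<Pi>\<^sub>M s\<in>{0..}. borel)"
    by (rule measurable_compose[where g=h, OF _ h]) (rule measurable_component_singleton, use s in simp)
  ultimately show ?thesis
    unfolding path_law_def by (subst integral_distr) (use s in auto)
qed

theorem theorem5:
  fixes \<nu> :: real and \<zeta> :: "real \<Rightarrow> real" and u :: "real \<times> real \<Rightarrow> real"
  assumes "1/2 < \<nu>" and "\<nu> < 1"
    and "cutoff \<zeta>"
    and "is_solution_u \<nu> (terminal \<zeta>) u"
  shows "(\<forall>(M :: 'w measure) F X P. L_process TYPE('v) \<nu> M F X P \<longrightarrow>
            (\<forall>t x. t < 1 \<and> (t, x) \<noteq> (0, 0) \<longrightarrow>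
               u (t, x) = (\<integral>\<omega>. terminal \<zeta> (snd (X (1 - t) \<omega>)) \<partial>P (t, x)))) \<and>
         \<not> (\<exists>l. (u \<longlongrightarrow> l) (at (0, 0)))"
proof -
  obtain q B where "odd_solution \<nu> \<zeta> u (Dx u) q B"
    using is_solution_u_imp_odd_solution[OF assms] by blast
  then interpret odd_solution \<nu> \<zeta> u "Dx u" q B .
  have "u (t, x) = (\<integral>\<omega>. terminal \<zeta> (snd (X (1 - t) \<omega>)) \<partial>P (t, x))"
    if L: "L_process TYPE('v) \<nu> M F X P" and t: "t < 1" and tx: "(t, x) \<noteq> (0, 0)"
    for M :: "'w measure" and F X P t x
  proof -
    have "strong_Markov_diffusion M F X P"
      using L unfolding L_process_def by (rule conjunct1)
    then have F: "filtration_on M F" and adapted: "adapted F X"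
      and P: "\<forall>z. prob_space (P z) \<and> sets (P z) = sets M \<and> (AE \<omega> in P z. X 0 \<omega> = z)"
      unfolding strong_Markov_diffusion_def by - (elim conjE, assumption)+
    have X: "X r \<in> borel_measurable (P (t, x))" if "0 \<le> r" for r
      by (rule measurable_from_filtration[OF F]) (use adapted P that in \<open>auto simp: adapted_def\<close>)
    obtain N :: "'v measure" and F' w Y where sol: "weak_solution \<nu> (t, x) N F' w Y"
        and law: "path_law (P (t, x)) X = path_law N Y"
      using L unfolding L_process_def by blast
    have Y: "Y r \<in> borel_measurable N" if "0 \<le> r" for r
      using sol that measurable_from_filtration[OF wiener_filtration, of N F' w "Y r" "ennreal r" N]
      by (simp add: weak_solution_def adapted_def)
    have "(\<lambda>z :: real \<times> real. u (1, snd z)) \<in> borel_measurable borel"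
      by (rule measurable_compose[OF _ u_slice_measurable]) (simp_all add: borel_measurable_continuous_onI continuous_on_snd)
    then have g: "(\<lambda>z :: real \<times> real. terminal \<zeta> (snd z)) \<in> borel_measurable borel"
      by (simp add: terminal)
    have "u (t, x) = (\<integral>\<omega>. terminal \<zeta> (snd (Y (1 - t) \<omega>)) \<partial>N)"
      by (rule representation[OF sol t tx])
    also have "\<dots> = (\<integral>\<phi>. terminal \<zeta> (snd (\<phi> (1 - t))) \<partial>path_law (P (t, x)) X)"
      unfolding law using expectation_path_law[OF Y g, where s="1 - t"] t by simp
    also have "\<dots> = (\<integral>\<omega>. terminal \<zeta> (snd (X (1 - t) \<omega>)) \<partial>P (t, x))"
      using expectation_path_law[OF X g, where s="1 - t"] t by simp
    finally show ?thesis .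
  qed
  then show ?thesis
    using no_limit_at_origin by blast
qed

end
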